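(* Let $0<p<\infty$, $\alpha>-1$, and let $\mu$ be a positive Borel measure on $[0,1)$ satisfying condition $(W_{p,\alpha})$. (i) If $q\ge p$ and $q>1$, then $\mathcal{H}_{\mu,\alpha+2}$ is a bounded operator from $A^p_\alpha$ into $A^q_\alpha$ if and only if $\mu$ is a $\left(\frac{\alpha+2}{p}+\frac{\alpha+2}{q'}\right)$-Carleson measure. (ii) If $q\ge p$ and $q=1$, then $\mathcal{H}_{\mu,\alpha+2}$ is a bounded operator from $A^p_\alpha$ into $A^1_\alpha$ if and only if $\mu$ is a $1$-logarithmic $\frac{\alpha+2}{p}$-Carleson measure.
   Context: $\mathbb{D}$ is the open unit disc, $dA=\frac1\pi dx\,dy$. For $0<p<\infty$, $\alpha>-1$, $A^p_\alpha$ is the space of analytic $f$ on $\mathbb{D}$ with $\|f\|_{A^p_\alpha}=\left((\alpha+1)\int_{\mathbb{D}}|f|^p(1-|z|^2)^\alpha dA\right)^{1/p}<\infty$. For $q>1$, $1/q+1/q'=1$. For a positive Borel measure $\mu$ on $[0,1)$ and $\beta>0$, $\mu_{n,k,\beta}=\frac{\Gamma(n+\beta)}{n!\Gamma(\beta)}\int_{[0,1)}t^{n+k}d\mu(t)$ and for $f(z)=\sum_k a_kz^k$ analytic, $\mathcal{H}_{\mu,\beta}(f)(z)=\sum_n\left(\sum_k\mu_{n,k,\beta}a_k\right)z^n$. Boundedness from $X$ into $Y$ means $\mathcal{H}_{\mu,\beta}(f)$ is defined and lies in $Y$ for all $f\in X$ with $\|\mathcal{H}_{\mu,\beta}(f)\|_Y\le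 C\|f\|_X$. A measure $\mu$ on $[0,1)$ is regarded as a measure on $\mathbb{D}$ via $\mu(E)=\mu(E\cap[0,1))$. For an arc $I\subset\partial\mathbb{D}$, $S(I)=\{re^{i\theta}:e^{i\theta}\in I,\ 1-\frac{|I|}{2\pi}\le r\le1\}$. For $s>0$, $\mu$ is an $s$-Carleson measure if $\mu([t,1))\le C(1-t)^s$ for $0\le t<1$ (equivalently $\mu(S(I))\le C|I|^s$), and a $\gamma$-logarithmic $s$-Carleson measure ($\gamma\ge0$) if $\mu(S(I))\left(\log\frac{2\pi}{|I|}\right)^\gamma\le C|I|^s$ for all arcs $I$. Condition $(W_{p,\alpha})$: if $0<p\le1$, $\mu$ is a $\frac{\alpha+2}{p}$-Carleson measure; if $1\le p\le 2$, $\mu$ is a $\frac{\alpha+2-(p-1)^2}{p}$-Carleson measure; if $2\le p<\infty$, $\mu$ is a $\frac{\alpha+1}{p}$-Carleson measure. *)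

theory Defs
  imports "HOL-Analysis.Analysis" "HOL-Complex_Analysis.Complex_Analysis"
begin

(* Weighted Bergman space A^p_alpha: analytic on the unit disc with finite weighted integral.
   dA = (1/pi) dx dy; lborel on complex is planar Lebesgue measure dx dy. *)
definition bergman_integral :: "real \<Rightarrow> real \<Rightarrow> (complex \<Rightarrow> complex) \<Rightarrow> ennreal" where
  "bergman_integral p \<alpha> f =
     (\<integral>\<^sup>+ z. indicator (ball 0 1) z *
        ennreal (norm (f z) powr p * (1 - (norm z)\<^sup>2) powr \<alpha>) \<partial>lborel)"

definition in_bergman :: "real \<Rightarrow> real \<Rightarrow> (complex \<Rightarrow> complex) \<Rightarrow> bool" where
  "in_bergman p \<alpha> f \<longleftrightarrow> f holomorphic_on ball 0 1 \<and> bergman_integral p \<alpha> f < \<infinity>"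

definition bergman_norm :: "real \<Rightarrow> real \<Rightarrow> (complex \<Rightarrow> complex) \<Rightarrow> real" where
  "bergman_norm p \<alpha> f = ((\<alpha> + 1) * (1 / pi) * enn2real (bergman_integral p \<alpha> f)) powr (1 / p)"

definition taylor_coeff :: "(complex \<Rightarrow> complex) \<Rightarrow> nat \<Rightarrow> complex" where
  "taylor_coeff f k = (deriv ^^ k) f 0 / of_nat (fact k)"

definition hilb_coef :: "real measure \<Rightarrow> real \<Rightarrow> nat \<Rightarrow> nat \<Rightarrow> real" where
  "hilb_coef \<mu> \<beta> n k =
     Gamma (real n + \<beta>) / (fact n * Gamma \<beta>) * (\<integral>t. t ^ (n + k) \<partial>\<mu>)"

definition hilb_inner :: "real measure \<Rightarrow> real \<Rightarrow> (complex \<Rightarrow> complex) \<Rightarrow> nat \<Rightarrow> complex" where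
  "hilb_inner \<mu> \<beta> f n = (\<Sum>k. complex_of_real (hilb_coef \<mu> \<beta> n k) * taylor_coeff f k)"

definition hilb_defined :: "real measure \<Rightarrow> real \<Rightarrow> (complex \<Rightarrow> complex) \<Rightarrow> bool" where
  "hilb_defined \<mu> \<beta> f \<longleftrightarrow>
     (\<forall>n. summable (\<lambda>k. complex_of_real (hilb_coef \<mu> \<beta> n k) * taylor_coeff f k)) \<and>
     (\<forall>z\<in>ball 0 1. summable (\<lambda>n. hilb_inner \<mu> \<beta> f n * z ^ n))"

definition hilb_op :: "real measure \<Rightarrow> real \<Rightarrow> (complex \<Rightarrow> complex) \<Rightarrow> complex \<Rightarrow> complex" where
  "hilb_op \<mu> \<beta> f z = (\<Sum>n. hilb_inner \<mu> \<beta> f n * z ^ n)"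

definition hilb_bounded :: "real measure \<Rightarrow> real \<Rightarrow> real \<Rightarrow> real \<Rightarrow> real \<Rightarrow> real \<Rightarrow> bool" where
  "hilb_bounded \<mu> \<beta> p \<alpha> q \<alpha>' \<longleftrightarrow>
     (\<exists>C. \<forall>f. in_bergman p \<alpha> f \<longrightarrow>
        hilb_defined \<mu> \<beta> f \<and> in_bergman q \<alpha>' (hilb_op \<mu> \<beta> f) \<and>
        bergman_norm q \<alpha>' (hilb_op \<mu> \<beta> f) \<le> C * bergman_norm p \<alpha> f)"

definition carleson :: "real \<Rightarrow> real measure \<Rightarrow> bool" where
  "carleson s \<mu> \<longleftrightarrow>
     (\<exists>C. \<forall>t. 0 \<le> t \<and> t < 1 \<longrightarrow> emeasure \<mu> {t..<1} \<le> ennreal (C * (1 - t) powr s))"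

(* Carleson box S(I) for the closed arc I = {e^{i theta} : a <= theta <= a + L}, |I| = L *)
definition carleson_box :: "real \<Rightarrow> real \<Rightarrow> complex set" where
  "carleson_box a L = {complex_of_real r * cis \<theta> | r \<theta>.
      a \<le> \<theta> \<and> \<theta> \<le> a + L \<and> 1 - L / (2 * pi) \<le> r \<and> r \<le> 1}"

(* gamma-logarithmic s-Carleson measure; mu viewed on the disc via mu(E) = mu(E \<inter> [0,1)) *)
definition log_carleson :: "real \<Rightarrow> real \<Rightarrow> real measure \<Rightarrow> bool" where
  "log_carleson \<gamma> s \<mu> \<longleftrightarrow>
     (\<exists>C. \<forall>a L. 0 < L \<and> L \<le> 2 * pi \<longrightarrow>
        emeasure \<mu> {t. 0 \<le> t \<and> t < 1 \<and> complex_of_real t \<in> carleson_box a L} *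
          ennreal (if \<gamma> = 0 then 1 else (ln (2 * pi / L)) powr \<gamma>)
        \<le> ennreal (C * L powr s))"

definition cond_W :: "real \<Rightarrow> real \<Rightarrow> real measure \<Rightarrow> bool" where
  "cond_W p \<alpha> \<mu> \<longleftrightarrow>
     (0 < p \<and> p \<le> 1 \<longrightarrow> carleson ((\<alpha> + 2) / p) \<mu>) \<and>
     (1 \<le> p \<and> p \<le> 2 \<longrightarrow> carleson ((\<alpha> + 2 - (p - 1)\<^sup>2) / p) \<mu>) \<and>
     (2 \<le> p \<longrightarrow> carleson ((\<alpha> + 1) / p) \<mu>)"

end

theory Submission
  imports Defs
begin

text \<open>
  Let \<open>e = \<alpha> + 2\<close>. Absolute convergence gives
  \<open>H f z = (\<integral>t. f t (1 - t z) powr (-e) \<partial>\<mu>)\<close>, and everything is read off dyadically at the point 1.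
  Subharmonicity of \<open>|f| powr p\<close> shows that on \<open>I j = [1 - 1/2^j, 1 - 1/2^(j+1))\<close> one has
  \<open>|f| \<le> b j * 2 powr (j e / p)\<close> with \<open>(\<Sum>j. b j powr p)\<close> controlled by the Bergman norm. On the ring
  \<open>|1 - z| \<approx> 1/2^i\<close> the kernel is at most a constant times \<open>2 powr (e min(i, j))\<close>, and the ring
  has weighted area \<open>O(2 powr (-i e))\<close>; so the norm of \<open>H f\<close> is that of \<open>b\<close> under a discrete
  convolution, bounded by a Schur test. For \<open>q = 1\<close> the kernel does not decay for \<open>j > i\<close>, its
  column sums grow like \<open>j\<close>, and this is what the logarithm in the Carleson condition pays for.

  Conversely, for \<open>f = (1 - r) powr (n - e/p) / (1 - r z)^n\<close> the integrand is positive at real points,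
  so \<open>H f (1 - 1/2^i)\<close> is bounded below by \<open>\<mu> [r, 1) (1 - r) powr (-e/p) 2 powr (i e)\<close> as long as
  \<open>1/2^i \<ge> 1 - r\<close>. The point evaluation at \<open>r\<close> gives the Carleson condition for \<open>q > 1\<close>;
  summing over all such \<open>i\<close> gives the logarithm for \<open>q = 1\<close>.
\<close>

section \<open>Rotation averages\<close>

text \<open>The measure lives on one radius, so only distances to the point 1 matter. With
  \<open>u = e / q\<close> and \<open>v = e (1 - 1 / q)\<close> the Carleson exponent is
  \<open>e / p + v\<close>, and after normalisation the discrete kernel decays like
  \<open>2 powr (- u (i - j))\<close> for \<open>j \<le> i\<close> and like
  \<open>2 powr (- v (j - i))\<close> for \<open>j > i\<close>. Both tails decay when
  \<open>q > 1\<close>, whereas \<open>q = 1\<close> means \<open>v = 0\<close>. The hypothesis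
  \<open>p \<le> q\<close> enters as the inclusion of \<open>l^p\<close> in \<open>l^q\<close> and,
  for \<open>p > 1\<close>, in the convergence of the coefficient series. That convergence is an
  obstacle of its own: the operator is defined through Taylor coefficients, so the integral formula
  needs more than bounds on the modulus of \<open>f\<close>. It comes from an embedding into a
  weighted space of exponent 1 whose weight exponent is the Carleson exponent minus 2; annuli
  matched to the dyadic intervals then control the coefficients. The dyadic majorant serves both
  directions: it is applied to \<open>f\<close> with exponent \<open>p\<close> for sufficiency and
  to the image of the test function with exponent \<open>q\<close> for necessity.\<close>

lemma lborel_complex_prod:
  "distr (lborel \<Otimes>\<^sub>M lborel) borel (\<lambda>(x, y). Complex x y) = lborel"
proof -
  have m: "(\<lambda>(x, y). Complex x y) \<in> lborel \<Otimes>\<^sub>M lborel \<rightarrow>\<^sub>M borel"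
    unfolding split_beta Complex_eq by measurable
  show ?thesis
  proof (rule sym, rule lborel_eqI)
    fix l u :: complex
    assume lu: "\<And>b. b \<in> Basis \<Longrightarrow> l \<bullet> b \<le> u \<bullet> b"
    then have le: "Re l \<le> Re u" "Im l \<le> Im u"
      using lu[of 1] lu[of \<i>] by (simp_all add: Basis_complex_def)
    have "(\<lambda>(x, y). Complex x y) -` box l u \<inter> space (lborel \<Otimes>\<^sub>M lborel)
        = {Re l<..<Re u} \<times> {Im l<..<Im u}"
      by (auto simp: box_def Basis_complex_def space_pair_measure)
    then have "emeasure (distr (lborel \<Otimes>\<^sub>M lborel) borel (\<lambda>(x, y). Complex x y)) (box l u)
        = emeasure (lborel \<Otimes>\<^sub>M lborel) ({Re l<..<Re u} \<times> {Im l<..<Im u})"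
      by (simp add: emeasure_distr[OF m])
    also have "\<dots> = ennreal (Re u - Re l) * ennreal (Im u - Im l)"
      using le by (subst lborel.emeasure_pair_measure_Times) auto
    also have "\<dots> = ennreal (\<Prod>b\<in>Basis. (u - l) \<bullet> b)"
      using le by (simp add: Basis_complex_def ennreal_mult' complex_i_not_one)
    finally show "emeasure (distr (lborel \<Otimes>\<^sub>M lborel) borel (\<lambda>(x, y). Complex x y)) (box l u)
        = ennreal (\<Prod>b\<in>Basis. (u - l) \<bullet> b)" .
  qed simp
qed

lemma borel_measurable_Complex [measurable]: "(\<lambda>(x, y). Complex x y) \<in> borel \<Otimes>\<^sub>M borel \<rightarrow>\<^sub>M borel"
  unfolding split_beta Complex_eq by measurable

text \<open>Both orders of integration are kept because a shear is a translation of the inner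
  integral only in the order that freezes the other coordinate.\<close>

lemma nn_integral_complex_iterated:
  fixes g :: "complex \<Rightarrow> ennreal"
  assumes [measurable]: "g \<in> borel_measurable borel"
  shows "(\<integral>\<^sup>+z. g z \<partial>lborel) = (\<integral>\<^sup>+x. \<integral>\<^sup>+y. g (Complex x y) \<partial>lborel \<partial>lborel)"
    and "(\<integral>\<^sup>+z. g z \<partial>lborel) = (\<integral>\<^sup>+y. \<integral>\<^sup>+x. g (Complex x y) \<partial>lborel \<partial>lborel)"
proof -
  have [measurable]: "(\<lambda>(x, y). Complex x y) \<in> lborel \<Otimes>\<^sub>M lborel \<rightarrow>\<^sub>M borel"
    unfolding split_beta Complex_eq by measurable
  have "(\<integral>\<^sup>+z. g z \<partial>lborel) = (\<integral>\<^sup>+z. g z \<partial>distr (lborel \<Otimes>\<^sub>M lborel) borel (\<lambda>(x, y). Complex x y))"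
    by (simp add: lborel_complex_prod)
  also have "\<dots> = (\<integral>\<^sup>+w. g (Complex (fst w) (snd w)) \<partial>(lborel \<Otimes>\<^sub>M lborel))"
    by (subst nn_integral_distr) (simp_all add: split_beta)
  finally have 1: "(\<integral>\<^sup>+z. g z \<partial>lborel) = (\<integral>\<^sup>+w. g (Complex (fst w) (snd w)) \<partial>(lborel \<Otimes>\<^sub>M lborel))" .
  have m: "(\<lambda>w. g (Complex (fst w) (snd w))) \<in> borel_measurable (lborel \<Otimes>\<^sub>M lborel)"
    by (simp add: Complex_eq)
  show "(\<integral>\<^sup>+z. g z \<partial>lborel) = (\<integral>\<^sup>+x. \<integral>\<^sup>+y. g (Complex x y) \<partial>lborel \<partial>lborel)"
    using lborel.nn_integral_fst[OF m] 1 by simp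
  show "(\<integral>\<^sup>+z. g z \<partial>lborel) = (\<integral>\<^sup>+y. \<integral>\<^sup>+x. g (Complex x y) \<partial>lborel \<partial>lborel)"
    using lborel_pair.nn_integral_snd[of "\<lambda>w. g (Complex (fst w) (snd w))"] m 1 by (simp add: split_beta)
qed

lemma nn_integral_real_translate:
  fixes g :: "real \<Rightarrow> ennreal"
  assumes [measurable]: "g \<in> borel_measurable borel"
  shows "(\<integral>\<^sup>+x. g (x + a) \<partial>lborel) = (\<integral>\<^sup>+x. g x \<partial>lborel)"
  using nn_integral_real_affine[of g 1 a] by (simp add: add.commute)

lemma nn_integral_shear_Re:
  fixes g :: "complex \<Rightarrow> ennreal"
  assumes [measurable]: "g \<in> borel_measurable borel"
  shows "(\<integral>\<^sup>+z. g (Complex (Re z + a * Im z) (Im z)) \<partial>lborel) = (\<integral>\<^sup>+z. g z \<partial>lborel)"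
  using nn_integral_real_translate[of "\<lambda>x. g (Complex x _)" "a * _"]
  by (subst (1 2) nn_integral_complex_iterated(2)) (simp_all add: Complex_eq)

lemma nn_integral_shear_Im:
  fixes g :: "complex \<Rightarrow> ennreal"
  assumes [measurable]: "g \<in> borel_measurable borel"
  shows "(\<integral>\<^sup>+z. g (Complex (Re z) (Im z + a * Re z)) \<partial>lborel) = (\<integral>\<^sup>+z. g z \<partial>lborel)"
  using nn_integral_real_translate[of "\<lambda>y. g (Complex _ y)" "a * _"]
  by (subst (1 2) nn_integral_complex_iterated(1)) (simp_all add: Complex_eq)

text \<open>A rotation by an angle that is not a multiple of \<open>\<pi>\<close> is a product of three shears.\<close>

lemma nn_integral_rotate:
  fixes g :: "complex \<Rightarrow> ennreal"
  assumes [measurable]: "g \<in> borel_measurable borel" and "norm u = 1"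
  shows "(\<integral>\<^sup>+z. g (u * z) \<partial>lborel) = (\<integral>\<^sup>+z. g z \<partial>lborel)"
proof -
  have *: "(\<integral>\<^sup>+z. h (v * z) \<partial>lborel) = (\<integral>\<^sup>+z. h z \<partial>lborel)"
    if [measurable]: "h \<in> borel_measurable borel" and v: "norm v = 1" "Im v \<noteq> 0"
    for h :: "complex \<Rightarrow> ennreal" and v
  proof -
    \<comment> \<open>\<open>t\<close> is the tangent of half the rotation angle, which is the slope
      in the factorisation of a rotation into shears; \<open>Im v\<close> is the slope of the middle
      one.\<close>
    define t where "t = (1 - Re v) / Im v"
    have n: "Re v ^ 2 + Im v ^ 2 = 1"
      using v(1) by (metis cmod_power2 one_power2)
    have t1: "t * Im v = 1 - Re v"
      using v by (simp add: t_def)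
    have "Im v * (t * (1 + Re v)) = (1 - Re v) * (1 + Re v)"
      unfolding t1[symmetric] by (simp add: algebra_simps)
    also have "\<dots> = Im v * Im v"
      using n by (simp add: algebra_simps power2_eq_square)
    finally have t2: "t * (1 + Re v) = Im v"
      using v by simp
    define F where "F = (\<lambda>z. Complex (Re z + (- t) * Im z) (Im z))"
    define G where "G = (\<lambda>z. Complex (Re z) (Im z + Im v * Re z))"
    have [measurable]: "F \<in> borel_measurable borel" "G \<in> borel_measurable borel"
      by (simp_all add: F_def G_def Complex_eq)
    have "F (G (F z)) = v * z" for z
    proof (rule complex_eqI)
      have "Re (F (G (F z))) = Re z * (1 - t * Im v) - Im z * (t * (1 + (1 - t * Im v)))"
        by (simp add: F_def G_def algebra_simps)
      then show "Re (F (G (F z))) = Re (v * z)"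
        using t1 t2 by simp
      have "Im (F (G (F z))) = Im z * (1 - t * Im v) + Im v * Re z"
        by (simp add: F_def G_def algebra_simps)
      then show "Im (F (G (F z))) = Im (v * z)"
        using t1 by simp
    qed
    then have "(\<integral>\<^sup>+z. h (v * z) \<partial>lborel) = (\<integral>\<^sup>+z. h (F (G (F z))) \<partial>lborel)"
      by simp
    also have "\<dots> = (\<integral>\<^sup>+z. h (F (G z)) \<partial>lborel)"
      using nn_integral_shear_Re[of "\<lambda>z. h (F (G z))" "-t"] by (simp add: F_def)
    also have "\<dots> = (\<integral>\<^sup>+z. h (F z) \<partial>lborel)"
      using nn_integral_shear_Im[of "\<lambda>z. h (F z)" "Im v"] by (simp add: G_def)
    also have "\<dots> = (\<integral>\<^sup>+z. h z \<partial>lborel)"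
      using nn_integral_shear_Re[of h "-t"] by (simp add: F_def)
    finally show ?thesis .
  qed
  show ?thesis
  proof (cases "Im u = 0")
    case False
    then show ?thesis using * assms by simp
  next
    \<comment> \<open>Here \<open>u\<close> is 1 or -1. Splitting off the factor \<open>\<i>\<close>
      leaves two unimodular factors off the real axis, and the shear argument applies to
      each.\<close>
    case True
    have "(\<integral>\<^sup>+z. g (u * z) \<partial>lborel) = (\<integral>\<^sup>+z. g (u * (- \<i>) * (\<i> * z)) \<partial>lborel)"
      by (simp add: algebra_simps)
    also have "\<dots> = (\<integral>\<^sup>+z. g (u * (- \<i>) * z) \<partial>lborel)"
      by (rule *) auto
    also have "\<dots> = (\<integral>\<^sup>+z. g z \<partial>lborel)"
      using True assms by (intro *) (auto simp: norm_mult cmod_def)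
    finally show ?thesis .
  qed
qed

lemma nn_integral_complex_translate:
  fixes g :: "complex \<Rightarrow> ennreal"
  assumes [measurable]: "g \<in> borel_measurable borel"
  shows "(\<integral>\<^sup>+z. g (a + z) \<partial>lborel) = (\<integral>\<^sup>+z. g z \<partial>lborel)"
proof -
  have "(\<integral>\<^sup>+z. g z \<partial>lborel) = (\<integral>\<^sup>+z. g z \<partial>distr lborel borel ((+) a))"
    by (simp add: lborel_distr_plus)
  then show ?thesis
    by (simp add: nn_integral_distr)
qed

text \<open>Rotation invariance under Fubini. The angle range \<open>L\<close> is left free:
  coefficient estimates use the full circle, the tent bound uses \<open>L = 1\<close>.\<close>

lemma nn_integral_average_rotations:
  fixes g :: "complex \<Rightarrow> ennreal"
  assumes [measurable]: "g \<in> borel_measurable borel" and "0 \<le> L"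
  shows "(\<integral>\<^sup>+z. (\<integral>\<^sup>+\<theta>. indicator {0..L} \<theta> * g (z * cis \<theta>) \<partial>lborel) \<partial>lborel)
    = ennreal L * (\<integral>\<^sup>+z. g z \<partial>lborel)"
proof -
  have [measurable]: "cis \<in> borel_measurable borel"
    by (intro borel_measurable_continuous_onI continuous_intros)
  have "(\<integral>\<^sup>+z. (\<integral>\<^sup>+\<theta>. indicator {0..L} \<theta> * g (z * cis \<theta>) \<partial>lborel) \<partial>lborel)
      = (\<integral>\<^sup>+\<theta>. (\<integral>\<^sup>+z. indicator {0..L} \<theta> * g (z * cis \<theta>) \<partial>lborel) \<partial>lborel)"
    by (rule lborel_pair.Fubini'[symmetric]) measurable
  also have "\<dots> = (\<integral>\<^sup>+\<theta>. indicator {0..L} \<theta> * (\<integral>\<^sup>+z. g z \<partial>lborel) \<partial>lborel)"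
    using nn_integral_rotate[of g "cis _"]
    by (intro nn_integral_cong) (simp add: nn_integral_cmult mult.commute)
  also have "\<dots> = ennreal L * (\<integral>\<^sup>+z. g z \<partial>lborel)"
    using assms by (simp add: nn_integral_multc)
  finally show ?thesis .
qed

section \<open>Circle and area means of Taylor coefficients\<close>

lemma norm_integral_le_nn_integral:
  fixes F :: "real \<Rightarrow> 'a :: euclidean_space"
  assumes "continuous_on {a..b} F"
  shows "ennreal (norm (integral {a..b} F)) \<le> (\<integral>\<^sup>+\<theta>. indicator {a..b} \<theta> * ennreal (norm (F \<theta>)) \<partial>lborel)"
proof -
  have si: "set_integrable lborel {a..b} F"
    by (rule borel_integrable_atLeastAtMost'[OF assms])
  then have "integral {a..b} F = integral\<^sup>L lborel (\<lambda>\<theta>. indicator {a..b} \<theta> *\<^sub>R F \<theta>)"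
    using set_borel_integral_eq_integral(2)[OF si] by (simp add: set_lebesgue_integral_def)
  also have "ennreal (norm \<dots>) \<le> (\<integral>\<^sup>+\<theta>. norm (indicator {a..b} \<theta> *\<^sub>R F \<theta>) \<partial>lborel)"
    using si unfolding set_integrable_def by (rule integral_norm_bound_ennreal)
  also have "\<dots> = (\<integral>\<^sup>+\<theta>. indicator {a..b} \<theta> * ennreal (norm (F \<theta>)) \<partial>lborel)"
    by (intro nn_integral_cong) (simp split: split_indicator)
  finally show ?thesis .
qed

text \<open>Cauchy's formula for the \<open>k\<close>-th derivative. The circle is based at
  \<open>w\<close> instead of the positive number \<open>norm w\<close>, so that the right side is a
  rotation average in \<open>w\<close> and can be integrated over \<open>w\<close>
  afterwards.\<close>

lemma norm_deriv_le_circle_mean: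
  assumes hol: "f holomorphic_on ball z0 R" and w: "norm w < R"
  shows "ennreal (2 * pi * (norm ((deriv ^^ k) f z0 / fact k) * norm w ^ k))
    \<le> (\<integral>\<^sup>+\<theta>. indicator {0..2 * pi} \<theta> * ennreal (norm (f (z0 + w * cis \<theta>))) \<partial>lborel)"
proof (cases "w = 0")
  case True
  then show ?thesis
    by (cases k) (auto simp: nn_integral_multc ennreal_mult'')
next
  case False
  define r where "r = norm w"
  define u where "u = w / r"
  have r: "0 < r" "r < R" and u: "norm u = 1" "w = u * r"
    using False w by (auto simp: r_def u_def norm_divide)
  \<comment> \<open>Turning by \<open>u\<close> and moving \<open>z0\<close> to 0 turns the circle
    into one about 0 that starts at the positive number \<open>r\<close>.\<close>
  define g where "g = (\<lambda>z. f (u * z + z0))"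
  have img: "(\<lambda>z. u * z + z0) ` ball 0 R \<subseteq> ball z0 R"
    using u by (auto simp: dist_norm norm_mult)
  have hg: "g holomorphic_on ball 0 R"
    unfolding g_def by (rule holomorphic_on_compose_gen[OF _ hol img, unfolded o_def])
       (auto intro!: holomorphic_intros)
  have dg: "(deriv ^^ k) g 0 = u ^ k * (deriv ^^ k) f z0"
    unfolding g_def
    using r u by (subst higher_deriv_compose_linear'[OF hol, where S = "ball 0 R"])
      (auto simp: dist_norm norm_mult)
  have sub: "cball 0 r \<subseteq> ball 0 R" "ball 0 r \<subseteq> ball (0::complex) R"
    using r by auto
  have cg: "continuous_on (cball 0 r) g" and hg': "g holomorphic_on ball 0 r"
    using holomorphic_on_subset[OF hg] sub holomorphic_on_imp_continuous_on by blast+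
  define F where "F = (\<lambda>\<theta>. g (r * cis \<theta>) * (\<i> * cis \<theta> / cis \<theta> ^ Suc k))"
  have cF: "continuous_on {0..2 * pi} F"
    unfolding F_def
    by (intro continuous_intros continuous_on_compose2[OF cg]) (use r in \<open>auto simp: norm_mult\<close>)
  have "(deriv ^^ k) g 0 = (fact k) / (2 * pi * \<i>) * contour_integral (circlepath 0 r) (\<lambda>u. g u / (u - 0) ^ (Suc k))"
    using r by (intro Cauchy_higher_derivative_integral_circlepath[OF cg hg']) auto
  also have "contour_integral (circlepath 0 r) (\<lambda>u. g u / (u - 0) ^ (Suc k)) =
      integral {0..2 * pi} (\<lambda>\<theta>. F \<theta> * inverse (of_real (r ^ k)))"
    unfolding circlepath_def using r
    by (subst contour_integral_part_circlepath_eq) (auto intro!: integral_cong simp: F_def field_simps)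
  also have "\<dots> = integral {0..2 * pi} F * inverse (of_real (r ^ k))"
    by (rule integral_mult_left)
  finally have "norm (u ^ k * (deriv ^^ k) f z0)
      = norm ((fact k) / (2 * pi * \<i>) * (integral {0..2 * pi} F * inverse (of_real (r ^ k))))"
    unfolding dg by (rule arg_cong)
  then have "norm ((deriv ^^ k) f z0) = fact k / (2 * pi) * (norm (integral {0..2 * pi} F) * inverse (r ^ k))"
    using r u(1) by (simp add: norm_mult norm_divide norm_power norm_inverse)
  then have "2 * pi * (norm ((deriv ^^ k) f z0 / fact k) * norm w ^ k) = norm (integral {0..2 * pi} F)"
    using r u(1) by (simp add: u(2) norm_mult norm_divide)
  moreover have "norm (F \<theta>) = norm (f (z0 + w * cis \<theta>))" for \<theta>
    by (simp add: F_def g_def u(2) norm_mult norm_divide norm_power algebra_simps)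
  ultimately show ?thesis
    using norm_integral_le_nn_integral[OF cF] by simp
qed

lemma borel_measurable_ind_continuous:
  fixes f :: "'a :: euclidean_space \<Rightarrow> real"
  assumes "continuous_on S f" "S \<in> sets borel"
  shows "(\<lambda>z. indicator S z * ennreal (f z)) \<in> borel_measurable borel"
proof -
  have "(\<lambda>z. ennreal (indicator S z *\<^sub>R f z)) \<in> borel_measurable borel"
    using borel_measurable_continuous_on_indicator[OF assms(2,1)] by measurable
  also have "(\<lambda>z. ennreal (indicator S z *\<^sub>R f z)) = (\<lambda>z. indicator S z * ennreal (f z))"
    by (auto split: split_indicator)
  finally show ?thesis .
qed

text \<open>Averaging over rotations replaces polar coordinates: the circle mean bounds a Taylor
  coefficient, and averaging over a rotation-invariant set leaves the area integral.\<close>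

lemma norm_deriv_le_area_mean:
  assumes hol: "f holomorphic_on ball z0 R" and S: "S \<in> sets borel"
    and SR: "\<And>w. w \<in> S \<Longrightarrow> norm w < R" and inv: "\<And>w \<theta>. w \<in> S \<Longrightarrow> w * cis \<theta> \<in> S"
    and low: "\<And>w. w \<in> S \<Longrightarrow> c \<le> norm w ^ k" and c: "0 \<le> c"
  shows "ennreal (norm ((deriv ^^ k) f z0 / fact k) * c) * emeasure lborel S
    \<le> (\<integral>\<^sup>+w. indicator S w * ennreal (norm (f (z0 + w))) \<partial>lborel)"
proof -
  define g where "g = (\<lambda>w. indicator S w * ennreal (norm (f (z0 + w))))"
  have "continuous_on S (\<lambda>w. norm (f (z0 + w)))"
    by (intro continuous_on_norm continuous_on_compose2[OF holomorphic_on_imp_continuous_on[OF hol]])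
       (auto intro!: continuous_intros SR simp: dist_norm)
  then have [measurable]: "g \<in> borel_measurable borel"
    unfolding g_def using S by (rule borel_measurable_ind_continuous)
  have ci: "w * cis \<theta> \<in> S \<longleftrightarrow> w \<in> S" for w \<theta>
    using inv[of w \<theta>] inv[of "w * cis \<theta>" "- \<theta>"] by (auto simp: cis_mult mult.assoc)
  have "ennreal (2 * pi) * (ennreal (norm ((deriv ^^ k) f z0 / fact k) * c) * emeasure lborel S)
     = (\<integral>\<^sup>+w. ennreal (2 * pi * (norm ((deriv ^^ k) f z0 / fact k) * c)) * indicator S w \<partial>lborel)"
    using S c by (simp add: nn_integral_cmult ennreal_mult mult.assoc)
  also have "\<dots> \<le> (\<integral>\<^sup>+w. (\<integral>\<^sup>+\<theta>. indicator {0..2 * pi} \<theta> * g (w * cis \<theta>) \<partial>lborel) \<partial>lborel)"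
  proof (rule nn_integral_mono)
    fix w
    show "ennreal (2 * pi * (norm ((deriv ^^ k) f z0 / fact k) * c)) * indicator S w
      \<le> (\<integral>\<^sup>+\<theta>. indicator {0..2 * pi} \<theta> * g (w * cis \<theta>) \<partial>lborel)"
    proof (cases "w \<in> S")
      case True
      have "ennreal (2 * pi * (norm ((deriv ^^ k) f z0 / fact k) * c))
        \<le> ennreal (2 * pi * (norm ((deriv ^^ k) f z0 / fact k) * norm w ^ k))"
        by (intro ennreal_leI mult_left_mono low True) auto
      also note norm_deriv_le_circle_mean[OF hol SR[OF True]]
      finally show ?thesis
        using True by (simp add: g_def ci)
    qed simp
  qed
  also have "\<dots> = ennreal (2 * pi) * (\<integral>\<^sup>+w. g w \<partial>lborel)"
    by (rule nn_integral_average_rotations) auto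
  finally show ?thesis
    unfolding g_def by (subst (asm) ennreal_mult_le_mult_iff) auto
qed

lemma emeasure_complex_ball: "0 \<le> r \<Longrightarrow> emeasure lborel (ball (z::complex) r) = ennreal (pi * r\<^sup>2)"
  by (simp add: emeasure_ball unit_ball_vol_2)

lemma area_mean_value_ineq:
  assumes hol: "f holomorphic_on ball z0 R" and R: "0 \<le> R"
  shows "ennreal (norm (f z0) * (pi * R\<^sup>2)) \<le> (\<integral>\<^sup>+z. indicator (ball z0 R) z * ennreal (norm (f z)) \<partial>lborel)"
proof -
  have [measurable]: "(\<lambda>z. indicator (ball z0 R) z * ennreal (norm (f z))) \<in> borel_measurable borel"
    by (intro borel_measurable_ind_continuous continuous_on_norm holomorphic_on_imp_continuous_on hol) auto
  have "ennreal (norm ((deriv ^^ 0) f z0 / fact 0) * 1) * emeasure lborel (ball (0::complex) R)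
    \<le> (\<integral>\<^sup>+w. indicator (ball 0 R) w * ennreal (norm (f (z0 + w))) \<partial>lborel)"
    by (rule norm_deriv_le_area_mean[OF hol]) (auto simp: norm_mult)
  also have "\<dots> = (\<integral>\<^sup>+w. indicator (ball z0 R) (z0 + w) * ennreal (norm (f (z0 + w))) \<partial>lborel)"
    by (intro nn_integral_cong) (simp add: indicator_def dist_norm)
  also have "\<dots> = (\<integral>\<^sup>+z. indicator (ball z0 R) z * ennreal (norm (f z)) \<partial>lborel)"
    by (rule nn_integral_complex_translate[where a = z0]) simp
  finally show ?thesis
    using R by (simp add: emeasure_complex_ball ennreal_mult)
qed

section \<open>Subharmonicity of powers of the modulus\<close>

definition bergman_weight :: "real \<Rightarrow> complex \<Rightarrow> real" where
  "bergman_weight \<alpha> z = (1 - (norm z)\<^sup>2) powr \<alpha>"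

lemma bergman_weight_nonneg [simp]: "0 \<le> bergman_weight \<alpha> z"
  by (simp add: bergman_weight_def)

lemma borel_measurable_bergman_weight [measurable]: "bergman_weight \<alpha> \<in> borel_measurable borel"
  unfolding bergman_weight_def by measurable

lemma borel_measurable_ind_norm_powr:
  assumes "f holomorphic_on U" "S \<subseteq> U" "S \<in> sets borel"
  shows "(\<lambda>z. indicator S z * ennreal (norm (f z) powr p)) \<in> borel_measurable borel"
proof -
  have [measurable]: "(\<lambda>z. indicator S z *\<^sub>R f z) \<in> borel_measurable borel"
    using assms by (intro borel_measurable_continuous_on_indicator
      continuous_on_subset[OF holomorphic_on_imp_continuous_on[OF assms(1)]]) auto
  have "(\<lambda>z. indicator S z * ennreal (norm (indicator S z *\<^sub>R f z) powr p)) \<in> borel_measurable borel"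
    using assms(3) by measurable
  also have "(\<lambda>z. indicator S z * ennreal (norm (indicator S z *\<^sub>R f z) powr p))
      = (\<lambda>z. indicator S z * ennreal (norm (f z) powr p))"
    by (auto split: split_indicator)
  finally show ?thesis .
qed

lemma borel_measurable_bergman_integrand:
  assumes "f holomorphic_on U" "S \<subseteq> U" "S \<in> sets borel"
  shows "(\<lambda>z. indicator S z * ennreal (norm (f z) powr p * bergman_weight \<alpha> z)) \<in> borel_measurable borel"
proof -
  note borel_measurable_ind_norm_powr[OF assms, of p, measurable]
  have "(\<lambda>z. (indicator S z * ennreal (norm (f z) powr p)) * ennreal (bergman_weight \<alpha> z)) \<in> borel_measurable borel"
    by measurable
  then show ?thesis by (simp add: ennreal_mult mult.assoc)
qed

lemma ennreal_finiteE:
  assumes "x \<noteq> \<infinity>"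
  obtains r where "0 \<le> r" "x = ennreal r"
  using assms by (cases x) auto

text \<open>An elementary substitute for the Hoelder inequality: beyond \<open>A\<close> the factor
  \<open>x powr (1 - p)\<close> is at most its value at \<open>A\<close>. The scale is free so that
  it can be tuned until the first summand is absorbed on the left of an estimate.\<close>

lemma le_add_powr_scaled:
  fixes x A :: real
  assumes "0 < A" "0 \<le> x" "1 \<le> p"
  shows "x \<le> A + A powr (1 - p) * x powr p"
proof (cases "x \<le> A")
  case True
  then show ?thesis by (simp add: add_increasing2)
next
  case False
  then have "x powr (1 - p) \<le> A powr (1 - p)"
    using assms by (intro powr_mono2') auto
  then have "x powr (1 - p) * x powr p \<le> A powr (1 - p) * x powr p"
    by (intro mult_right_mono) auto
  also have "x powr (1 - p) * x powr p = x"
    using False assms by (simp flip: powr_add)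
  finally show ?thesis using assms by simp
qed

lemma submean_powr_ge1:
  assumes hol: "f holomorphic_on ball z0 R" and R: "0 < R" and p: "1 \<le> p"
  shows "ennreal (norm (f z0) powr p * R\<^sup>2)
    \<le> ennreal (2 powr p) * (\<integral>\<^sup>+z. indicator (ball z0 R) z * ennreal (norm (f z) powr p) \<partial>lborel)"
proof (cases "f z0 = 0 \<or> (\<integral>\<^sup>+z. indicator (ball z0 R) z * ennreal (norm (f z) powr p) \<partial>lborel) = \<infinity>")
  case True
  then show ?thesis by (auto simp: ennreal_mult_top)
next
  case False
  \<comment> \<open>Half the central value: the constant part of the splitting then costs half of
    the mean value bound and is absorbed.\<close>
  define A where "A = norm (f z0) / 2"
  have A: "A > 0" using False by (simp add: A_def)
  obtain I where I: "I \<ge> 0" "(\<integral>\<^sup>+z. indicator (ball z0 R) z * ennreal (norm (f z) powr p) \<partial>lborel) = ennreal I"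
    using False ennreal_finiteE by blast
  have [measurable]: "(\<lambda>z. indicator (ball z0 R) z * ennreal (norm (f z) powr p)) \<in> borel_measurable borel"
    by (intro borel_measurable_ind_norm_powr[OF hol]) auto
  have "ennreal (2 * A * (pi * R\<^sup>2)) \<le> (\<integral>\<^sup>+z. indicator (ball z0 R) z * ennreal (norm (f z)) \<partial>lborel)"
    using area_mean_value_ineq[OF hol] R by (simp add: A_def)
  also have "\<dots> \<le> (\<integral>\<^sup>+z. ennreal A * indicator (ball z0 R) z
      + ennreal (A powr (1 - p)) * (indicator (ball z0 R) z * ennreal (norm (f z) powr p)) \<partial>lborel)"
    using A by (intro nn_integral_mono)
      (auto split: split_indicator intro!: ennreal_leI le_add_powr_scaled p simp flip: ennreal_mult' ennreal_plus)
  also have "\<dots> = ennreal (A * (pi * R\<^sup>2) + A powr (1 - p) * I)"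
  proof (subst nn_integral_add)
    have "(\<integral>\<^sup>+z. ennreal A * indicator (ball z0 R) z \<partial>lborel) = ennreal (A * (pi * R\<^sup>2))"
      using A R by (simp add: nn_integral_cmult_indicator emeasure_complex_ball ennreal_mult)
    moreover have "(\<integral>\<^sup>+z. ennreal (A powr (1 - p)) * (indicator (ball z0 R) z * ennreal (norm (f z) powr p)) \<partial>lborel)
        = ennreal (A powr (1 - p) * I)"
      using I by (simp add: nn_integral_cmult ennreal_mult)
    ultimately show "(\<integral>\<^sup>+z. ennreal A * indicator (ball z0 R) z \<partial>lborel)
        + (\<integral>\<^sup>+z. ennreal (A powr (1 - p)) * (indicator (ball z0 R) z * ennreal (norm (f z) powr p)) \<partial>lborel)
        = ennreal (A * (pi * R\<^sup>2) + A powr (1 - p) * I)"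
      using A I(1) by simp
  qed (measurable, simp_all)
  finally have "2 * A * (pi * R\<^sup>2) \<le> A * (pi * R\<^sup>2) + A powr (1 - p) * I"
    using A I by (subst (asm) ennreal_le_iff) auto
  then have "A powr (p - 1) * (A * (pi * R\<^sup>2)) \<le> A powr (p - 1) * (A powr (1 - p) * I)"
    by (intro mult_left_mono) auto
  then have "A powr p * (pi * R\<^sup>2) \<le> I"
    using A by (simp add: powr_diff flip: powr_add mult.assoc)
  moreover have "A powr p * R\<^sup>2 \<le> A powr p * (pi * R\<^sup>2)"
    using pi_ge_two by (intro mult_left_mono mult_right_mono[of 1 pi, simplified]) auto
  ultimately have "A powr p * R\<^sup>2 \<le> I" by simp
  then have "2 powr p * A powr p * R\<^sup>2 \<le> 2 powr p * I" by simp
  also have "2 powr p * A powr p = norm (f z0) powr p"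
    by (simp add: A_def flip: powr_mult)
  finally show ?thesis
    using I by (simp flip: ennreal_mult)
qed

text \<open>For \<open>p < 1\<close> the mean value inequality is applied where
  \<open>(R - |z - z0|) powr (2 / p) * |f z|\<close> is maximal.\<close>

lemma submean_powr_lt1:
  assumes hol: "f holomorphic_on ball z0 R" and R: "0 < R" and p: "0 < p" "p < 1"
  shows "ennreal (norm (f z0) powr p * R\<^sup>2)
    \<le> ennreal (4 * 2 powr (2 / p)) * (\<integral>\<^sup>+z. indicator (ball z0 R) z * ennreal (norm (f z) powr p) \<partial>lborel)"
proof (cases "f z0 = 0 \<or> (\<integral>\<^sup>+z. indicator (ball z0 R) z * ennreal (norm (f z) powr p) \<partial>lborel) = \<infinity>")
  case True
  then show ?thesis by (auto simp: ennreal_mult_top)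
next
  case False
  obtain I where I: "I \<ge> 0" "(\<integral>\<^sup>+z. indicator (ball z0 R) z * ennreal (norm (f z) powr p) \<partial>lborel) = ennreal I"
    using False ennreal_finiteE by blast
  have [measurable]: "(\<lambda>z. indicator (ball z0 R) z * ennreal (norm (f z) powr p)) \<in> borel_measurable borel"
    by (intro borel_measurable_ind_norm_powr[OF hol]) auto
  \<comment> \<open>The smaller radius keeps the closed disc inside the domain, so that
    \<open>\<Phi>\<close> attains its maximum.\<close>
  define r where "r = R / 2"
  have r: "0 < r" "r < R" using R by (auto simp: r_def)
  define \<Phi> where "\<Phi> = (\<lambda>z. (r - dist z z0) powr (2 / p) * norm (f z))"
  have "continuous_on (cball z0 r) \<Phi>"
    unfolding \<Phi>_def
    by (intro continuous_intros continuous_on_powr' continuous_on_subset[OF holomorphic_on_imp_continuous_on[OF hol]])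
       (use r p in \<open>auto simp: dist_commute\<close>)
  then obtain z1 where z1: "z1 \<in> cball z0 r" "\<And>z. z \<in> cball z0 r \<Longrightarrow> \<Phi> z \<le> \<Phi> z1"
    using continuous_attains_sup[of "cball z0 r" \<Phi>] r by auto
  define M where "M = \<Phi> z1"
  have "r powr (2 / p) * norm (f z0) \<le> M"
    using z1(2)[of z0] r by (simp add: \<Phi>_def M_def)
  moreover have "0 < r powr (2 / p) * norm (f z0)" using False r by simp
  ultimately have M: "0 < M" "r powr (2 / p) * norm (f z0) \<le> M" by linarith+
  \<comment> \<open>Half the distance from the maximum point to the circle of radius
    \<open>r\<close>. On \<open>ball z1 \<delta>\<close> the weight in \<open>\<Phi>\<close> is
    still at least \<open>\<delta> powr (2 / p)\<close>, which turns maximality into the bound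
    \<open>K\<close> for \<open>norm (f w)\<close>. It is positive because \<open>\<Phi>\<close>
    vanishes on the circle while \<open>M > 0\<close>.\<close>
  define \<delta> where "\<delta> = (r - dist z1 z0) / 2"
  have \<delta>: "0 < \<delta>" using M(1) z1(1) p
    by (cases "dist z1 z0 = r") (auto simp: M_def \<Phi>_def \<delta>_def dist_commute)
  have sub: "ball z1 \<delta> \<subseteq> ball z0 r"
  proof
    fix w assume "w \<in> ball z1 \<delta>"
    moreover have "dist z0 w \<le> dist z1 z0 + dist z1 w" by (metis dist_commute dist_triangle)
    ultimately show "w \<in> ball z0 r" using \<delta> by (auto simp: \<delta>_def field_simps)
  qed
  define K where "K = M * \<delta> powr (- (2 / p))"
  have K: "0 < K" using M \<delta> by (simp add: K_def)
  have fK: "norm (f w) \<le> K" if w: "w \<in> ball z1 \<delta>" for w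
  proof -
    have "dist w z0 \<le> dist z1 z0 + dist z1 w" by (metis add.commute dist_commute dist_triangle)
    then have "\<delta> \<le> r - dist w z0" using w by (auto simp: \<delta>_def field_simps)
    then have "\<delta> powr (2 / p) * norm (f w) \<le> \<Phi> w"
      unfolding \<Phi>_def using \<delta> p by (intro mult_right_mono powr_mono2) auto
    also have "\<dots> \<le> M" using z1(2)[of w] sub w by (force simp: M_def)
    finally show ?thesis
      using \<delta> by (simp add: K_def powr_minus field_simps)
  qed
  have "ennreal (norm (f z1) * (pi * \<delta>\<^sup>2)) \<le> (\<integral>\<^sup>+z. indicator (ball z1 \<delta>) z * ennreal (norm (f z)) \<partial>lborel)"
    using \<delta> sub r by (intro area_mean_value_ineq holomorphic_on_subset[OF hol]) auto
  also have "\<dots> \<le> (\<integral>\<^sup>+z. ennreal (K powr (1 - p)) * (indicator (ball z0 R) z * ennreal (norm (f z) powr p)) \<partial>lborel)"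
  proof (rule nn_integral_mono)
    fix z
    show "indicator (ball z1 \<delta>) z * ennreal (norm (f z))
      \<le> ennreal (K powr (1 - p)) * (indicator (ball z0 R) z * ennreal (norm (f z) powr p))"
    proof (cases "z \<in> ball z1 \<delta>")
      case True
      have "norm (f z) = norm (f z) powr (1 - p) * norm (f z) powr p"
        by (cases "f z = 0") (simp_all flip: powr_add)
      also have "\<dots> \<le> K powr (1 - p) * norm (f z) powr p"
        using fK[OF True] p by (intro mult_right_mono powr_mono2) auto
      finally have "ennreal (norm (f z)) \<le> ennreal (K powr (1 - p) * norm (f z) powr p)"
        by (rule ennreal_leI)
      moreover have "z \<in> ball z0 R" using True sub r by auto
      ultimately show ?thesis using True by (simp add: ennreal_mult)
    qed simp
  qed
  also have "\<dots> = ennreal (K powr (1 - p) * I)"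
    using I by (simp add: nn_integral_cmult ennreal_mult)
  finally have le: "norm (f z1) * (pi * \<delta>\<^sup>2) \<le> K powr (1 - p) * I"
    using I by simp
  have f1: "norm (f z1) = M * (2 * \<delta>) powr (- (2 / p))"
  proof -
    have "M = (2 * \<delta>) powr (2 / p) * norm (f z1)"
      by (simp add: M_def \<Phi>_def \<delta>_def diff_divide_distrib)
    then show ?thesis using \<delta> by (simp add: powr_minus field_simps)
  qed
  \<comment> \<open>This identity fixes the exponent \<open>2 / p\<close> in \<open>\<Phi>\<close>:
    the same power of \<open>\<delta>\<close> occurs in \<open>K powr (1 - p)\<close>, so the
    uncontrolled radius cancels.\<close>
  have d2: "\<delta> powr (- (2 / p)) * \<delta>\<^sup>2 = \<delta> powr (- (2 / p) * (1 - p))"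
  proof -
    have "- (2 / p) + 2 = - (2 / p) * (1 - p)" using p by (simp add: field_simps)
    then show ?thesis using \<delta> by (simp only: powr_numeral[symmetric] powr_add[symmetric])
  qed
  have "norm (f z1) * (pi * \<delta>\<^sup>2) = M * 2 powr (- (2 / p)) * pi * (\<delta> powr (- (2 / p)) * \<delta>\<^sup>2)"
    using \<delta> by (simp add: f1 powr_mult)
  also have "\<dots> = M * 2 powr (- (2 / p)) * pi * \<delta> powr (- (2 / p) * (1 - p))"
    unfolding d2 ..
  also have "M = M powr p * M powr (1 - p)"
    using M by (simp flip: powr_add)
  finally have "norm (f z1) * (pi * \<delta>\<^sup>2)
      = M powr p * M powr (1 - p) * 2 powr (- (2 / p)) * pi * \<delta> powr (- (2 / p) * (1 - p))" .
  moreover have "K powr (1 - p) = M powr (1 - p) * \<delta> powr (- (2 / p) * (1 - p))"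
    using M \<delta> by (simp add: K_def powr_mult powr_powr)
  ultimately have "M powr p * M powr (1 - p) * 2 powr (- (2 / p)) * pi * \<delta> powr (- (2 / p) * (1 - p))
      \<le> M powr (1 - p) * \<delta> powr (- (2 / p) * (1 - p)) * I"
    using le by metis
  then have "(M powr p * 2 powr (- (2 / p)) * pi) * (M powr (1 - p) * \<delta> powr (- (2 / p) * (1 - p)))
      \<le> I * (M powr (1 - p) * \<delta> powr (- (2 / p) * (1 - p)))"
    by (simp only: mult_ac)
  then have "M powr p * 2 powr (- (2 / p)) * pi \<le> I"
    using M \<delta> by (subst (asm) mult_le_cancel_right_pos) auto
  moreover have "M powr p * 2 powr (- (2 / p)) * 1 \<le> M powr p * 2 powr (- (2 / p)) * pi"
    using pi_ge_two by (intro mult_left_mono) auto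
  ultimately have "M powr p * 2 powr (- (2 / p)) \<le> I" by simp
  then have MI: "M powr p \<le> 2 powr (2 / p) * I"
    by (simp add: powr_minus field_simps)
  have "(r powr (2 / p) * norm (f z0)) powr p \<le> M powr p"
    using M p by (intro powr_mono2) auto
  also have "(r powr (2 / p) * norm (f z0)) powr p = R\<^sup>2 / 4 * norm (f z0) powr p"
    using r p by (simp add: powr_mult powr_powr r_def power_divide)
  finally have "norm (f z0) powr p * R\<^sup>2 \<le> 4 * 2 powr (2 / p) * I"
    using MI by (simp add: mult.commute[of "R\<^sup>2"])
  then show ?thesis
    using I by (simp flip: ennreal_mult)
qed

lemma submean_powr:
  assumes "0 < p"
  shows "\<exists>C>0. \<forall>f z0 R. 0 < R \<longrightarrow> f holomorphic_on ball z0 R \<longrightarrow> ennreal (norm (f z0) powr p * R\<^sup>2)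
    \<le> ennreal C * (\<integral>\<^sup>+z. indicator (ball z0 R) z * ennreal (norm (f z) powr p) \<partial>lborel)"
proof (cases "p < 1")
  case True
  then show ?thesis
    using submean_powr_lt1 assms by (intro exI[of _ "4 * 2 powr (2 / p)"]) auto
next
  case False
  then show ?thesis
    using submean_powr_ge1 by (intro exI[of _ "2 powr p"]) auto
qed

section \<open>Comparability of the weight and weighted point evaluation\<close>

lemma powr_comparable:
  fixes a b x y \<gamma> :: real
  assumes "0 < a" "0 < y" "a * y \<le> x" "x \<le> b * y"
  shows "min (a powr \<gamma>) (b powr \<gamma>) * y powr \<gamma> \<le> x powr \<gamma>"
    and "x powr \<gamma> \<le> max (a powr \<gamma>) (b powr \<gamma>) * y powr \<gamma>"
proof -
  have "0 < a * y" using assms by simp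
  then have x: "0 < x" "0 < b" using assms zero_less_mult_pos2[of b y] by linarith+
  have 1: "a powr \<gamma> * y powr \<gamma> = (a * y) powr \<gamma>" "b powr \<gamma> * y powr \<gamma> = (b * y) powr \<gamma>"
    using assms x by (simp_all add: powr_mult)
  \<comment> \<open>The weight exponent may be negative, in which case the power reverses the order;
    \<open>min\<close> and \<open>max\<close> in the conclusion cover both signs.\<close>
  have "(a * y) powr \<gamma> \<le> x powr \<gamma> \<and> x powr \<gamma> \<le> (b * y) powr \<gamma>
      \<or> (b * y) powr \<gamma> \<le> x powr \<gamma> \<and> x powr \<gamma> \<le> (a * y) powr \<gamma>"
  proof (cases "\<gamma> \<ge> 0")
    case True
    then have "(a * y) powr \<gamma> \<le> x powr \<gamma>" "x powr \<gamma> \<le> (b * y) powr \<gamma>"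
      using assms x \<open>0 < a * y\<close> by (auto intro!: powr_mono2 simp: less_imp_le[OF x(1)])
    then show ?thesis by simp
  next
    case False
    then have "(b * y) powr \<gamma> \<le> x powr \<gamma>"
      by (intro powr_mono2'[OF _ x(1) assms(4)]) simp
    moreover have "x powr \<gamma> \<le> (a * y) powr \<gamma>"
      using False by (intro powr_mono2'[OF _ \<open>0 < a * y\<close> assms(3)]) simp
    ultimately show ?thesis by simp
  qed
  then show "min (a powr \<gamma>) (b powr \<gamma>) * y powr \<gamma> \<le> x powr \<gamma>"
    and "x powr \<gamma> \<le> max (a powr \<gamma>) (b powr \<gamma>) * y powr \<gamma>"
    by (auto simp: min_mult_distrib_right max_mult_distrib_right 1)
qed

lemma one_minus_norm_sq_bounds:
  assumes "norm (z :: complex) < 1"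
  shows "1 - norm z \<le> 1 - (norm z)\<^sup>2" "1 - (norm z)\<^sup>2 \<le> 2 * (1 - norm z)"
proof -
  have e: "1 - (norm z)\<^sup>2 = (1 - norm z) * (1 + norm z)" by (simp add: power2_eq_square algebra_simps)
  have "(1 - norm z) * 1 \<le> (1 - norm z) * (1 + norm z)" "(1 - norm z) * (1 + norm z) \<le> (1 - norm z) * 2"
    using assms by (intro mult_left_mono; simp)+
  then show "1 - norm z \<le> 1 - (norm z)\<^sup>2" "1 - (norm z)\<^sup>2 \<le> 2 * (1 - norm z)"
    unfolding e by simp_all
qed

text \<open>On a disc whose radius is a fixed fraction of the distance to the unit circle the weight
  is essentially constant, so the unweighted mean inequality transfers. The right side keeps the
  local integral, because later the local masses are summed.\<close>

lemma bergman_point_bound: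
  assumes p: "0 < p"
  shows "\<exists>C>0. \<forall>f z. f holomorphic_on ball 0 1 \<longrightarrow> norm z < 1 \<longrightarrow>
    ennreal (norm (f z) powr p * (1 - norm z) powr (\<alpha> + 2))
    \<le> ennreal C * (\<integral>\<^sup>+w. indicator (ball z ((1 - norm z) / 4)) w
          * ennreal (norm (f w) powr p * bergman_weight \<alpha> w) \<partial>lborel)"
proof -
  obtain C where C: "C > 0" "\<And>f z0 R. 0 < R \<Longrightarrow> f holomorphic_on ball z0 R \<Longrightarrow> ennreal (norm (f z0) powr p * R\<^sup>2)
    \<le> ennreal C * (\<integral>\<^sup>+z. indicator (ball z0 R) z * ennreal (norm (f z) powr p) \<partial>lborel)"
    using submean_powr[OF p] by blast
  \<comment> \<open>For \<open>w\<close> in the disc, \<open>1 - norm w\<close> lies between 3/4 and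
    5/4 of \<open>1 - norm z\<close>; passing to \<open>1 - (norm w)\<^sup>2\<close> at most doubles
    the upper bound.\<close>
  define c where "c = min ((3 / 4 :: real) powr \<alpha>) ((5 / 2) powr \<alpha>)"
  have c: "c > 0" by (simp add: c_def)
  show ?thesis
  proof (intro exI[of _ "16 * C / c"] conjI allI impI)
    show "0 < 16 * C / c" using C c by simp
    fix f :: "complex \<Rightarrow> complex" and z :: complex
    assume hol: "f holomorphic_on ball 0 1" and z: "norm z < 1"
    define \<rho> where "\<rho> = 1 - norm z"
    have \<rho>: "0 < \<rho>" using z by (simp add: \<rho>_def)
    have near: "(3 / 4) * \<rho> \<le> 1 - (norm w)\<^sup>2 \<and> 1 - (norm w)\<^sup>2 \<le> (5 / 2) * \<rho> \<and> norm w < 1"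
      if w: "w \<in> ball z (\<rho> / 4)" for w
    proof -
      have "\<bar>norm w - norm z\<bar> \<le> norm (w - z)" by (rule norm_triangle_ineq3)
      then have b: "3 / 4 * \<rho> \<le> 1 - norm w" "1 - norm w \<le> 5 / 4 * \<rho>"
        using w by (auto simp: dist_norm \<rho>_def norm_minus_commute)
      have "norm w < 1" using b(1) \<rho> by linarith
      from one_minus_norm_sq_bounds[OF this]
      show ?thesis using b \<rho> by (auto simp: algebra_simps)
    qed
    have wlow: "c * \<rho> powr \<alpha> \<le> bergman_weight \<alpha> w" if w: "w \<in> ball z (\<rho> / 4)" for w
      unfolding bergman_weight_def c_def using near[OF w] \<rho> by (intro powr_comparable(1)) auto
    have hol': "f holomorphic_on ball z (\<rho> / 4)"
      using near by (intro holomorphic_on_subset[OF hol]) auto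
    have [measurable]: "(\<lambda>w. indicator (ball z (\<rho> / 4)) w * ennreal (norm (f w) powr p * bergman_weight \<alpha> w)) \<in> borel_measurable borel"
      by (intro borel_measurable_bergman_integrand[OF hol']) auto
    have [measurable]: "(\<lambda>w. indicator (ball z (\<rho> / 4)) w * ennreal (norm (f w) powr p)) \<in> borel_measurable borel"
      by (intro borel_measurable_ind_norm_powr[OF hol']) auto
    have "ennreal (norm (f z) powr p * \<rho> powr (\<alpha> + 2))
      = ennreal (16 * \<rho> powr \<alpha>) * ennreal (norm (f z) powr p * (\<rho> / 4)\<^sup>2)"
      using \<rho> by (simp add: powr_add power_divide flip: ennreal_mult)
    also have "\<dots> \<le> ennreal (16 * \<rho> powr \<alpha>) * (ennreal C * (\<integral>\<^sup>+w. indicator (ball z (\<rho> / 4)) w * ennreal (norm (f w) powr p) \<partial>lborel))"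
      using \<rho> by (intro mult_left_mono C hol') auto
    also have "\<dots> = ennreal (16 * C / c) * (\<integral>\<^sup>+w. ennreal (c * \<rho> powr \<alpha>) * (indicator (ball z (\<rho> / 4)) w * ennreal (norm (f w) powr p)) \<partial>lborel)"
      using C c by (subst nn_integral_cmult)
        (simp_all add: mult.assoc[symmetric] ennreal_mult[symmetric], simp add: mult_ac)
    also have "\<dots> \<le> ennreal (16 * C / c) * (\<integral>\<^sup>+w. indicator (ball z (\<rho> / 4)) w * ennreal (norm (f w) powr p * bergman_weight \<alpha> w) \<partial>lborel)"
      using c by (intro mult_left_mono nn_integral_mono)
         (auto split: split_indicator simp flip: ennreal_mult intro!: ennreal_leI simp: mult.commute[of _ "bergman_weight _ _"] intro!: mult_right_mono wlow)
    finally show "ennreal (norm (f z) powr p * (1 - norm z) powr (\<alpha> + 2)) \<le> \<dots>"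
      unfolding \<rho>_def .
  qed
qed

section \<open>Masses of annuli and Carleson tents\<close>

lemma power_powr_swap: "0 < x \<Longrightarrow> (x ^ n) powr s = (x powr s) ^ n" for x :: real
  by (simp add: powr_realpow[symmetric] powr_powr mult.commute)

lemma dyadic_scale:
  fixes x \<delta> :: real
  assumes "0 < x" "x \<le> \<delta>"
  obtains n where "\<delta> * (1 / 2) ^ Suc n < x" "x \<le> \<delta> * (1 / 2) ^ n"
proof -
  have "0 < \<delta>" using assms by simp
  have ex: "\<exists>n. \<delta> * (1 / 2) ^ n < x"
    using real_arch_pow_inv[of "x / \<delta>" "1 / 2"] assms \<open>0 < \<delta>\<close> by (auto simp: field_simps)
  define m where "m = (LEAST n. \<delta> * (1 / 2) ^ n < x)"
  have m: "\<delta> * (1 / 2) ^ m < x" unfolding m_def using ex by (rule LeastI_ex)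
  then have "m \<noteq> 0" using assms by (cases m) auto
  then obtain n where n: "m = Suc n" using not0_implies_Suc by blast
  then have "\<not> \<delta> * (1 / 2) ^ n < x"
    unfolding m_def by (metis lessI not_less_Least)
  then show thesis using that[of n] m n by simp
qed

lemma emeasure_complex_annulus:
  assumes "0 \<le> a" "a \<le> b"
  shows "emeasure lborel {z :: complex. a \<le> norm z \<and> norm z < b} = ennreal (pi * (b\<^sup>2 - a\<^sup>2))"
proof -
  have "{z :: complex. a \<le> norm z \<and> norm z < b} = ball 0 b - ball 0 a" by auto
  moreover have "emeasure lborel (ball (0::complex) b - ball 0 a) = emeasure lborel (ball (0::complex) b) - emeasure lborel (ball (0::complex) a)"
    using assms by (intro emeasure_Diff) (auto simp: emeasure_complex_ball)
  ultimately show ?thesis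
    using assms by (simp add: emeasure_complex_ball ennreal_minus algebra_simps)
qed

text \<open>Dyadic annuli towards the circle: the weight on the annulus at depth
  \<open>\<rho> n\<close> is about \<open>\<rho> n powr \<alpha>\<close> and its area is
  \<open>O(\<rho> n)\<close>. The masses form a geometric series of ratio
  \<open>2 powr (- (\<alpha> + 1))\<close>, which converges because
  \<open>\<alpha> > -1\<close>.\<close>

lemma weight_annulus_bound:
  assumes \<alpha>: "\<alpha> > -1"
  shows "\<exists>C>0. \<forall>\<delta>. 0 < \<delta> \<and> \<delta> \<le> 1 \<longrightarrow>
    (\<integral>\<^sup>+z. indicator {z. 1 - \<delta> \<le> norm z \<and> norm z < 1} z * ennreal (bergman_weight \<alpha> z) \<partial>lborel)
      \<le> ennreal (C * \<delta> powr (\<alpha> + 1))"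
proof -
  define c where "c = max ((1 / 2 :: real) powr \<alpha>) (2 powr \<alpha>)"
  define r where "r = (1 / 2 :: real) powr (\<alpha> + 1)"
  have c: "c > 0" by (simp add: c_def less_max_iff_disj)
  have r: "0 < r" "r < 1" using \<alpha> powr_less_mono2[of "\<alpha> + 1" "1 / 2" 1] by (auto simp: r_def)
  show ?thesis
  proof (intro exI[of _ "pi * c / (1 - r)"] conjI allI impI)
    show "0 < pi * c / (1 - r)" using c r by simp
    fix \<delta> :: real assume \<delta>: "0 < \<delta> \<and> \<delta> \<le> 1"
    define \<rho> where "\<rho> = (\<lambda>n. \<delta> * (1 / 2) ^ n)"
    have \<rho>: "0 < \<rho> n" "\<rho> n \<le> 1" "\<rho> (Suc n) = \<rho> n / 2" for n
      using \<delta> by (auto simp: \<rho>_def power_le_one intro!: mult_le_one)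
    define E where "E = (\<lambda>n. {z :: complex. 1 - \<rho> n \<le> norm z \<and> norm z < 1 - \<rho> (Suc n)})"
    have [measurable]: "E n \<in> sets borel" for n
      unfolding E_def by measurable
    have pt: "indicator {z. 1 - \<delta> \<le> norm z \<and> norm z < 1} z * ennreal (bergman_weight \<alpha> z)
       \<le> (\<Sum>n. ennreal (c * \<rho> n powr \<alpha>) * indicator (E n) z)" for z
    proof (cases "1 - \<delta> \<le> norm z \<and> norm z < 1")
      case True
      then obtain n where n: "\<rho> (Suc n) < 1 - norm z" "1 - norm z \<le> \<rho> n"
        using dyadic_scale[of "1 - norm z" \<delta>] unfolding \<rho>_def by auto
      have "1 - norm z \<le> 1 - (norm z)\<^sup>2" "1 - (norm z)\<^sup>2 \<le> 2 * (1 - norm z)"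
        using one_minus_norm_sq_bounds[of z] True by simp_all
      then have "bergman_weight \<alpha> z \<le> c * \<rho> n powr \<alpha>"
        unfolding bergman_weight_def c_def using n \<rho>[of n] by (intro powr_comparable(2)) auto
      then have "indicator {z. 1 - \<delta> \<le> norm z \<and> norm z < 1} z * ennreal (bergman_weight \<alpha> z)
        \<le> ennreal (c * \<rho> n powr \<alpha>) * indicator (E n) z"
        using n True by (auto simp: E_def intro!: ennreal_leI)
      also have "\<dots> \<le> (\<Sum>n. ennreal (c * \<rho> n powr \<alpha>) * indicator (E n) z)"
        by (intro sum_le_suminf[of _ "{n}", simplified]) auto
      finally show ?thesis .
    qed simp
    have bound: "ennreal (c * \<rho> n powr \<alpha>) * emeasure lborel (E n) \<le> ennreal (pi * c * \<delta> powr (\<alpha> + 1) * r ^ n)" for n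
    proof -
      have "(1 - \<rho> (Suc n))\<^sup>2 - (1 - \<rho> n)\<^sup>2 = (\<rho> n - \<rho> (Suc n)) * (2 - \<rho> n - \<rho> (Suc n))"
        by (simp add: power2_eq_square algebra_simps)
      also have "\<dots> \<le> \<rho> n / 2 * 2"
        using \<rho>[of n] by (intro mult_mono) auto
      finally have "(1 - \<rho> (Suc n))\<^sup>2 - (1 - \<rho> n)\<^sup>2 \<le> \<rho> n" by simp
      then have "ennreal (pi * ((1 - \<rho> (Suc n))\<^sup>2 - (1 - \<rho> n)\<^sup>2)) \<le> ennreal (pi * \<rho> n)"
        by (intro ennreal_leI mult_left_mono) auto
      moreover have "emeasure lborel (E n) = ennreal (pi * ((1 - \<rho> (Suc n))\<^sup>2 - (1 - \<rho> n)\<^sup>2))"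
        unfolding E_def using \<rho>[of n] by (intro emeasure_complex_annulus) auto
      ultimately have "emeasure lborel (E n) \<le> ennreal (pi * \<rho> n)" by simp
      then have "ennreal (c * \<rho> n powr \<alpha>) * emeasure lborel (E n) \<le> ennreal (c * \<rho> n powr \<alpha>) * ennreal (pi * \<rho> n)"
        by (rule mult_left_mono) simp
      also have "\<dots> = ennreal (pi * c * \<rho> n powr (\<alpha> + 1))"
        using c \<rho>[of n] by (simp add: powr_add mult_ac flip: ennreal_mult)
      also have "\<rho> n powr (\<alpha> + 1) = \<delta> powr (\<alpha> + 1) * r ^ n"
        using \<delta> by (simp add: \<rho>_def powr_mult power_powr_swap r_def)
      finally show ?thesis by (simp add: mult.assoc)
    qed
    have "(\<integral>\<^sup>+z. indicator {z. 1 - \<delta> \<le> norm z \<and> norm z < 1} z * ennreal (bergman_weight \<alpha> z) \<partial>lborel)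
      \<le> (\<integral>\<^sup>+z. (\<Sum>n. ennreal (c * \<rho> n powr \<alpha>) * indicator (E n) z) \<partial>lborel)"
      by (intro nn_integral_mono pt)
    also have "\<dots> = (\<Sum>n. ennreal (c * \<rho> n powr \<alpha>) * emeasure lborel (E n))"
      by (subst nn_integral_suminf) (simp_all add: nn_integral_cmult_indicator)
    also have "\<dots> \<le> (\<Sum>n. ennreal (pi * c * \<delta> powr (\<alpha> + 1) * r ^ n))"
      by (intro suminf_le bound) auto
    also have "\<dots> = ennreal (pi * c * \<delta> powr (\<alpha> + 1) * (1 / (1 - r)))"
      using c r by (intro suminf_ennreal_eq sums_mult geometric_sums) auto
    finally show "(\<integral>\<^sup>+z. indicator {z. 1 - \<delta> \<le> norm z \<and> norm z < 1} z * ennreal (bergman_weight \<alpha> z) \<partial>lborel)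
      \<le> ennreal (pi * c / (1 - r) * \<delta> powr (\<alpha> + 1))"
      by simp
  qed
qed

text \<open>A chord is comparable to its arc: \<open>sin x - x / 2\<close> increases on
  \<open>[0, 1]\<close>, since 1 lies below \<open>pi / 3\<close>, where the cosine is 1/2.\<close>

lemma dist_cis_ge:
  assumes "\<bar>a - b\<bar> \<le> 1"
  shows "\<bar>a - b\<bar> / 2 \<le> norm (cis a - cis b)"
proof -
  have half: "x / 2 \<le> sin x" if "0 \<le> x" "x \<le> 1" for x :: real
  proof -
    have "(\<lambda>x::real. sin x - x / 2) 0 \<le> (\<lambda>x. sin x - x / 2) x"
    proof (rule DERIV_nonneg_imp_nondecreasing[of 0 x "\<lambda>x. sin x - x / 2"])
      show "0 \<le> x" by fact
      fix y assume y: "0 \<le> y" "y \<le> x"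
      have "cos (pi / 3) \<le> cos y"
        using y that pi_gt3 by (intro cos_monotone_0_pi_le) auto
      then have "0 \<le> cos y - 1 / 2" by (simp add: cos_60)
      then show "\<exists>d. ((\<lambda>x::real. sin x - x / 2) has_real_derivative d) (at y) \<and> 0 \<le> d"
        by (intro exI[of _ "cos y - 1 / 2"]) (auto intro!: derivative_eq_intros)
    qed
    then show ?thesis by simp
  qed
  have "\<bar>a - b\<bar> / 2 \<le> \<bar>sin (a - b)\<bar>"
    using half[of "\<bar>a - b\<bar>"] assms by (cases "a \<le> b") (auto simp: abs_if sin_minus[of "b - a", simplified])
  also have "\<dots> = \<bar>Im (cis (a - b) - 1)\<bar>" by simp
  also have "\<dots> \<le> norm (cis (a - b) - 1)" by (rule abs_Im_le_cmod)
  also have "\<dots> = norm (cis b * (cis (a - b) - 1))" by (simp add: norm_mult)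
  also have "cis b * (cis (a - b) - 1) = cis a - cis b" by (simp add: algebra_simps cis_mult)
  finally show ?thesis .
qed

text \<open>The gain of one power of \<open>\<delta>\<close> over the annulus comes from averaging
  over rotations by angles in \<open>[0, 1]\<close>: for each \<open>z\<close> the angles that carry
  it into the tent fill an interval of length at most \<open>16 * \<delta>\<close>.\<close>

lemma weight_tent_bound:
  assumes \<alpha>: "\<alpha> > -1"
  shows "\<exists>C>0. \<forall>\<delta>>0.
    (\<integral>\<^sup>+z. indicator {z. norm z < 1 \<and> norm (1 - z) \<le> \<delta>} z * ennreal (bergman_weight \<alpha> z) \<partial>lborel)
      \<le> ennreal (C * \<delta> powr (\<alpha> + 2))"
proof -
  obtain C where C: "C > 0" "\<And>\<delta>. 0 < \<delta> \<Longrightarrow> \<delta> \<le> 1 \<Longrightarrow>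
    (\<integral>\<^sup>+z. indicator {z. 1 - \<delta> \<le> norm z \<and> norm z < 1} z * ennreal (bergman_weight \<alpha> z) \<partial>lborel)
      \<le> ennreal (C * \<delta> powr (\<alpha> + 1))"
    using weight_annulus_bound[OF \<alpha>] by blast
  \<comment> \<open>The first summand serves small \<open>\<delta>\<close>. For
    \<open>\<delta> > 1/2\<close> the mass of the whole disc suffices, and the second summand is
    chosen so that \<open>(2 * \<delta>) powr (\<alpha> + 2) \<ge> 1\<close> pays for it.\<close>
  define K where "K = 16 * C + C * 2 powr (\<alpha> + 2)"
  show ?thesis
  proof (intro exI[of _ K] conjI allI impI)
    show "0 < K" using C by (simp add: K_def add_pos_pos)
    fix \<delta> :: real assume \<delta>: "\<delta> > 0"
    define T where "T = {z :: complex. norm z < 1 \<and> norm (1 - z) \<le> \<delta>}"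
    have [measurable]: "T \<in> sets borel" unfolding T_def by measurable
    show "(\<integral>\<^sup>+z. indicator {z. norm z < 1 \<and> norm (1 - z) \<le> \<delta>} z * ennreal (bergman_weight \<alpha> z) \<partial>lborel)
      \<le> ennreal (K * \<delta> powr (\<alpha> + 2))"
    proof (cases "\<delta> \<le> 1 / 2")
      case False
      have "(\<integral>\<^sup>+z. indicator {z. norm z < 1 \<and> norm (1 - z) \<le> \<delta>} z * ennreal (bergman_weight \<alpha> z) \<partial>lborel)
        \<le> (\<integral>\<^sup>+z. indicator {z. 1 - 1 \<le> norm z \<and> norm z < 1} z * ennreal (bergman_weight \<alpha> z) \<partial>lborel)"
        by (intro nn_integral_mono) (auto split: split_indicator)
      also have "\<dots> \<le> ennreal (C * 1 powr (\<alpha> + 1))" by (rule C) auto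
      also have "\<dots> \<le> ennreal (K * \<delta> powr (\<alpha> + 2))"
      proof (rule ennreal_leI)
        have "C * 1 \<le> C * (2 * \<delta>) powr (\<alpha> + 2)"
          using C False \<alpha> by (intro mult_left_mono ge_one_powr_ge_zero) auto
        also have "\<dots> = (C * 2 powr (\<alpha> + 2)) * \<delta> powr (\<alpha> + 2)"
          using \<delta> by (simp add: powr_mult)
        also have "\<dots> \<le> K * \<delta> powr (\<alpha> + 2)"
          using C by (intro mult_right_mono) (auto simp: K_def)
        finally show "C * 1 powr (\<alpha> + 1) \<le> K * \<delta> powr (\<alpha> + 2)" by simp
      qed
      finally show ?thesis .
    next
      case True
      define g where "g = (\<lambda>z. indicator T z * ennreal (bergman_weight \<alpha> z))"
      have [measurable]: "g \<in> borel_measurable borel" unfolding g_def by measurable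
      define A where "A = {z :: complex. 1 - \<delta> \<le> norm z \<and> norm z < 1}"
      have [measurable]: "A \<in> sets borel" unfolding A_def by measurable
      have TA: "z \<in> A" if "z * cis \<theta> \<in> T" for z \<theta>
      proof -
        have "norm (1::complex) \<le> norm (1 - z * cis \<theta>) + norm (z * cis \<theta>)"
          by (metis add.commute diff_add_cancel norm_triangle_ineq)
        then show ?thesis using that by (auto simp: A_def T_def norm_mult)
      qed
      have pt: "(\<integral>\<^sup>+\<theta>. indicator {0..1} \<theta> * g (z * cis \<theta>) \<partial>lborel)
        \<le> ennreal (16 * \<delta>) * (indicator A z * ennreal (bergman_weight \<alpha> z))" for z
      proof (cases "\<exists>\<theta>. \<theta> \<in> {0..1} \<and> z * cis \<theta> \<in> T")
        case False
        then have "indicator {0..1} \<theta> * g (z * cis \<theta>) = 0" for \<theta>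
          by (auto simp: g_def split: split_indicator)
        then show ?thesis by (simp only: nn_integral_0_iff_AE) simp
      next
        case True
        then obtain \<theta>0 where \<theta>0: "\<theta>0 \<in> {0..1}" "z * cis \<theta>0 \<in> T" by blast
        have zA: "z \<in> A" using TA \<theta>0 by blast
        \<comment> \<open>Modulus at least 1/2 converts the distance of two rotated points, at most
          \<open>2 * \<delta>\<close>, into a difference of angles of at most
          \<open>8 * \<delta>\<close>.\<close>
        have zn: "1 / 2 \<le> norm z" using zA \<open>\<delta> \<le> 1 / 2\<close> by (auto simp: A_def)
        have "indicator {0..1} \<theta> * g (z * cis \<theta>) \<le> ennreal (bergman_weight \<alpha> z) * indicator {\<theta>0 - 8 * \<delta>..\<theta>0 + 8 * \<delta>} \<theta>" for \<theta>
        proof (cases "\<theta> \<in> {0..1} \<and> z * cis \<theta> \<in> T")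
          case True
          have "norm z * norm (cis \<theta> - cis \<theta>0) = norm (z * cis \<theta> - z * cis \<theta>0)"
            by (simp flip: norm_mult add: algebra_simps)
          also have "\<dots> = norm ((1 - z * cis \<theta>0) - (1 - z * cis \<theta>))" by simp
          also have "\<dots> \<le> norm (1 - z * cis \<theta>0) + norm (1 - z * cis \<theta>)" by (rule norm_triangle_ineq4)
          also have "\<dots> \<le> 2 * \<delta>" using True \<theta>0 by (auto simp: T_def)
          finally have le: "norm z * norm (cis \<theta> - cis \<theta>0) \<le> 2 * \<delta>" .
          have "1 / 2 * norm (cis \<theta> - cis \<theta>0) \<le> norm z * norm (cis \<theta> - cis \<theta>0)"
            using zn by (intro mult_right_mono) auto
          also note le
          finally have "norm (cis \<theta> - cis \<theta>0) \<le> 4 * \<delta>" by simp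
          moreover have "\<bar>\<theta> - \<theta>0\<bar> / 2 \<le> norm (cis \<theta> - cis \<theta>0)"
            using True \<theta>0 by (intro dist_cis_ge) auto
          ultimately have "\<bar>\<theta> - \<theta>0\<bar> / 2 \<le> 4 * \<delta>" by (rule order.trans[rotated])
          then have "\<bar>\<theta> - \<theta>0\<bar> \<le> 8 * \<delta>" by simp
          then have "\<theta> \<in> {\<theta>0 - 8 * \<delta>..\<theta>0 + 8 * \<delta>}" by auto
          then show ?thesis using True by (simp add: g_def bergman_weight_def norm_mult)
        qed (auto simp: g_def)
        then have "(\<integral>\<^sup>+\<theta>. indicator {0..1} \<theta> * g (z * cis \<theta>) \<partial>lborel)
          \<le> (\<integral>\<^sup>+\<theta>. ennreal (bergman_weight \<alpha> z) * indicator {\<theta>0 - 8 * \<delta>..\<theta>0 + 8 * \<delta>} \<theta> \<partial>lborel)"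
          by (intro nn_integral_mono)
        also have "\<dots> = ennreal (bergman_weight \<alpha> z) * ennreal (16 * \<delta>)"
          using \<delta> by (subst nn_integral_cmult_indicator) auto
        finally show ?thesis using zA by (simp add: mult.commute)
      qed
      have "(\<integral>\<^sup>+z. g z \<partial>lborel) = (\<integral>\<^sup>+z. (\<integral>\<^sup>+\<theta>. indicator {0..1} \<theta> * g (z * cis \<theta>) \<partial>lborel) \<partial>lborel)"
        using nn_integral_average_rotations[of g 1] by simp
      also have "\<dots> \<le> (\<integral>\<^sup>+z. ennreal (16 * \<delta>) * (indicator A z * ennreal (bergman_weight \<alpha> z)) \<partial>lborel)"
        by (intro nn_integral_mono pt)
      also have "\<dots> = ennreal (16 * \<delta>) * (\<integral>\<^sup>+z. indicator A z * ennreal (bergman_weight \<alpha> z) \<partial>lborel)"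
        by (rule nn_integral_cmult) measurable
      also have "\<dots> \<le> ennreal (16 * \<delta>) * ennreal (C * \<delta> powr (\<alpha> + 1))"
        unfolding A_def using \<delta> True by (intro mult_left_mono C) auto
      also have "\<dots> = ennreal (16 * C * \<delta> powr (\<alpha> + 2))"
        using \<delta> C by (simp add: powr_add power2_eq_square mult_ac flip: ennreal_mult)
      also have "\<dots> \<le> ennreal (K * \<delta> powr (\<alpha> + 2))"
        using C by (intro ennreal_leI mult_right_mono) (auto simp: K_def)
      finally show ?thesis by (simp add: g_def T_def)
    qed
  qed
qed

section \<open>Dyadic rings at the boundary point 1\<close>

text \<open>The factor 2 lets the ring of index 0 reach the largest distance from 1 inside the disc,
  so that the rings from index 0 on partition the disc.\<close>

definition dyadic_ring :: "nat \<Rightarrow> complex set" where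
  "dyadic_ring i = {z. norm z < 1 \<and> (1 / 2) ^ i < norm (1 - z) \<and> norm (1 - z) \<le> 2 * (1 / 2) ^ i}"

definition dyadic_interval :: "nat \<Rightarrow> real set" where
  "dyadic_interval j = {1 - (1 / 2) ^ j ..< 1 - (1 / 2) ^ Suc j}"

definition ring_mass :: "real \<Rightarrow> real \<Rightarrow> (complex \<Rightarrow> complex) \<Rightarrow> nat \<Rightarrow> ennreal" where
  "ring_mass p \<alpha> f i =
     (\<integral>\<^sup>+z. indicator (dyadic_ring i) z * ennreal (norm (f z) powr p * bergman_weight \<alpha> z) \<partial>lborel)"

lemma dyadic_ring_borel [measurable]: "dyadic_ring i \<in> sets borel"
  unfolding dyadic_ring_def by measurable

lemma dyadic_ring_subset: "dyadic_ring i \<subseteq> ball 0 1"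
  by (auto simp: dyadic_ring_def)

lemma half_power_mono: "i \<le> j \<Longrightarrow> (1 / 2 :: real) ^ j \<le> (1 / 2) ^ i"
  by (rule power_decreasing) auto

lemma disjoint_family_lessI:
  fixes A :: "nat \<Rightarrow> 'a set"
  assumes "\<And>i j. i < j \<Longrightarrow> A i \<inter> A j = {}"
  shows "disjoint_family A"
  using assms by (auto simp: disjoint_family_on_def) (metis disjoint_iff linorder_neqE_nat)

lemma disjoint_dyadic_ring: "disjoint_family dyadic_ring"
proof -
  have "dyadic_ring i \<inter> dyadic_ring j = {}" if "i < j" for i j
    using half_power_mono[of "Suc i" j] that by (auto simp: dyadic_ring_def)
  then show ?thesis by (rule disjoint_family_lessI)
qed

lemma UN_dyadic_ring: "(\<Union>i. dyadic_ring i) = ball 0 1"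
proof (intro equalityI subsetI)
  fix z :: complex assume z: "z \<in> ball 0 1"
  have "norm (1 - z) \<le> norm (1::complex) + norm z" by (rule norm_triangle_ineq4)
  then have "norm (1 - z) \<le> 2" "0 < norm (1 - z)" using z by auto
  then obtain n where "2 * (1 / 2) ^ Suc n < norm (1 - z)" "norm (1 - z) \<le> 2 * (1 / 2) ^ n"
    using dyadic_scale[of "norm (1 - z)" 2] by metis
  then have "z \<in> dyadic_ring n" using z by (auto simp: dyadic_ring_def)
  then show "z \<in> (\<Union>i. dyadic_ring i)" by blast
qed (use dyadic_ring_subset in blast)

lemma bergman_integral_weight:
  "bergman_integral p \<alpha> f =
    (\<integral>\<^sup>+z. indicator (ball 0 1) z * ennreal (norm (f z) powr p * bergman_weight \<alpha> z) \<partial>lborel)"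
  by (simp add: bergman_integral_def bergman_weight_def)

lemma bergman_integral_rings:
  assumes "f holomorphic_on ball 0 1"
  shows "bergman_integral p \<alpha> f = (\<Sum>i. ring_mass p \<alpha> f i)"
proof -
  define g where "g = (\<lambda>z. indicator (ball 0 1) z * ennreal (norm (f z) powr p * bergman_weight \<alpha> z))"
  have [measurable]: "g \<in> borel_measurable borel"
    unfolding g_def by (rule borel_measurable_bergman_integrand[OF assms]) auto
  have "bergman_integral p \<alpha> f = (\<integral>\<^sup>+z\<in>(\<Union>i. dyadic_ring i). g z \<partial>lborel)"
    unfolding UN_dyadic_ring bergman_integral_weight
    by (intro nn_integral_cong) (auto simp: g_def split: split_indicator)
  also have "\<dots> = (\<Sum>i. \<integral>\<^sup>+z\<in>dyadic_ring i. g z \<partial>lborel)"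
    by (intro nn_integral_disjoint_family disjoint_dyadic_ring) auto
  also have "(\<lambda>i. \<integral>\<^sup>+z\<in>dyadic_ring i. g z \<partial>lborel) = ring_mass p \<alpha> f"
    unfolding ring_mass_def using dyadic_ring_subset
    by (intro ext nn_integral_cong) (fastforce simp: g_def split: split_indicator)
  finally show ?thesis .
qed

lemma ring_mass_le_bergman_integral:
  assumes "f holomorphic_on ball 0 1"
  shows "ring_mass p \<alpha> f i \<le> bergman_integral p \<alpha> f"
  unfolding bergman_integral_rings[OF assms]
  by (intro sum_le_suminf[of _ "{i}", simplified]) auto

text \<open>The disc of radius \<open>(1 - t) / 4\<close> about \<open>t\<close> changes the
  distance to 1 by at most a quarter, so it meets only the rings \<open>j\<close>,
  \<open>j + 1\<close> and \<open>j + 2\<close>.\<close>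

lemma dyadic_point_bound:
  assumes p: "0 < p" and \<alpha>: "\<alpha> > -1"
  shows "\<exists>C>0. \<forall>f j t. f holomorphic_on ball 0 1 \<longrightarrow> t \<in> dyadic_interval j \<longrightarrow>
    ennreal (norm (f (complex_of_real t)) powr p * ((1 / 2) ^ j) powr (\<alpha> + 2))
    \<le> ennreal C * (ring_mass p \<alpha> f j + ring_mass p \<alpha> f (Suc j) + ring_mass p \<alpha> f (Suc (Suc j)))"
proof -
  obtain C where C: "C > 0" "\<And>f z. f holomorphic_on ball 0 1 \<Longrightarrow> norm z < 1 \<Longrightarrow>
    ennreal (norm (f z) powr p * (1 - norm z) powr (\<alpha> + 2))
    \<le> ennreal C * (\<integral>\<^sup>+w. indicator (ball z ((1 - norm z) / 4)) w
          * ennreal (norm (f w) powr p * bergman_weight \<alpha> w) \<partial>lborel)"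
    using bergman_point_bound[OF p] by blast
  show ?thesis
  proof (intro exI[of _ "2 powr (\<alpha> + 2) * C"] conjI allI impI)
    show "0 < 2 powr (\<alpha> + 2) * C" using C by simp
    fix f :: "complex \<Rightarrow> complex" and j t
    assume hol: "f holomorphic_on ball 0 1" and t: "t \<in> dyadic_interval j"
    define h where "h = (\<lambda>w. ennreal (norm (f w) powr p * bergman_weight \<alpha> w))"
    have pj: "0 < (1 / 2 :: real) ^ j" "(1 / 2 :: real) ^ j \<le> 1" by (auto simp: power_le_one)
    have tb: "(1 / 2) ^ j / 2 < 1 - t" "1 - t \<le> (1 / 2) ^ j" "0 \<le> t" "t < 1"
      using t pj by (auto simp: dyadic_interval_def)
    have [measurable]: "(\<lambda>w. indicator (dyadic_ring i) w * h w) \<in> borel_measurable borel" for i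
      unfolding h_def by (rule borel_measurable_bergman_integrand[OF hol dyadic_ring_subset]) simp
    have pt: "indicator (ball (complex_of_real t) ((1 - t) / 4)) w * h w
        \<le> indicator (dyadic_ring j) w * h w + indicator (dyadic_ring (Suc j)) w * h w
          + indicator (dyadic_ring (Suc (Suc j))) w * h w" for w
    proof (cases "w \<in> ball (complex_of_real t) ((1 - t) / 4)")
      case True
      then have d: "norm (w - complex_of_real t) < (1 - t) / 4" by (simp add: dist_norm norm_minus_commute)
      have "norm w \<le> norm (complex_of_real t) + norm (w - complex_of_real t)"
        by (metis add_diff_cancel_left' diff_add_cancel norm_triangle_ineq)
      then have w1: "norm w < 1" using d tb by simp
      have eq: "1 - w = complex_of_real (1 - t) - (w - complex_of_real t)" by simp
      have n1: "norm (complex_of_real (1 - t)) = 1 - t" using tb by (simp only: norm_of_real abs_of_nonneg)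
      have "norm (1 - w) \<le> (1 - t) + norm (w - complex_of_real t)"
        unfolding eq using norm_triangle_ineq4[of "complex_of_real (1 - t)" "w - complex_of_real t"] n1 by simp
      moreover have "(1 - t) - norm (w - complex_of_real t) \<le> norm (1 - w)"
        unfolding eq using norm_triangle_ineq2[of "complex_of_real (1 - t)" "w - complex_of_real t"] n1 by simp
      ultimately have "norm (1 - w) \<le> 2 * (1 / 2) ^ j" "(1 / 2) ^ j / 4 < norm (1 - w)"
        using d tb by auto
      then have "w \<in> dyadic_ring j \<or> w \<in> dyadic_ring (Suc j) \<or> w \<in> dyadic_ring (Suc (Suc j))"
        using w1 by (auto simp: dyadic_ring_def)
      then show ?thesis
        by (auto simp: add_increasing add_increasing2 split: split_indicator)
    qed simp
    have "norm (f (complex_of_real t)) powr p * ((1 / 2) ^ j) powr (\<alpha> + 2)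
      \<le> 2 powr (\<alpha> + 2) * (norm (f (complex_of_real t)) powr p * (1 - norm (complex_of_real t)) powr (\<alpha> + 2))"
    proof -
      have "((1 / 2) ^ j) powr (\<alpha> + 2) \<le> (2 * (1 - t)) powr (\<alpha> + 2)"
        using tb \<alpha> pj by (intro powr_mono2) auto
      also have "\<dots> = 2 powr (\<alpha> + 2) * (1 - norm (complex_of_real t)) powr (\<alpha> + 2)"
        using tb powr_mult[of 2 "1 - t" "\<alpha> + 2"] by simp
      finally have "norm (f (complex_of_real t)) powr p * ((1 / 2) ^ j) powr (\<alpha> + 2)
          \<le> norm (f (complex_of_real t)) powr p * (2 powr (\<alpha> + 2) * (1 - norm (complex_of_real t)) powr (\<alpha> + 2))"
        by (rule mult_left_mono) simp
      then show ?thesis by (simp only: mult_ac)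
    qed
    then have "ennreal (norm (f (complex_of_real t)) powr p * ((1 / 2) ^ j) powr (\<alpha> + 2))
      \<le> ennreal (2 powr (\<alpha> + 2)) * ennreal (norm (f (complex_of_real t)) powr p * (1 - norm (complex_of_real t)) powr (\<alpha> + 2))"
      by (subst ennreal_mult[symmetric]) (auto intro: ennreal_leI)
    also have "\<dots> \<le> ennreal (2 powr (\<alpha> + 2)) * (ennreal C * (\<integral>\<^sup>+w. indicator (ball (complex_of_real t) ((1 - norm (complex_of_real t)) / 4)) w * h w \<partial>lborel))"
      unfolding h_def using tb by (intro mult_left_mono C(2)[OF hol]) auto
    also have "\<dots> = ennreal (2 powr (\<alpha> + 2) * C) * (\<integral>\<^sup>+w. indicator (ball (complex_of_real t) ((1 - t) / 4)) w * h w \<partial>lborel)"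
      using C tb by (simp add: ennreal_mult mult.assoc)
    also have "\<dots> \<le> ennreal (2 powr (\<alpha> + 2) * C) * (\<integral>\<^sup>+w. indicator (dyadic_ring j) w * h w + indicator (dyadic_ring (Suc j)) w * h w
          + indicator (dyadic_ring (Suc (Suc j))) w * h w \<partial>lborel)"
      by (intro mult_left_mono nn_integral_mono pt) auto
    also have "(\<integral>\<^sup>+w. indicator (dyadic_ring j) w * h w + indicator (dyadic_ring (Suc j)) w * h w
          + indicator (dyadic_ring (Suc (Suc j))) w * h w \<partial>lborel)
       = ring_mass p \<alpha> f j + ring_mass p \<alpha> f (Suc j) + ring_mass p \<alpha> f (Suc (Suc j))"
      by (subst nn_integral_add, simp, simp)+ (simp add: ring_mass_def h_def)
    finally show "ennreal (norm (f (complex_of_real t)) powr p * ((1 / 2) ^ j) powr (\<alpha> + 2))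
      \<le> ennreal (2 powr (\<alpha> + 2) * C) * (ring_mass p \<alpha> f j + ring_mass p \<alpha> f (Suc j) + ring_mass p \<alpha> f (Suc (Suc j)))" .
  qed
qed

lemma sums_of_suminf_ennreal:
  assumes "\<And>i. 0 \<le> m i" "0 \<le> x" "(\<Sum>i. ennreal (m i)) = ennreal x"
  shows "m sums x"
proof -
  have "(\<lambda>i. ennreal (m i)) sums ennreal x"
    unfolding assms(3)[symmetric] by (rule summable_sums[OF summableI])
  then show ?thesis using sums_ennreal[OF assms(1,2)] by simp
qed

text \<open>\<open>b j\<close> is the \<open>p\<close>-th root of a constant times the mass of the
  three rings that see \<open>dyadic_interval j\<close>. Each ring is counted at most three times,
  hence the bound on the sum.\<close>

lemma dyadic_majorant:
  assumes p: "0 < p" and \<alpha>: "\<alpha> > -1"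
  shows "\<exists>C>0. \<forall>f. in_bergman p \<alpha> f \<longrightarrow> (\<exists>b. (\<forall>j. 0 \<le> b j)
    \<and> (\<forall>j t. t \<in> dyadic_interval j \<longrightarrow> norm (f (complex_of_real t)) \<le> b j * (2 ^ j) powr ((\<alpha> + 2) / p))
    \<and> summable (\<lambda>j. b j powr p) \<and> (\<Sum>j. b j powr p) \<le> C * enn2real (bergman_integral p \<alpha> f))"
proof -
  obtain C where C: "C > 0" "\<And>f j t. f holomorphic_on ball 0 1 \<Longrightarrow> t \<in> dyadic_interval j \<Longrightarrow>
    ennreal (norm (f (complex_of_real t)) powr p * ((1 / 2) ^ j) powr (\<alpha> + 2))
    \<le> ennreal C * (ring_mass p \<alpha> f j + ring_mass p \<alpha> f (Suc j) + ring_mass p \<alpha> f (Suc (Suc j)))"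
    using dyadic_point_bound[OF assms] by blast
  show ?thesis
  proof (intro exI[of _ "3 * C"] conjI allI impI)
    show "0 < 3 * C" using C by simp
    fix f assume f: "in_bergman p \<alpha> f"
    then have hol: "f holomorphic_on ball 0 1" and fin: "bergman_integral p \<alpha> f < \<infinity>"
      by (auto simp: in_bergman_def)
    define I where "I = enn2real (bergman_integral p \<alpha> f)"
    define m where "m = (\<lambda>i. enn2real (ring_mass p \<alpha> f i))"
    have m0: "0 \<le> m i" for i by (simp add: m_def)
    have me: "ring_mass p \<alpha> f i = ennreal (m i)" for i
      using ring_mass_le_bergman_integral[OF hol, of p \<alpha> i] fin by (simp add: m_def top.not_eq_extremum)
    have "(\<Sum>i. ennreal (m i)) = ennreal I"
      using bergman_integral_rings[OF hol, of p \<alpha>] fin by (simp add: me I_def top.not_eq_extremum)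
    then have sm: "m sums I"
      using m0 by (intro sums_of_suminf_ennreal) (auto simp: I_def)
    define c where "c = (\<lambda>j. C * (m j + m (Suc j) + m (Suc (Suc j))))"
    have c0: "0 \<le> c j" for j using C m0 by (simp add: c_def)
    have s1: "(\<lambda>j. m (Suc j)) sums (I - m 0)"
      using sm by (subst sums_Suc_iff) simp
    have s2: "(\<lambda>j. m (Suc (Suc j))) sums (I - m 0 - m 1)"
      using s1 by (subst sums_Suc_iff[of "\<lambda>j. m (Suc j)"]) simp
    have sc: "c sums (C * (I + (I - m 0) + (I - m 0 - m 1)))"
      unfolding c_def by (intro sums_mult sums_add sm s1 s2)
    define b where "b = (\<lambda>j. c j powr (1 / p))"
    have bp: "b j powr p = c j" for j
      using p c0[of j] by (simp add: b_def powr_powr)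
    show "\<exists>b. (\<forall>j. 0 \<le> b j)
      \<and> (\<forall>j t. t \<in> dyadic_interval j \<longrightarrow> norm (f (complex_of_real t)) \<le> b j * (2 ^ j) powr ((\<alpha> + 2) / p))
      \<and> summable (\<lambda>j. b j powr p) \<and> (\<Sum>j. b j powr p) \<le> 3 * C * enn2real (bergman_integral p \<alpha> f)"
    proof (intro exI[of _ b] conjI allI impI)
      show "0 \<le> b j" for j by (simp add: b_def)
      show "summable (\<lambda>j. b j powr p)" unfolding bp using sc by (rule sums_summable)
      have "(\<Sum>j. b j powr p) = C * (I + (I - m 0) + (I - m 0 - m 1))"
        unfolding bp using sc by (rule sums_unique[symmetric])
      also have "\<dots> \<le> C * (3 * I)"
        using C m0[of 0] m0[of 1] by (intro mult_left_mono) auto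
      finally show "(\<Sum>j. b j powr p) \<le> 3 * C * enn2real (bergman_integral p \<alpha> f)"
        by (simp add: I_def)
      fix j t assume t: "t \<in> dyadic_interval j"
      have "ennreal (norm (f (complex_of_real t)) powr p * ((1 / 2) ^ j) powr (\<alpha> + 2)) \<le> ennreal (c j)"
        using C(2)[OF hol t] C(1) m0 by (simp add: me c_def ennreal_mult')
      then have "norm (f (complex_of_real t)) powr p * ((1 / 2) ^ j) powr (\<alpha> + 2) \<le> c j"
        using c0 by simp
      then have "norm (f (complex_of_real t)) powr p \<le> c j * (2 ^ j) powr (\<alpha> + 2)"
        by (simp add: power_one_over powr_divide field_simps)
      then have "(norm (f (complex_of_real t)) powr p) powr (1 / p) \<le> (c j * (2 ^ j) powr (\<alpha> + 2)) powr (1 / p)"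
        using p by (intro powr_mono2) auto
      then show "norm (f (complex_of_real t)) \<le> b j * (2 ^ j) powr ((\<alpha> + 2) / p)"
        using p c0[of j] by (simp add: powr_powr powr_mult b_def)
    qed
  qed
qed

section \<open>The integral representation\<close>

lemma hilb_factor_eq:
  fixes \<beta> :: real
  assumes "0 < \<beta>"
  shows "Gamma (real n + \<beta>) / (fact n * Gamma \<beta>) = pochhammer \<beta> n / fact n"
proof -
  have "\<beta> \<notin> \<int>\<^sub>\<le>\<^sub>0" using assms by (auto elim!: nonpos_Ints_cases)
  then show ?thesis by (simp add: pochhammer_Gamma add.commute)
qed

text \<open>The binomial series: its coefficients are the Gamma quotients in
  \<open>hilb_coef\<close>, so summation over the output index produces the kernel.\<close>

lemma pochhammer_sums_complex:
  fixes w :: complex and \<beta> :: real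
  assumes "norm w < 1"
  shows "(\<lambda>n. complex_of_real (pochhammer \<beta> n / fact n) * w ^ n) sums (1 - w) powr (- complex_of_real \<beta>)"
proof -
  have "(\<lambda>n. ((- complex_of_real \<beta>) gchoose n) * (- w) ^ n) sums (1 + (- w)) powr (- complex_of_real \<beta>)"
    using assms by (intro gen_binomial_complex) simp
  moreover have "((- complex_of_real \<beta>) gchoose n) * (- w) ^ n = complex_of_real (pochhammer \<beta> n / fact n) * w ^ n" for n
    unfolding power_minus[of w]
    by (simp add: gbinomial_pochhammer pochhammer_of_real flip: power_mult_distrib mult.assoc)
  ultimately show ?thesis by simp
qed

lemma pochhammer_summable:
  fixes x \<beta> :: real
  assumes "0 \<le> x" "x < 1" "0 < \<beta>"
  shows "summable (\<lambda>n. pochhammer \<beta> n / fact n * x ^ n)"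
proof -
  have "summable (\<lambda>n. complex_of_real (pochhammer \<beta> n / fact n) * (complex_of_real x) ^ n)"
    using pochhammer_sums_complex[of "complex_of_real x" \<beta>] assms by (auto dest: sums_summable)
  then have "summable (\<lambda>n. complex_of_real (pochhammer \<beta> n / fact n * x ^ n))"
    by simp
  then show ?thesis by (simp only: summable_complex_of_real)
qed

lemma taylor_sums:
  assumes "f holomorphic_on ball 0 R" "norm z < R"
  shows "(\<lambda>k. taylor_coeff f k * z ^ k) sums f z"
  using holomorphic_power_series[OF assms(1), of z] assms(2) by (simp add: taylor_coeff_def)

text \<open>The radius is free because the test functions, holomorphic beyond the unit circle, are
  needed at \<open>t = 1\<close>.\<close>

lemma taylor_norm_summable:
  assumes "f holomorphic_on ball 0 R" "0 \<le> t" "t < R"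
  shows "summable (\<lambda>k. norm (taylor_coeff f k) * t ^ k)"
proof -
  define s where "s = (t + R) / 2"
  have s: "t < s" "s < R" "0 < s" using assms by (auto simp: s_def)
  have "summable (\<lambda>k. taylor_coeff f k * complex_of_real s ^ k)"
    using taylor_sums[OF assms(1), of "complex_of_real s"] s by (auto dest: sums_summable)
  then have "summable (\<lambda>k. norm (taylor_coeff f k * complex_of_real t ^ k))"
    by (rule powser_insidea) (use assms s in auto)
  then show ?thesis using assms(2) by (simp add: norm_mult norm_power)
qed

text \<open>Finite total mass makes all moments finite; in the theorem it is read off from the
  Carleson condition at \<open>t = 0\<close>.\<close>

locale disc_measure = finite_measure \<mu> for \<mu> :: "real measure" +
  assumes sets_eq: "sets \<mu> = sets (restrict_space borel {0..<1})"
begin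

lemma space_eq: "space \<mu> = {0..<1}"
  using sets_eq_imp_space_eq[OF sets_eq] by (simp add: space_restrict_space)

lemma measurable_eq: "measurable \<mu> N = measurable (restrict_space borel {0..<1}) N"
  by (rule measurable_cong_sets) (auto simp: sets_eq)

lemma continuous_measurable:
  fixes g :: "real \<Rightarrow> 'a :: topological_space"
  shows "continuous_on {0..<1} g \<Longrightarrow> g \<in> borel_measurable \<mu>"
  unfolding measurable_eq by (rule borel_measurable_continuous_on_restrict)

lemma borel_sets_in:
  assumes "A \<in> sets borel" "A \<subseteq> {0..<1}"
  shows "A \<in> sets \<mu>"
  unfolding sets_eq sets_restrict_space using assms by (auto intro!: image_eqI[of _ _ A])

lemma holomorphic_measurable:
  assumes "f holomorphic_on ball 0 1"
  shows "(\<lambda>t. f (complex_of_real t)) \<in> borel_measurable \<mu>"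
  by (intro continuous_measurable continuous_on_compose2[OF holomorphic_on_imp_continuous_on[OF assms]])
     (auto intro!: continuous_intros)

lemma power_integrable: "integrable \<mu> (\<lambda>t. t ^ n)"
  by (rule integrable_const_bound[where B = 1])
     (auto intro!: AE_I2 continuous_measurable continuous_intros simp: space_eq power_le_one)

text \<open>Two exchanges of sum and integral. The sum over \<open>k\<close> is dominated through
  the hypothesis \<open>fin\<close>; the sum over \<open>n\<close> is the binomial series in
  \<open>t z\<close>, dominated by its value at \<open>norm z\<close> times the integral of the
  modulus of \<open>f\<close>.\<close>

lemma hilb_representation:
  assumes hol: "f holomorphic_on ball 0 1" and \<beta>: "0 < \<beta>"
    and fin: "(\<integral>\<^sup>+t. (\<Sum>k. ennreal (norm (taylor_coeff f k) * t ^ k)) \<partial>\<mu>) < \<infinity>"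
  shows "hilb_defined \<mu> \<beta> f" and "hilb_op \<mu> \<beta> f holomorphic_on ball 0 1"
    and "integrable \<mu> (\<lambda>t. f (complex_of_real t))"
    and "norm z < 1 \<Longrightarrow> integrable \<mu> (\<lambda>t. f (complex_of_real t) * (1 - complex_of_real t * z) powr (- complex_of_real \<beta>))"
    and "norm z < 1 \<Longrightarrow> hilb_op \<mu> \<beta> f z =
       (\<integral>t. f (complex_of_real t) * (1 - complex_of_real t * z) powr (- complex_of_real \<beta>) \<partial>\<mu>)"
proof -
  define a where "a = taylor_coeff f"
  define c where "c = (\<lambda>n. pochhammer \<beta> n / fact n :: real)"
  have c0: "0 \<le> c n" for n using \<beta> by (simp add: c_def pochhammer_nonneg)
  have fm [measurable]: "(\<lambda>t. f (complex_of_real t)) \<in> borel_measurable \<mu>"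
    by (rule holomorphic_measurable[OF hol])
  have pm [measurable]: "(\<lambda>t. t) \<in> borel_measurable \<mu>"
    by (intro continuous_measurable continuous_intros)
  have mom0: "0 \<le> (\<integral>t. t ^ n \<partial>\<mu>)" for n
    by (intro integral_nonneg_AE AE_I2) (auto simp: space_eq)
  have sn: "summable (\<lambda>k. norm (a k) * t ^ k)" if "t \<in> {0..<1}" for t
    unfolding a_def using that by (intro taylor_norm_summable[OF hol]) auto
  have "(\<Sum>k. ennreal (norm (a k) * (\<integral>t. t ^ k \<partial>\<mu>))) = (\<Sum>k. \<integral>\<^sup>+t. ennreal (norm (a k) * t ^ k) \<partial>\<mu>)"
  proof (intro arg_cong[of _ _ suminf] ext)
    fix k
    have "(\<integral>\<^sup>+t. ennreal (norm (a k) * t ^ k) \<partial>\<mu>) = ennreal (\<integral>t. norm (a k) * t ^ k \<partial>\<mu>)"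
      by (intro nn_integral_eq_integral integrable_mult_right power_integrable AE_I2) (auto simp: space_eq)
    then show "ennreal (norm (a k) * (\<integral>t. t ^ k \<partial>\<mu>)) = (\<integral>\<^sup>+t. ennreal (norm (a k) * t ^ k) \<partial>\<mu>)"
      by simp
  qed
  also have "\<dots> = (\<integral>\<^sup>+t. (\<Sum>k. ennreal (norm (a k) * t ^ k)) \<partial>\<mu>)"
    by (rule nn_integral_suminf[symmetric]) measurable
  also have "\<dots> < \<infinity>" using fin by (simp add: a_def)
  finally have "summable (\<lambda>k. norm (a k) * (\<integral>t. t ^ k \<partial>\<mu>))"
    by (intro summable_suminf_not_top) (auto intro!: mult_nonneg_nonneg mom0)
  \<comment> \<open>Moments decrease in the exponent on \<open>[0, 1)\<close>, so
    \<open>n = 0\<close> dominates every \<open>n\<close>.\<close>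
  then have sk: "summable (\<lambda>k. norm (a k) * (\<integral>t. t ^ (n + k) \<partial>\<mu>))" for n
  proof (rule summable_comparison_test')
    fix k :: nat assume "k \<ge> 0"
    have "(\<integral>t. t ^ (n + k) \<partial>\<mu>) \<le> (\<integral>t. t ^ k \<partial>\<mu>)"
      by (intro integral_mono power_integrable power_decreasing) (auto simp: space_eq)
    moreover have "0 \<le> (\<integral>t. t ^ (n + k) \<partial>\<mu>)"
      by (intro integral_nonneg_AE AE_I2) (auto simp: space_eq)
    ultimately show "norm (norm (a k) * (\<integral>t. t ^ (n + k) \<partial>\<mu>)) \<le> norm (a k) * (\<integral>t. t ^ k \<partial>\<mu>)"
      by (simp add: mult_left_mono abs_mult)
  qed
  have inner: "(\<lambda>k. \<integral>t. a k * complex_of_real (t ^ (n + k)) \<partial>\<mu>) sums (\<integral>t. complex_of_real (t ^ n) * f (complex_of_real t) \<partial>\<mu>)"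
    and innerI: "integrable \<mu> (\<lambda>t. complex_of_real (t ^ n) * f (complex_of_real t))" for n
  proof -
    have i: "integrable \<mu> (\<lambda>t. a k * complex_of_real (t ^ (n + k)))" for k
      by (intro integrable_mult_right integrable_of_real power_integrable)
    have s: "AE t in \<mu>. summable (\<lambda>k. norm (a k * complex_of_real (t ^ (n + k))))"
    proof (rule AE_I2)
      fix t assume t: "t \<in> space \<mu>"
      have "summable (\<lambda>k. t ^ n * (norm (a k) * t ^ k))"
        using t by (intro summable_mult sn) (simp add: space_eq)
      then show "summable (\<lambda>k. norm (a k * complex_of_real (t ^ (n + k))))"
        using t by (simp add: space_eq norm_mult power_add norm_power mult_ac)
    qed
    have "(\<integral>t. norm (a k * complex_of_real (t ^ (n + k))) \<partial>\<mu>) = norm (a k) * (\<integral>t. t ^ (n + k) \<partial>\<mu>)" for k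
    proof -
      have "(\<integral>t. norm (a k * complex_of_real (t ^ (n + k))) \<partial>\<mu>) = (\<integral>t. norm (a k) * t ^ (n + k) \<partial>\<mu>)"
        by (intro Bochner_Integration.integral_cong refl) (auto simp: space_eq norm_mult norm_power)
      then show ?thesis by simp
    qed
    then have ss: "summable (\<lambda>k. \<integral>t. norm (a k * complex_of_real (t ^ (n + k))) \<partial>\<mu>)"
      using sk[of n] by simp
    have eq: "(\<Sum>k. a k * complex_of_real (t ^ (n + k))) = complex_of_real (t ^ n) * f (complex_of_real t)"
      if "t \<in> space \<mu>" for t
    proof -
      have "(\<lambda>k. complex_of_real (t ^ n) * (a k * complex_of_real t ^ k)) sums (complex_of_real (t ^ n) * f (complex_of_real t))"
        unfolding a_def using that by (intro sums_mult taylor_sums[OF hol]) (auto simp: space_eq)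
      then show ?thesis
        by (intro sums_unique[symmetric]) (simp add: power_add mult_ac)
    qed
    have "(\<lambda>k. \<integral>t. a k * complex_of_real (t ^ (n + k)) \<partial>\<mu>) sums (\<integral>t. (\<Sum>k. a k * complex_of_real (t ^ (n + k))) \<partial>\<mu>)"
      by (rule sums_integral[OF i s ss])
    also have "(\<integral>t. (\<Sum>k. a k * complex_of_real (t ^ (n + k))) \<partial>\<mu>) = (\<integral>t. complex_of_real (t ^ n) * f (complex_of_real t) \<partial>\<mu>)"
      by (intro Bochner_Integration.integral_cong refl eq)
    finally show "(\<lambda>k. \<integral>t. a k * complex_of_real (t ^ (n + k)) \<partial>\<mu>) sums (\<integral>t. complex_of_real (t ^ n) * f (complex_of_real t) \<partial>\<mu>)" .
    have "integrable \<mu> (\<lambda>t. (\<Sum>k. a k * complex_of_real (t ^ (n + k))))"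
      by (rule integrable_suminf[OF i s ss])
    then show "integrable \<mu> (\<lambda>t. complex_of_real (t ^ n) * f (complex_of_real t))"
      by (subst (asm) Bochner_Integration.integrable_cong[OF refl eq]) auto
  qed
  have coef: "(\<lambda>k. complex_of_real (hilb_coef \<mu> \<beta> n k) * taylor_coeff f k) sums
     (complex_of_real (c n) * (\<integral>t. complex_of_real (t ^ n) * f (complex_of_real t) \<partial>\<mu>))" for n
  proof -
    have "complex_of_real (hilb_coef \<mu> \<beta> n k) * taylor_coeff f k
        = complex_of_real (c n) * (\<integral>t. a k * complex_of_real (t ^ (n + k)) \<partial>\<mu>)" for k
      unfolding integral_mult_right_zero integral_complex_of_real
      by (simp add: hilb_coef_def hilb_factor_eq[OF \<beta>] c_def a_def)
    then show ?thesis
      using sums_mult[OF inner, of "complex_of_real (c n)" n] by (simp only:)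
  qed
  have hi: "hilb_inner \<mu> \<beta> f n = complex_of_real (c n) * (\<integral>t. complex_of_real (t ^ n) * f (complex_of_real t) \<partial>\<mu>)" for n
    unfolding hilb_inner_def using coef[of n] by (rule sums_unique[symmetric])
  show fint: "integrable \<mu> (\<lambda>t. f (complex_of_real t))"
    using innerI[of 0] by simp
  have outer: "(\<lambda>n. hilb_inner \<mu> \<beta> f n * z ^ n) sums
      (\<integral>t. f (complex_of_real t) * (1 - complex_of_real t * z) powr (- complex_of_real \<beta>) \<partial>\<mu>)"
    and outerI: "integrable \<mu> (\<lambda>t. f (complex_of_real t) * (1 - complex_of_real t * z) powr (- complex_of_real \<beta>))"
    if z: "norm z < 1" for z
  proof -
    define T where "T = (\<lambda>n t. complex_of_real (c n) * z ^ n * (complex_of_real (t ^ n) * f (complex_of_real t)))"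
    have i: "integrable \<mu> (T n)" for n
      unfolding T_def by (intro integrable_mult_right innerI)
    have tz: "norm (complex_of_real t * z) < 1" "norm (complex_of_real t * z) \<le> norm z" if "t \<in> space \<mu>" for t
    proof -
      have "t * norm z \<le> 1 * norm z" using that by (intro mult_right_mono) (auto simp: space_eq)
      then show "norm (complex_of_real t * z) < 1" "norm (complex_of_real t * z) \<le> norm z"
        using that z by (auto simp: norm_mult space_eq)
    qed
    \<comment> \<open>As \<open>t < 1\<close>, the series at \<open>norm z\<close> majorises all
      series at \<open>t z\<close>, uniformly in \<open>t\<close>.\<close>
    have sc: "summable (\<lambda>n. c n * norm z ^ n)"
      unfolding c_def using z \<beta> by (intro pochhammer_summable) auto
    have Tn: "norm (T n t) \<le> c n * norm z ^ n * norm (f (complex_of_real t))" if "t \<in> space \<mu>" for n t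
    proof -
      have "t ^ n * norm (f (complex_of_real t)) \<le> 1 * norm (f (complex_of_real t))"
        using that by (intro mult_right_mono power_le_one) (auto simp: space_eq)
      then have "c n * norm z ^ n * (t ^ n * norm (f (complex_of_real t))) \<le> c n * norm z ^ n * (1 * norm (f (complex_of_real t)))"
        using c0 by (intro mult_left_mono) auto
      then show ?thesis using c0 that by (simp add: T_def norm_mult norm_power space_eq)
    qed
    have s: "AE t in \<mu>. summable (\<lambda>n. norm (T n t))"
    proof (rule AE_I2)
      fix t assume "t \<in> space \<mu>"
      then show "summable (\<lambda>n. norm (T n t))"
        by (intro summable_comparison_test'[OF summable_mult2[OF sc], of 0 _ "norm (f (complex_of_real t))"]) (simp add: Tn)
    qed
    have ss: "summable (\<lambda>n. \<integral>t. norm (T n t) \<partial>\<mu>)"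
    proof (rule summable_comparison_test'[OF summable_mult2[OF sc]])
      fix n :: nat assume "n \<ge> 0"
      have "(\<integral>t. norm (T n t) \<partial>\<mu>) \<le> (\<integral>t. c n * norm z ^ n * norm (f (complex_of_real t)) \<partial>\<mu>)"
        by (intro integral_mono integrable_norm i integrable_mult_right fint Tn)
      then show "norm (\<integral>t. norm (T n t) \<partial>\<mu>) \<le> c n * norm z ^ n * (\<integral>t. norm (f (complex_of_real t)) \<partial>\<mu>)"
        by simp
    qed
    have eq: "(\<Sum>n. T n t) = f (complex_of_real t) * (1 - complex_of_real t * z) powr (- complex_of_real \<beta>)"
      if "t \<in> space \<mu>" for t
    proof -
      have "(\<lambda>n. f (complex_of_real t) * (complex_of_real (c n) * (complex_of_real t * z) ^ n)) sums
         (f (complex_of_real t) * (1 - complex_of_real t * z) powr (- complex_of_real \<beta>))"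
        unfolding c_def by (intro sums_mult pochhammer_sums_complex tz that)
      then show ?thesis
        by (intro sums_unique[symmetric]) (simp add: T_def power_mult_distrib mult_ac)
    qed
    have "(\<lambda>n. \<integral>t. T n t \<partial>\<mu>) sums (\<integral>t. (\<Sum>n. T n t) \<partial>\<mu>)"
      by (rule sums_integral[OF i s ss])
    also have "(\<integral>t. (\<Sum>n. T n t) \<partial>\<mu>) = (\<integral>t. f (complex_of_real t) * (1 - complex_of_real t * z) powr (- complex_of_real \<beta>) \<partial>\<mu>)"
      by (intro Bochner_Integration.integral_cong refl eq)
    also have "(\<lambda>n. \<integral>t. T n t \<partial>\<mu>) = (\<lambda>n. hilb_inner \<mu> \<beta> f n * z ^ n)"
      unfolding T_def integral_mult_right_zero hi by (simp add: mult_ac)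
    finally show "(\<lambda>n. hilb_inner \<mu> \<beta> f n * z ^ n) sums
      (\<integral>t. f (complex_of_real t) * (1 - complex_of_real t * z) powr (- complex_of_real \<beta>) \<partial>\<mu>)" .
    have "integrable \<mu> (\<lambda>t. (\<Sum>n. T n t))"
      by (rule integrable_suminf[OF i s ss])
    then show "integrable \<mu> (\<lambda>t. f (complex_of_real t) * (1 - complex_of_real t * z) powr (- complex_of_real \<beta>))"
      by (subst (asm) Bochner_Integration.integrable_cong[OF refl eq]) auto
  qed
  show "hilb_defined \<mu> \<beta> f"
    unfolding hilb_defined_def
    using sums_summable[OF coef] sums_summable[OF outer] by auto
  have op: "(\<lambda>n. hilb_inner \<mu> \<beta> f n * z ^ n) sums hilb_op \<mu> \<beta> f z" if "norm z < 1" for z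
    unfolding hilb_op_def using outer[OF that] by (intro summable_sums) (rule sums_summable)
  then show "hilb_op \<mu> \<beta> f holomorphic_on ball 0 1"
    by (intro power_series_holomorphic[where a = "hilb_inner \<mu> \<beta> f"]) (simp add: dist_norm)
  show "integrable \<mu> (\<lambda>t. f (complex_of_real t) * (1 - complex_of_real t * z) powr (- complex_of_real \<beta>))"
    if "norm z < 1" by (rule outerI[OF that])
  show "hilb_op \<mu> \<beta> f z =
       (\<integral>t. f (complex_of_real t) * (1 - complex_of_real t * z) powr (- complex_of_real \<beta>) \<partial>\<mu>)" if "norm z < 1"
    using sums_unique2[OF op[OF that] outer[OF that]] .
qed

end

section \<open>Absolute convergence of the coefficient series\<close>

lemma disjoint_dyadic_interval: "disjoint_family dyadic_interval"
proof -
  have "dyadic_interval i \<inter> dyadic_interval j = {}" if "i < j" for i j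
    using half_power_mono[of "Suc i" j] that by (auto simp: dyadic_interval_def)
  then show ?thesis by (rule disjoint_family_lessI)
qed

lemma UN_dyadic_interval: "(\<Union>j. dyadic_interval j) = {0..<1}"
proof (intro equalityI subsetI)
  fix t :: real assume t: "t \<in> {0..<1}"
  then obtain n where "(1 / 2) ^ Suc n < 1 - t" "1 - t \<le> (1 / 2) ^ n"
    using dyadic_scale[of "1 - t" 1] by auto
  then have "t \<in> dyadic_interval n" by (auto simp: dyadic_interval_def)
  then show "t \<in> (\<Union>j. dyadic_interval j)" by blast
next
  fix t assume "t \<in> (\<Union>j. dyadic_interval j)"
  then obtain j where j: "t \<in> dyadic_interval j" by blast
  have "(1 / 2 :: real) ^ j \<le> 1" "0 < (1 / 2 :: real) ^ Suc j" by (auto simp: power_le_one)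
  then show "t \<in> {0..<1}" using j unfolding dyadic_interval_def atLeastLessThan_iff by linarith
qed

lemma dyadic_interval_borel [measurable]: "dyadic_interval j \<in> sets borel"
  by (simp add: dyadic_interval_def)

text \<open>The power \<open>t ^ k\<close> is split into two factors \<open>q ^ k\<close>. One is
  absorbed by the area mean over an annulus outside radius \<open>q\<close>, which bounds
  \<open>norm (taylor_coeff f k) * q ^ k\<close> at the price of the inverse area
  \<open>8 / \<epsilon>\<close>; the other leaves a geometric series with sum
  \<open>4 / \<epsilon>\<close>. Hence the constant 32 and the power 2.\<close>

lemma taylor_majorant_dyadic:
  assumes hol: "f holomorphic_on ball 0 1" and t: "t \<in> dyadic_interval j"
  defines "B \<equiv> {z :: complex. 1 - (1 / 2) ^ j / 4 \<le> norm z \<and> norm z < 1 - (1 / 2) ^ j / 8}"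
  shows "(\<Sum>k. ennreal (norm (taylor_coeff f k) * t ^ k)) \<le>
     ennreal (32 * (2 ^ j) powr 2) * (\<integral>\<^sup>+z. indicator B z * ennreal (norm (f z)) \<partial>lborel)"
proof -
  define \<epsilon> where "\<epsilon> = (1 / 2 :: real) ^ j"
  have \<epsilon>: "0 < \<epsilon>" "\<epsilon> \<le> 1" by (auto simp: \<epsilon>_def power_le_one)
  \<comment> \<open>A rational stand-in for the square root of \<open>t\<close>: since
    \<open>t < 1 - \<epsilon> / 2\<close>, one has \<open>t \<le> q * q\<close>.\<close>
  define q where "q = 1 - \<epsilon> / 4"
  have q: "0 < q" "q < 1" using \<epsilon> by (auto simp: q_def)
  have B: "B = {z. q \<le> norm z \<and> norm z < 1 - \<epsilon> / 8}" by (simp add: B_def q_def \<epsilon>_def)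
  have [measurable]: "B \<in> sets borel" unfolding B by measurable
  have tq: "0 \<le> t" "t \<le> q * q"
  proof -
    have "t \<in> {0..<1}" using t UN_dyadic_interval by blast
    then show "0 \<le> t" by simp
    have "t < 1 - \<epsilon> / 2" using t by (simp add: dyadic_interval_def \<epsilon>_def)
    also have "\<dots> \<le> q * q" by (simp add: q_def algebra_simps)
    finally show "t \<le> q * q" by simp
  qed
  define X where "X = (\<integral>\<^sup>+z. indicator B z * ennreal (norm (f z)) \<partial>lborel)"
  have area: "emeasure lborel B \<ge> ennreal (\<epsilon> / 8)"
  proof -
    have "(1 - \<epsilon> / 8)\<^sup>2 - q\<^sup>2 = \<epsilon> / 8 * (2 - 3 * \<epsilon> / 8)"
      by (simp add: q_def power2_eq_square algebra_simps)
    also have "\<dots> \<ge> \<epsilon> / 8 * 1" using \<epsilon> by (intro mult_left_mono) auto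
    finally have "\<epsilon> / 8 \<le> (1 - \<epsilon> / 8)\<^sup>2 - q\<^sup>2" by simp
    moreover have "1 * ((1 - \<epsilon> / 8)\<^sup>2 - q\<^sup>2) \<le> pi * ((1 - \<epsilon> / 8)\<^sup>2 - q\<^sup>2)"
      using pi_ge_two \<open>\<epsilon> / 8 \<le> _\<close> \<epsilon> by (intro mult_right_mono) auto
    moreover have "emeasure lborel B = ennreal (pi * ((1 - \<epsilon> / 8)\<^sup>2 - q\<^sup>2))"
      unfolding B using q \<epsilon> by (intro emeasure_complex_annulus) (auto simp: q_def)
    ultimately show ?thesis by (simp add: ennreal_leI)
  qed
  have k: "ennreal (norm (taylor_coeff f k) * t ^ k) \<le> ennreal (8 / \<epsilon> * q ^ k) * X" for k
  proof -
    have "norm (taylor_coeff f k) * t ^ k \<le> norm (taylor_coeff f k) * (q * q) ^ k"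
      using tq by (intro mult_left_mono power_mono) auto
    also have "\<dots> = 8 / \<epsilon> * q ^ k * (norm (taylor_coeff f k) * q ^ k) * (\<epsilon> / 8)"
      using \<epsilon> by (simp add: power_mult_distrib)
    finally have "ennreal (norm (taylor_coeff f k) * t ^ k)
        \<le> ennreal (8 / \<epsilon> * q ^ k) * (ennreal (norm (taylor_coeff f k) * q ^ k) * ennreal (\<epsilon> / 8))"
      using q \<epsilon> by (simp add: mult.assoc ennreal_leI flip: ennreal_mult)
    also have "\<dots> \<le> ennreal (8 / \<epsilon> * q ^ k) * (ennreal (norm (taylor_coeff f k) * q ^ k) * emeasure lborel B)"
      by (intro mult_left_mono area) auto
    also have "ennreal (norm (taylor_coeff f k) * q ^ k) * emeasure lborel B \<le> X"
    proof -
      have "ennreal (norm ((deriv ^^ k) f 0 / fact k) * q ^ k) * emeasure lborel B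
          \<le> (\<integral>\<^sup>+w. indicator B w * ennreal (norm (f (0 + w))) \<partial>lborel)"
        using q \<epsilon> by (intro norm_deriv_le_area_mean[OF hol]) (auto simp: B norm_mult intro: power_mono)
      then show ?thesis by (simp add: taylor_coeff_def X_def)
    qed
    finally show ?thesis by (simp add: mult_left_mono)
  qed
  have "(\<Sum>k. ennreal (norm (taylor_coeff f k) * t ^ k)) \<le> (\<Sum>k. ennreal (8 / \<epsilon> * q ^ k) * X)"
    by (intro suminf_le k) auto
  also have "\<dots> = (\<Sum>k. ennreal (8 / \<epsilon> * q ^ k)) * X" by simp
  also have "(\<Sum>k. ennreal (8 / \<epsilon> * q ^ k)) = ennreal (8 / \<epsilon> * (1 / (1 - q)))"
    using q \<epsilon> by (intro suminf_ennreal_eq sums_mult geometric_sums) auto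
  also have "8 / \<epsilon> * (1 / (1 - q)) = 32 * (2 ^ j) powr 2"
    by (simp add: q_def \<epsilon>_def power_one_over powr_numeral power2_eq_square)
  finally show ?thesis by (simp add: X_def)
qed

text \<open>On \<open>dyadic_interval j\<close> the majorant costs
  \<open>(2 ^ j) powr (\<gamma> + 2)\<close> times the weighted mass \<open>Y j\<close> of the
  matching annulus, and the mass of the interval cancels this factor. The annuli are disjoint, so
  the sum of the \<open>Y j\<close> is at most the integral of exponent 1.\<close>

lemma (in disc_measure) taylor_majorant_integrable:
  assumes hol: "f holomorphic_on ball 0 1" and fin: "bergman_integral 1 \<gamma> f < \<infinity>"
    and M: "\<And>j. measure \<mu> {1 - (1 / 2) ^ j ..< 1} \<le> M * ((1 / 2) ^ j) powr (\<gamma> + 2)"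
  shows "(\<integral>\<^sup>+t. (\<Sum>k. ennreal (norm (taylor_coeff f k) * t ^ k)) \<partial>\<mu>) < \<infinity>"
proof -
  define h where "h = (\<lambda>t. \<Sum>k. ennreal (norm (taylor_coeff f k) * t ^ k))"
  define B where "B = (\<lambda>j. {z :: complex. 1 - (1 / 2) ^ j / 4 \<le> norm z \<and> norm z < 1 - (1 / 2) ^ j / 8})"
  define c where "c = min ((1 / 8 :: real) powr \<gamma>) ((1 / 2) powr \<gamma>)"
  have c: "0 < c" by (simp add: c_def)
  have M0: "0 \<le> M" using order_trans[OF measure_nonneg M[of 0]] by simp
  have pm [measurable]: "(\<lambda>t. t) \<in> borel_measurable \<mu>"
    by (intro continuous_measurable continuous_intros)
  have hm [measurable]: "h \<in> borel_measurable \<mu>" unfolding h_def by measurable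
  have [measurable]: "dyadic_interval j \<in> sets \<mu>" for j
    using UN_dyadic_interval by (intro borel_sets_in) auto
  have [measurable]: "B j \<in> sets borel" for j unfolding B_def by measurable
  have Bball: "B j \<subseteq> ball 0 1" for j
    by (auto simp: B_def)
  define Y where "Y = (\<lambda>j. \<integral>\<^sup>+z. indicator (B j) z * ennreal (norm (f z) powr 1 * bergman_weight \<gamma> z) \<partial>lborel)"
  have low: "c * ((1 / 2) ^ j) powr \<gamma> \<le> bergman_weight \<gamma> z" if "z \<in> B j" for z j
  proof -
    have n: "norm z < 1" using that Bball[of j] by auto
    have "1 / 8 * (1 / 2) ^ j \<le> 1 - (norm z)\<^sup>2" "1 - (norm z)\<^sup>2 \<le> 1 / 2 * (1 / 2) ^ j"
      using that one_minus_norm_sq_bounds[OF n] by (auto simp: B_def)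
    then show ?thesis unfolding c_def bergman_weight_def by (intro powr_comparable(1)) auto
  qed
  have XY: "ennreal (32 * (2 ^ j) powr 2) * (\<integral>\<^sup>+z. indicator (B j) z * ennreal (norm (f z)) \<partial>lborel)
      \<le> ennreal (32 / c * (2 ^ j) powr (\<gamma> + 2)) * Y j" for j
  proof -
    have [measurable]: "(\<lambda>z. indicator (B j) z * ennreal (norm (f z) powr 1 * bergman_weight \<gamma> z)) \<in> borel_measurable borel"
      by (intro borel_measurable_bergman_integrand[OF hol Bball]) auto
    have "(\<integral>\<^sup>+z. indicator (B j) z * ennreal (norm (f z)) \<partial>lborel) \<le>
        (\<integral>\<^sup>+z. ennreal ((2 ^ j) powr \<gamma> / c) * (indicator (B j) z * ennreal (norm (f z) powr 1 * bergman_weight \<gamma> z)) \<partial>lborel)"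
    proof (rule nn_integral_mono)
      fix z
      show "indicator (B j) z * ennreal (norm (f z)) \<le>
         ennreal ((2 ^ j) powr \<gamma> / c) * (indicator (B j) z * ennreal (norm (f z) powr 1 * bergman_weight \<gamma> z))"
      proof (cases "z \<in> B j")
        case True
        have "norm (f z) = (2 ^ j) powr \<gamma> / c * (norm (f z) * (c * ((1 / 2) ^ j) powr \<gamma>))"
          using c by (simp add: power_one_over powr_divide)
        also have "\<dots> \<le> (2 ^ j) powr \<gamma> / c * (norm (f z) * bergman_weight \<gamma> z)"
          using c by (intro mult_left_mono low True) auto
        finally have "ennreal (norm (f z)) \<le> ennreal ((2 ^ j) powr \<gamma> / c * (norm (f z) * bergman_weight \<gamma> z))"
          by (rule ennreal_leI)
        then show ?thesis using True c by (simp flip: ennreal_mult)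
      qed simp
    qed
    also have "\<dots> = ennreal ((2 ^ j) powr \<gamma> / c) * Y j"
      unfolding Y_def by (rule nn_integral_cmult) measurable
    finally have "ennreal (32 * (2 ^ j) powr 2) * (\<integral>\<^sup>+z. indicator (B j) z * ennreal (norm (f z)) \<partial>lborel)
       \<le> ennreal (32 * (2 ^ j) powr 2) * (ennreal ((2 ^ j) powr \<gamma> / c) * Y j)"
      by (rule mult_left_mono) simp
    also have "\<dots> = ennreal (32 / c * (2 ^ j) powr (\<gamma> + 2)) * Y j"
    proof -
      have "32 * (2 ^ j) powr 2 * ((2 ^ j) powr \<gamma> / c) = 32 / c * (2 ^ j) powr (\<gamma> + 2)"
        by (simp only: powr_add divide_inverse mult_ac)
      then have "ennreal (32 * (2 ^ j) powr 2) * ennreal ((2 ^ j) powr \<gamma> / c) = ennreal (32 / c * (2 ^ j) powr (\<gamma> + 2))"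
        using c by (subst ennreal_mult[symmetric]) auto
      then show ?thesis by (simp only: mult.assoc[symmetric])
    qed
    finally show ?thesis .
  qed
  have disj: "disjoint_family B"
  proof -
    have "B i \<inter> B j = {}" if "i < j" for i j
      using half_power_mono[of "Suc i" j] that by (auto simp: B_def)
    then show ?thesis by (rule disjoint_family_lessI)
  qed
  have sumY: "(\<Sum>j. Y j) \<le> bergman_integral 1 \<gamma> f"
  proof -
    define g where "g = (\<lambda>z. indicator (ball 0 1) z * ennreal (norm (f z) powr 1 * bergman_weight \<gamma> z))"
    have [measurable]: "g \<in> borel_measurable borel"
      unfolding g_def by (rule borel_measurable_bergman_integrand[OF hol]) auto
    have "Y = (\<lambda>j. \<integral>\<^sup>+z\<in>B j. g z \<partial>lborel)"
      unfolding Y_def using Bball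
      by (intro ext nn_integral_cong) (fastforce simp: g_def split: split_indicator)
    then have "(\<Sum>j. Y j) = (\<integral>\<^sup>+z\<in>(\<Union>j. B j). g z \<partial>lborel)"
      using disj by (subst nn_integral_disjoint_family) auto
    also have "\<dots> \<le> bergman_integral 1 \<gamma> f"
      unfolding bergman_integral_weight g_def by (intro nn_integral_mono) (auto split: split_indicator)
    finally show ?thesis .
  qed
  have "(\<integral>\<^sup>+t. h t \<partial>\<mu>) = (\<integral>\<^sup>+t\<in>(\<Union>j. dyadic_interval j). h t \<partial>\<mu>)"
    by (intro nn_integral_cong) (simp add: UN_dyadic_interval space_eq)
  also have "\<dots> = (\<Sum>j. \<integral>\<^sup>+t\<in>dyadic_interval j. h t \<partial>\<mu>)"
    by (intro nn_integral_disjoint_family disjoint_dyadic_interval) auto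
  also have "\<dots> \<le> (\<Sum>j. ennreal (32 / c * M) * Y j)"
  proof (intro suminf_le)
    fix j
    have "(\<integral>\<^sup>+t\<in>dyadic_interval j. h t \<partial>\<mu>) \<le> (\<integral>\<^sup>+t. ennreal (32 / c * (2 ^ j) powr (\<gamma> + 2)) * Y j * indicator (dyadic_interval j) t \<partial>\<mu>)"
    proof (intro nn_integral_mono)
      fix t
      show "h t * indicator (dyadic_interval j) t \<le> ennreal (32 / c * (2 ^ j) powr (\<gamma> + 2)) * Y j * indicator (dyadic_interval j) t"
      proof (cases "t \<in> dyadic_interval j")
        case True
        have "h t \<le> ennreal (32 * (2 ^ j) powr 2) * (\<integral>\<^sup>+z. indicator (B j) z * ennreal (norm (f z)) \<partial>lborel)"
          unfolding h_def B_def by (rule taylor_majorant_dyadic[OF hol True])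
        also note XY
        finally show ?thesis using True by simp
      qed simp
    qed
    also have "\<dots> = ennreal (32 / c * (2 ^ j) powr (\<gamma> + 2)) * Y j * emeasure \<mu> (dyadic_interval j)"
      by (rule nn_integral_cmult_indicator) simp
    also have "\<dots> \<le> ennreal (32 / c * (2 ^ j) powr (\<gamma> + 2)) * Y j * ennreal (M * ((1 / 2) ^ j) powr (\<gamma> + 2))"
    proof (intro mult_left_mono)
      have "emeasure \<mu> (dyadic_interval j) \<le> emeasure \<mu> {1 - (1 / 2) ^ j ..< 1}"
        by (intro emeasure_mono borel_sets_in) (auto simp: dyadic_interval_def power_le_one intro: less_le_trans)
      also have "\<dots> \<le> ennreal (M * ((1 / 2) ^ j) powr (\<gamma> + 2))"
        unfolding emeasure_eq_measure by (intro ennreal_leI M)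
      finally show "emeasure \<mu> (dyadic_interval j) \<le> ennreal (M * ((1 / 2) ^ j) powr (\<gamma> + 2))" .
    qed simp
    also have "\<dots> = ennreal (32 / c * (2 ^ j) powr (\<gamma> + 2)) * ennreal (M * ((1 / 2) ^ j) powr (\<gamma> + 2)) * Y j"
      by (simp only: mult_ac)
    also have "ennreal (32 / c * (2 ^ j) powr (\<gamma> + 2)) * ennreal (M * ((1 / 2) ^ j) powr (\<gamma> + 2)) = ennreal (32 / c * M)"
      using c M0 by (simp add: power_one_over powr_divide flip: ennreal_mult)
    finally show "(\<integral>\<^sup>+t\<in>dyadic_interval j. h t \<partial>\<mu>) \<le> ennreal (32 / c * M) * Y j" .
  qed auto
  also have "\<dots> = ennreal (32 / c * M) * (\<Sum>j. Y j)" by simp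
  also have "\<dots> \<le> ennreal (32 / c * M) * bergman_integral 1 \<gamma> f"
    by (intro mult_left_mono sumY) auto
  also have "\<dots> < \<infinity>" using fin by (simp add: ennreal_mult_less_top)
  finally show ?thesis by (simp add: h_def)
qed

section \<open>Embeddings into weighted spaces of exponent 1\<close>

lemma weight_integral_finite:
  assumes "\<alpha> > -1"
  shows "(\<integral>\<^sup>+z. indicator (ball 0 1) z * ennreal (bergman_weight \<alpha> z) \<partial>lborel) < \<infinity>"
proof -
  obtain C where C: "\<And>\<delta>. 0 < \<delta> \<Longrightarrow> \<delta> \<le> 1 \<Longrightarrow>
    (\<integral>\<^sup>+z. indicator {z. 1 - \<delta> \<le> norm z \<and> norm z < 1} z * ennreal (bergman_weight \<alpha> z) \<partial>lborel)
      \<le> ennreal (C * \<delta> powr (\<alpha> + 1))"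
    using weight_annulus_bound[OF assms] by blast
  have "(\<integral>\<^sup>+z. indicator (ball 0 1) z * ennreal (bergman_weight \<alpha> z) \<partial>lborel)
    \<le> (\<integral>\<^sup>+z. indicator {z. 1 - 1 \<le> norm z \<and> norm z < 1} z * ennreal (bergman_weight \<alpha> z) \<partial>lborel)"
    by (intro nn_integral_mono) (auto split: split_indicator)
  also have "\<dots> \<le> ennreal (C * 1 powr (\<alpha> + 1))" by (rule C) auto
  finally show ?thesis using le_less_trans by fastforce
qed

text \<open>Write the modulus of \<open>f\<close> as its powers \<open>1 - p\<close> and
  \<open>p\<close>, and apply the point evaluation bound to the first factor only. This costs the
  weight exponent \<open>(\<alpha> + 2) (1 - p) / p\<close>, and \<open>\<alpha>\<close> plus this
  cost is \<open>(\<alpha> + 2) / p - 2\<close>.\<close>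

lemma bergman_embed_A1_le1:
  assumes f: "in_bergman p \<alpha> f" and p: "0 < p" "p \<le> 1" and \<alpha>: "\<alpha> > -1" and \<gamma>: "(\<alpha> + 2) / p - 2 \<le> \<gamma>"
  shows "bergman_integral 1 \<gamma> f < \<infinity>"
proof -
  have hol: "f holomorphic_on ball 0 1" and fin: "bergman_integral p \<alpha> f < \<infinity>"
    using f by (auto simp: in_bergman_def)
  obtain C where C: "C > 0" "\<And>f z. f holomorphic_on ball 0 1 \<Longrightarrow> norm z < 1 \<Longrightarrow>
    ennreal (norm (f z) powr p * (1 - norm z) powr (\<alpha> + 2))
    \<le> ennreal C * (\<integral>\<^sup>+w. indicator (ball z ((1 - norm z) / 4)) w
          * ennreal (norm (f w) powr p * bergman_weight \<alpha> w) \<partial>lborel)"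
    using bergman_point_bound[OF p(1)] by blast
  define I where "I = C * enn2real (bergman_integral p \<alpha> f)"
  have I0: "0 \<le> I" using C by (simp add: I_def)
  have pb: "norm (f z) powr p * (1 - norm z) powr (\<alpha> + 2) \<le> I" if z: "norm z < 1" for z
  proof -
    have "w \<in> ball 0 1" if "w \<in> ball z ((1 - norm z) / 4)" for w
    proof -
      have "norm w \<le> norm z + norm (w - z)"
        by (metis add_diff_cancel_left' diff_add_cancel norm_triangle_ineq)
      then show ?thesis using that z by (auto simp: dist_norm norm_minus_commute)
    qed
    then have "(\<integral>\<^sup>+w. indicator (ball z ((1 - norm z) / 4)) w
          * ennreal (norm (f w) powr p * bergman_weight \<alpha> w) \<partial>lborel) \<le> bergman_integral p \<alpha> f"
      unfolding bergman_integral_weight by (intro nn_integral_mono) (auto split: split_indicator)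
    then have "ennreal C * (\<integral>\<^sup>+w. indicator (ball z ((1 - norm z) / 4)) w
          * ennreal (norm (f w) powr p * bergman_weight \<alpha> w) \<partial>lborel) \<le> ennreal C * bergman_integral p \<alpha> f"
      by (rule mult_left_mono) simp
    also have "\<dots> = ennreal I"
      using fin C by (simp add: I_def ennreal_mult top.not_eq_extremum)
    finally have "ennreal (norm (f z) powr p * (1 - norm z) powr (\<alpha> + 2)) \<le> ennreal I"
      using C(2)[OF hol z] by (rule order_trans[rotated])
    then show ?thesis using I0 by simp
  qed
  define K where "K = (I * 2 powr (\<alpha> + 2)) powr ((1 - p) / p)"
  have pt: "norm (f z) powr 1 * bergman_weight \<gamma> z \<le> K * (norm (f z) powr p * bergman_weight \<alpha> z)"
    if z: "norm z < 1" for z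
  proof (cases "f z = 0")
    case False
    define x where "x = 1 - (norm z)\<^sup>2"
    have x: "0 < x" "x \<le> 1" "x \<le> 2 * (1 - norm z)"
      using one_minus_norm_sq_bounds[OF z] z by (auto simp: x_def)
    have "norm (f z) powr p * x powr (\<alpha> + 2) \<le> norm (f z) powr p * (2 * (1 - norm z)) powr (\<alpha> + 2)"
      using x \<alpha> by (intro mult_left_mono powr_mono2) auto
    also have "(2 * (1 - norm z)) powr (\<alpha> + 2) = 2 powr (\<alpha> + 2) * (1 - norm z) powr (\<alpha> + 2)"
      using z by (intro powr_mult)
    also have "norm (f z) powr p * (2 powr (\<alpha> + 2) * (1 - norm z) powr (\<alpha> + 2)) \<le> I * 2 powr (\<alpha> + 2)"
      using pb[OF z] by simp
    finally have "(norm (f z) powr p * x powr (\<alpha> + 2)) powr ((1 - p) / p) \<le> K"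
      unfolding K_def using p by (intro powr_mono2) auto
    also have "(norm (f z) powr p * x powr (\<alpha> + 2)) powr ((1 - p) / p)
        = norm (f z) powr (1 - p) * x powr ((\<alpha> + 2) * ((1 - p) / p))"
      using p by (simp add: powr_mult powr_powr)
    finally have K: "norm (f z) powr (1 - p) * x powr ((\<alpha> + 2) * ((1 - p) / p)) \<le> K" .
    have "x powr \<gamma> \<le> x powr (\<alpha> + (\<alpha> + 2) * ((1 - p) / p))"
    proof (rule powr_mono')
      have "\<alpha> + (\<alpha> + 2) * ((1 - p) / p) = (\<alpha> + 2) / p - 2" using p by (simp add: field_simps)
      then show "\<alpha> + (\<alpha> + 2) * ((1 - p) / p) \<le> \<gamma>" using \<gamma> by simp
    qed (use x in auto)
    then have "norm (f z) * x powr \<gamma> \<le> norm (f z) * x powr (\<alpha> + (\<alpha> + 2) * ((1 - p) / p))"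
      by (rule mult_left_mono) simp
    also have "\<dots> = (norm (f z) powr (1 - p) * x powr ((\<alpha> + 2) * ((1 - p) / p))) * (norm (f z) powr p * x powr \<alpha>)"
    proof -
      have "norm (f z) = norm (f z) powr (1 - p) * norm (f z) powr p"
        using False by (simp flip: powr_add)
      then show ?thesis by (simp add: powr_add mult_ac)
    qed
    also have "\<dots> \<le> K * (norm (f z) powr p * x powr \<alpha>)"
      using K by (rule mult_right_mono) simp
    finally show ?thesis by (simp add: bergman_weight_def x_def)
  qed simp
  have [measurable]: "(\<lambda>z. indicator (ball 0 1) z * ennreal (norm (f z) powr p * bergman_weight \<alpha> z)) \<in> borel_measurable borel"
    by (rule borel_measurable_bergman_integrand[OF hol]) auto
  have "bergman_integral 1 \<gamma> f \<le> (\<integral>\<^sup>+z. ennreal K * (indicator (ball 0 1) z * ennreal (norm (f z) powr p * bergman_weight \<alpha> z)) \<partial>lborel)"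
    unfolding bergman_integral_weight
  proof (intro nn_integral_mono)
    fix z
    show "indicator (ball 0 1) z * ennreal (norm (f z) powr 1 * bergman_weight \<gamma> z)
       \<le> ennreal K * (indicator (ball 0 1) z * ennreal (norm (f z) powr p * bergman_weight \<alpha> z))"
    proof (cases "z \<in> ball 0 1")
      case True
      then have "ennreal (norm (f z) powr 1 * bergman_weight \<gamma> z) \<le> ennreal (K * (norm (f z) powr p * bergman_weight \<alpha> z))"
        by (intro ennreal_leI pt) simp
      then show ?thesis using True by (simp add: ennreal_mult' K_def)
    qed simp
  qed
  also have "\<dots> = ennreal K * bergman_integral p \<alpha> f"
    unfolding bergman_integral_weight by (rule nn_integral_cmult) measurable
  also have "\<dots> < \<infinity>" using fin by (simp add: ennreal_mult_less_top)
  finally show ?thesis .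
qed

text \<open>Hoelder as a pointwise alternative: either the modulus of \<open>f\<close> is large
  enough for its \<open>p\<close>-th power to dominate, or it is below a power of the weight, and
  then a pure weight of exponent \<open>\<kappa>\<close> remains.\<close>

lemma bergman_embed_A1_gt1:
  assumes f: "in_bergman p \<alpha> f" and p: "1 < p" and \<gamma>: "(\<alpha> + 1) / p - 1 < \<gamma>"
  shows "bergman_integral 1 \<gamma> f < \<infinity>"
proof -
  have hol: "f holomorphic_on ball 0 1" and fin: "bergman_integral p \<alpha> f < \<infinity>"
    using f by (auto simp: in_bergman_def)
  \<comment> \<open>The exponent left at the threshold, where the modulus of \<open>f\<close> equals
    the weight base to the power \<open>(\<gamma> - \<alpha>) / (p - 1)\<close>. The hypothesis on
    \<open>\<gamma>\<close> says precisely \<open>\<kappa> > -1\<close>.\<close>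
  define \<kappa> where "\<kappa> = \<gamma> + (\<gamma> - \<alpha>) / (p - 1)"
  have "\<kappa> = (\<gamma> * p - \<alpha>) / (p - 1)" using p by (simp add: \<kappa>_def field_simps)
  moreover have "- (p - 1) < \<gamma> * p - \<alpha>" using \<gamma> p by (simp add: field_simps)
  ultimately have \<kappa>: "\<kappa> > -1" using p by (simp only: pos_less_divide_eq) simp
  have pt: "norm (f z) powr 1 * bergman_weight \<gamma> z \<le> norm (f z) powr p * bergman_weight \<alpha> z + bergman_weight \<kappa> z"
    if z: "norm z < 1" for z
  proof -
    define x where "x = 1 - (norm z)\<^sup>2"
    define y where "y = norm (f z)"
    have x: "0 < x" and y: "0 \<le> y"
      using one_minus_norm_sq_bounds[OF z] z by (auto simp: x_def y_def)
    have "y * x powr \<gamma> \<le> y powr p * x powr \<alpha> + x powr \<kappa>"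
    proof (cases "x powr (\<gamma> - \<alpha>) \<le> y powr (p - 1)")
      case True
      have "y * x powr \<gamma> = (y * x powr \<alpha>) * x powr (\<gamma> - \<alpha>)"
        using x by (simp flip: powr_add)
      also have "\<dots> \<le> (y * x powr \<alpha>) * y powr (p - 1)"
        using True y by (intro mult_left_mono) auto
      also have "\<dots> = y powr p * x powr \<alpha>"
        using y by (cases "y = 0") (simp_all add: powr_diff)
      finally show ?thesis by (simp add: add_increasing2)
    next
      case False
      then have "(y powr (p - 1)) powr (1 / (p - 1)) \<le> (x powr (\<gamma> - \<alpha>)) powr (1 / (p - 1))"
        using p by (intro powr_mono2) auto
      then have "y \<le> x powr ((\<gamma> - \<alpha>) / (p - 1))"
        using p y by (simp add: powr_powr)
      then have "y * x powr \<gamma> \<le> x powr ((\<gamma> - \<alpha>) / (p - 1)) * x powr \<gamma>"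
        by (rule mult_right_mono) simp
      also have "\<dots> = x powr \<kappa>" by (simp add: \<kappa>_def add.commute flip: powr_add)
      finally show ?thesis by (simp add: add_increasing)
    qed
    then show ?thesis using y by (simp add: bergman_weight_def x_def y_def)
  qed
  have [measurable]: "(\<lambda>z. indicator (ball 0 1) z * ennreal (norm (f z) powr p * bergman_weight \<alpha> z)) \<in> borel_measurable borel"
    by (rule borel_measurable_bergman_integrand[OF hol]) auto
  have [measurable]: "ball (0::complex) 1 \<in> sets borel" by simp
  have "bergman_integral 1 \<gamma> f \<le> (\<integral>\<^sup>+z. indicator (ball 0 1) z * ennreal (norm (f z) powr p * bergman_weight \<alpha> z)
      + indicator (ball 0 1) z * ennreal (bergman_weight \<kappa> z) \<partial>lborel)"
    unfolding bergman_integral_weight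
  proof (intro nn_integral_mono)
    fix z
    show "indicator (ball 0 1) z * ennreal (norm (f z) powr 1 * bergman_weight \<gamma> z)
       \<le> indicator (ball 0 1) z * ennreal (norm (f z) powr p * bergman_weight \<alpha> z)
      + indicator (ball 0 1) z * ennreal (bergman_weight \<kappa> z)"
    proof (cases "z \<in> ball 0 1")
      case True
      then have "ennreal (norm (f z) powr 1 * bergman_weight \<gamma> z) \<le> ennreal (norm (f z) powr p * bergman_weight \<alpha> z + bergman_weight \<kappa> z)"
        by (intro ennreal_leI pt) simp
      then show ?thesis using True by simp
    qed simp
  qed
  also have "\<dots> = bergman_integral p \<alpha> f + (\<integral>\<^sup>+z. indicator (ball 0 1) z * ennreal (bergman_weight \<kappa> z) \<partial>lborel)"
    unfolding bergman_integral_weight by (rule nn_integral_add) measurable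
  also have "\<dots> < \<infinity>" using fin weight_integral_finite[OF \<kappa>] by simp
  finally show ?thesis .
qed

text \<open>The Carleson exponent required for boundedness also gives absolute convergence:
  \<open>\<gamma>\<close> is that exponent minus 2, and it meets the threshold of the relevant
  embedding.\<close>

lemma (in disc_measure) taylor_majorant_finite:
  assumes f: "in_bergman p \<alpha> f" and p: "0 < p" "p \<le> q" "1 \<le> q" and \<alpha>: "\<alpha> > -1"
    and M: "\<And>j. measure \<mu> {1 - (1 / 2) ^ j ..< 1} \<le> M * ((1 / 2) ^ j) powr ((\<alpha> + 2) / p + (\<alpha> + 2) * (1 - 1 / q))"
  shows "(\<integral>\<^sup>+t. (\<Sum>k. ennreal (norm (taylor_coeff f k) * t ^ k)) \<partial>\<mu>) < \<infinity>"
proof -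
  define \<gamma> where "\<gamma> = (\<alpha> + 2) / p + (\<alpha> + 2) * (1 - 1 / q) - 2"
  have q: "0 \<le> 1 - 1 / q" using p by simp
  have fin: "bergman_integral 1 \<gamma> f < \<infinity>"
  proof (cases "p \<le> 1")
    case True
    have "0 \<le> (\<alpha> + 2) * (1 - 1 / q)" using q \<alpha> by (intro mult_nonneg_nonneg) auto
    then show ?thesis
      using True p \<alpha> by (intro bergman_embed_A1_le1[OF f]) (auto simp: \<gamma>_def)
  next
    case False
    \<comment> \<open>For \<open>p > 1\<close> the embedding needs a strict inequality. The margin
      is \<open>(\<alpha> + 1) (1 - 1/q) + (1/p - 1/q)\<close>, positive because
      \<open>q \<ge> p > 1\<close>.\<close>
    then have "0 < (\<alpha> + 1) * (1 - 1 / q)" using p \<alpha> by (intro mult_pos_pos) auto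
    moreover have "1 / q \<le> 1 / p" using p by (intro divide_left_mono) auto
    moreover have "(\<alpha> + 2) / p = (\<alpha> + 1) / p + 1 / p" by (simp add: add_divide_distrib)
    moreover have "(\<alpha> + 2) * (1 - 1 / q) = (\<alpha> + 1) * (1 - 1 / q) + (1 - 1 / q)" by (simp add: algebra_simps add_divide_distrib)
    ultimately have "(\<alpha> + 1) / p - 1 < \<gamma>" unfolding \<gamma>_def by linarith
    then show ?thesis using False by (intro bergman_embed_A1_gt1[OF f]) auto
  qed
  show ?thesis
  proof (rule taylor_majorant_integrable[OF _ fin])
    show "f holomorphic_on ball 0 1" using f by (simp add: in_bergman_def)
    show "measure \<mu> {1 - (1 / 2) ^ j ..< 1} \<le> M * ((1 / 2) ^ j) powr (\<gamma> + 2)" for j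
      using M[of j] by (simp add: \<gamma>_def)
  qed
qed

section \<open>A discrete Schur test\<close>

text \<open>The inclusion of \<open>l^p\<close> in \<open>l^q\<close>: every term is at most the
  total \<open>B\<close>, so the surplus power of \<open>b j\<close> can be replaced by a power of
  \<open>B\<close>.\<close>

lemma suminf_powr_le:
  fixes b :: "nat \<Rightarrow> real"
  assumes b: "\<And>j. 0 \<le> b j" and p: "0 < p" "p \<le> q" and s: "summable (\<lambda>j. b j powr p)"
  shows "summable (\<lambda>j. b j powr q)" and "(\<Sum>j. b j powr q) \<le> (\<Sum>j. b j powr p) powr (q / p)"
proof -
  define B where "B = (\<Sum>j. b j powr p)"
  have B0: "0 \<le> B" unfolding B_def by (rule suminf_nonneg[OF s]) simp
  have bq: "b j powr q \<le> B powr ((q - p) / p) * b j powr p" for j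
  proof -
    have "b j powr p \<le> B"
      unfolding B_def using s by (intro sum_le_suminf[of _ "{j}", simplified]) auto
    then have "(b j powr p) powr ((q - p) / p) \<le> B powr ((q - p) / p)"
      using p by (intro powr_mono2) auto
    then have "(b j powr p) powr ((q - p) / p) * b j powr p \<le> B powr ((q - p) / p) * b j powr p"
      by (rule mult_right_mono) simp
    moreover have "(b j powr p) powr ((q - p) / p) * b j powr p = b j powr q"
      using p by (simp add: powr_powr flip: powr_add)
    ultimately show ?thesis by simp
  qed
  have s2: "summable (\<lambda>j. B powr ((q - p) / p) * b j powr p)" by (rule summable_mult[OF s])
  show sq: "summable (\<lambda>j. b j powr q)"
    by (rule summable_comparison_test'[OF s2, of 0]) (simp add: bq)
  have "(\<Sum>j. b j powr q) \<le> (\<Sum>j. B powr ((q - p) / p) * b j powr p)"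
    by (rule suminf_le[OF bq sq s2])
  also have "\<dots> = B powr ((q - p) / p) * B" unfolding B_def by (rule suminf_mult[OF s])
  also have "\<dots> = B powr (q / p)"
  proof (cases "B = 0")
    case False
    then have "B powr ((q - p) / p) * B = B powr ((q - p) / p + 1)"
      using B0 by (simp add: powr_add)
    also have "(q - p) / p + 1 = q / p" using p by (simp add: field_simps)
    finally show ?thesis .
  qed simp
  finally show "(\<Sum>j. b j powr q) \<le> (\<Sum>j. b j powr p) powr (q / p)" by (simp add: B_def)
qed

lemma suminf_swap_ennreal:
  fixes g :: "nat \<Rightarrow> nat \<Rightarrow> ennreal"
  shows "(\<Sum>i. \<Sum>j. g i j) = (\<Sum>j. \<Sum>i. g i j)"
proof -
  have "(\<Sum>i. \<Sum>j. g i j) = (\<integral>\<^sup>+i. (\<Sum>j. g i j) \<partial>count_space UNIV)"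
    by (simp add: nn_integral_count_space_nat)
  also have "\<dots> = (\<Sum>j. \<integral>\<^sup>+i. g i j \<partial>count_space UNIV)"
    by (rule nn_integral_suminf) simp
  finally show ?thesis by (simp add: nn_integral_count_space_nat)
qed

text \<open>Hoelder with respect to the weights \<open>k j\<close> of one row, of total weight at
  most \<open>K\<close>. For \<open>q = 1\<close> both sides carry the same sum, so a divergent row
  is admissible there.\<close>

lemma schur_row:
  fixes k b :: "nat \<Rightarrow> real"
  assumes k: "\<And>j. 0 \<le> k j" "\<And>j. k j \<le> 1" and b: "\<And>j. 0 \<le> b j" and q: "1 \<le> q"
    and s: "summable (\<lambda>j. b j powr q)" and K: "1 \<le> K"
    and row: "q = 1 \<or> (summable k \<and> suminf k \<le> K)"
  shows "summable (\<lambda>j. k j * b j)"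
    and "(\<Sum>j. k j * b j) powr q \<le> 2 powr q * K powr (q - 1) * (\<Sum>j. k j * b j powr q)"
    and "summable (\<lambda>j. k j * b j powr q)"
proof -
  have kb: "k j * b j powr q \<le> b j powr q" for j
    using k[of j] by (simp add: mult_left_le_one_le)
  show skb: "summable (\<lambda>j. k j * b j powr q)"
    by (rule summable_comparison_test'[OF s, of 0]) (use kb k in auto)
  define S where "S = (\<Sum>j. k j * b j powr q)"
  have S0: "0 \<le> S" unfolding S_def by (rule suminf_nonneg[OF skb]) (use k in auto)
  show sG: "summable (\<lambda>j. k j * b j)"
  proof (cases "q = 1")
    case True
    then show ?thesis using skb b by simp
  next
    case False
    then have "summable (\<lambda>j. k j + k j * b j powr q)"
      using row skb by (intro summable_add) auto
    then show ?thesis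
    proof (rule summable_comparison_test'[of _ 0])
      fix j
      show "norm (k j * b j) \<le> k j + k j * b j powr q"
        using mult_left_mono[OF le_add_powr_scaled[of 1 "b j" q] k(1)[of j]] b[of j] k(1)[of j] q
        by (simp add: distrib_left)
    qed
  qed
  define G where "G = (\<Sum>j. k j * b j)"
  have G0: "0 \<le> G" unfolding G_def by (rule suminf_nonneg[OF sG]) (use k b in auto)
  have "G powr q \<le> 2 powr q * K powr (q - 1) * S"
  proof (cases "q = 1 \<or> G = 0")
    case True
    then show ?thesis
    proof
      assume "q = 1"
      then have "G = S" using b by (simp add: G_def S_def)
      then show ?thesis using \<open>q = 1\<close> S0 K by simp
    next
      assume "G = 0"
      then show ?thesis using S0 by simp
    qed
  next
    case False
    then have G: "0 < G" and rk: "summable k" "suminf k \<le> K" using G0 row by auto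
    \<comment> \<open>Chosen so that \<open>A * K = G / 2\<close>: the row-sum term is absorbed into
      the left side.\<close>
    define A where "A = G / (2 * K)"
    have A: "0 < A" using G K by (simp add: A_def)
    have "G \<le> (\<Sum>j. A * k j + A powr (1 - q) * (k j * b j powr q))"
      unfolding G_def
    proof (rule suminf_le[OF _ sG])
      fix j
      show "k j * b j \<le> A * k j + A powr (1 - q) * (k j * b j powr q)"
        using mult_left_mono[OF le_add_powr_scaled[OF A b[of j] q] k(1)[of j]]
        by (simp add: algebra_simps)
    qed (intro summable_add summable_mult rk skb)
    also have "\<dots> = A * suminf k + A powr (1 - q) * S"
      unfolding S_def using rk skb
      by (subst suminf_add[symmetric]) (auto simp: suminf_mult)
    also have "\<dots> \<le> A * K + A powr (1 - q) * S"
      using rk A by (intro add_right_mono mult_left_mono) auto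
    also have "A * K = G / 2" using K by (simp add: A_def)
    finally have "G / 2 \<le> A powr (1 - q) * S" by simp
    then have "A powr (q - 1) * (G / 2) \<le> A powr (q - 1) * (A powr (1 - q) * S)"
      by (rule mult_left_mono) simp
    also have "\<dots> = S" using A by (simp add: mult.assoc[symmetric] flip: powr_add)
    finally have "A powr (q - 1) * (G / 2) \<le> S" .
    then have "2 powr q * K powr (q - 1) * (A powr (q - 1) * (G / 2)) \<le> 2 powr q * K powr (q - 1) * S"
      by (rule mult_left_mono) simp
    moreover have "2 powr q * K powr (q - 1) * (A powr (q - 1) * (G / 2)) = G powr q"
    proof -
      have "2 powr (q - 1) * K powr (q - 1) * A powr (q - 1) = (2 * K * A) powr (q - 1)"
        by (simp only: powr_mult)
      also have "2 * K * A = G" using K by (simp add: A_def)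
      finally have "2 powr (q - 1) * K powr (q - 1) * A powr (q - 1) = G powr (q - 1)" .
      moreover have "2 powr q = 2 powr (q - 1) * 2" "G powr q = G powr (q - 1) * G"
        using G by (simp_all add: powr_diff)
      ultimately show ?thesis by (simp add: mult_ac)
    qed
    ultimately show ?thesis by (simp only:)
  qed
  then show "(\<Sum>j. k j * b j) powr q \<le> 2 powr q * K powr (q - 1) * (\<Sum>j. k j * b j powr q)"
    by (simp add: G_def S_def)
qed

text \<open>After the row estimate the double sum is exchanged and column sums finish. Columns are
  measured in \<open>ennreal\<close>, so the exchange is unconditional.\<close>

lemma schur_test:
  fixes k :: "nat \<Rightarrow> nat \<Rightarrow> real" and b :: "nat \<Rightarrow> real"
  assumes k: "\<And>i j. 0 \<le> k i j" "\<And>i j. k i j \<le> 1" and b: "\<And>j. 0 \<le> b j" and q: "1 \<le> q"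
    and s: "summable (\<lambda>j. b j powr q)" and K: "1 \<le> K"
    and row: "q = 1 \<or> (\<forall>i. summable (k i) \<and> suminf (k i) \<le> K)"
    and col: "\<And>j. (\<Sum>i. ennreal (k i j)) \<le> ennreal K"
  shows "(\<Sum>i. ennreal ((\<Sum>j. k i j * b j) powr q)) \<le> ennreal (2 powr q * K powr q * (\<Sum>j. b j powr q))"
proof -
  define c where "c = 2 powr q * K powr (q - 1)"
  have c: "0 \<le> c" by (simp add: c_def)
  have row': "q = 1 \<or> (summable (k i) \<and> suminf (k i) \<le> K)" for i using row by auto
  note r = schur_row[where k = "k i" for i, OF k(1) k(2) b q s K row']
  have "(\<Sum>i. ennreal ((\<Sum>j. k i j * b j) powr q)) \<le> (\<Sum>i. \<Sum>j. ennreal (c * (k i j * b j powr q)))"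
  proof (intro suminf_le)
    fix i
    have "ennreal ((\<Sum>j. k i j * b j) powr q) \<le> ennreal (c * (\<Sum>j. k i j * b j powr q))"
      unfolding c_def by (intro ennreal_leI r)
    also have "\<dots> = (\<Sum>j. ennreal (c * (k i j * b j powr q)))"
      using r(3)[of i] c k by (intro suminf_ennreal_eq[symmetric] sums_mult summable_sums) auto
    finally show "ennreal ((\<Sum>j. k i j * b j) powr q) \<le> (\<Sum>j. ennreal (c * (k i j * b j powr q)))" .
  qed auto
  also have "\<dots> = (\<Sum>j. \<Sum>i. ennreal (c * (k i j * b j powr q)))"
    by (rule suminf_swap_ennreal)
  also have "\<dots> \<le> (\<Sum>j. ennreal (c * K * b j powr q))"
  proof (intro suminf_le)
    fix j
    have "(\<Sum>i. ennreal (c * (k i j * b j powr q))) = (\<Sum>i. ennreal (c * b j powr q) * ennreal (k i j))"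
      using c k by (intro arg_cong[of _ _ suminf] ext) (simp add: mult_ac flip: ennreal_mult)
    also have "\<dots> = ennreal (c * b j powr q) * (\<Sum>i. ennreal (k i j))" by simp
    also have "\<dots> \<le> ennreal (c * b j powr q) * ennreal K"
      by (intro mult_left_mono col) auto
    also have "\<dots> = ennreal (c * K * b j powr q)"
      using c K by (simp add: mult_ac flip: ennreal_mult)
    finally show "(\<Sum>i. ennreal (c * (k i j * b j powr q))) \<le> ennreal (c * K * b j powr q)" .
  qed auto
  also have "\<dots> = ennreal (c * K * (\<Sum>j. b j powr q))"
    using s c K by (intro suminf_ennreal_eq sums_mult summable_sums) auto
  also have "c * K = 2 powr q * K powr q"
    using K by (simp add: c_def powr_diff)
  finally show ?thesis .
qed

section \<open>The two-sided geometric kernel\<close>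

definition dyadic_kernel :: "real \<Rightarrow> real \<Rightarrow> nat \<Rightarrow> nat \<Rightarrow> real" where
  "dyadic_kernel X V i j = (if j \<le> i then X ^ (i - j) else V ^ (j - i))"

text \<open>The part of a column with \<open>i < j\<close> is left as a finite sum, since in the
  logarithmic case \<open>V = 1\<close> it equals \<open>j\<close> and has no uniform bound.\<close>

lemma dyadic_kernel_sums:
  assumes "0 < X" "X < 1"
  shows "(\<lambda>i. dyadic_kernel X V i j) sums (1 / (1 - X) + (\<Sum>i<j. V ^ (j - i)))"
proof -
  have "(\<lambda>i. dyadic_kernel X V (i + j) j) sums (1 / (1 - X))"
    using geometric_sums[of X] assms by (simp add: dyadic_kernel_def)
  then have "(\<lambda>i. dyadic_kernel X V i j) sums (1 / (1 - X) + (\<Sum>i<j. dyadic_kernel X V i j))"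
    by (subst (asm) sums_iff_shift)
  then show ?thesis by (simp add: dyadic_kernel_def)
qed

lemma dyadic_kernel_swap: "dyadic_kernel X V i j = dyadic_kernel V X j i"
  by (auto simp: dyadic_kernel_def)

lemma sum_reflected_powers_le:
  fixes V :: real
  assumes "0 \<le> V" "V < 1"
  shows "(\<Sum>i<j. V ^ (j - i)) \<le> 1 / (1 - V)"
proof -
  have "(\<Sum>i<j. V ^ (j - i)) \<le> (\<Sum>i<j. V ^ (j - Suc i))"
    using assms by (intro sum_mono power_decreasing) auto
  also have "\<dots> = (\<Sum>i<j. V ^ i)" by (rule sum.nat_diff_reindex)
  also have "\<dots> \<le> (\<Sum>i. V ^ i)" using assms by (intro sum_le_suminf) auto
  also have "\<dots> = 1 / (1 - V)" using assms by (intro suminf_geometric) auto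
  finally show ?thesis .
qed

lemma dyadic_kernel_bounds:
  assumes "0 < X" "X \<le> 1" "0 < V" "V \<le> 1"
  shows "0 \<le> dyadic_kernel X V i j" "dyadic_kernel X V i j \<le> 1"
  using assms by (auto simp: dyadic_kernel_def power_le_one)

text \<open>The kernel with the logarithmic weight has unbounded row sums, which is harmless for
  \<open>q = 1\<close>.\<close>

lemma hilb_kernel_bounds:
  fixes u v :: real and wt :: "nat \<Rightarrow> real"
  assumes u: "0 < u" and v: "0 \<le> v" and q: "1 \<le> q"
    and wt: "0 < v \<and> wt = (\<lambda>j. 1) \<or> v = 0 \<and> q = 1 \<and> wt = (\<lambda>j. real (Suc j))"
  defines "k \<equiv> (\<lambda>i j. dyadic_kernel (2 powr - u) (2 powr - v) i j / wt j)"
  obtains K where "1 \<le> K" "q = 1 \<or> (\<forall>i. summable (k i) \<and> suminf (k i) \<le> K)"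
    "\<And>j. (\<Sum>i. ennreal (k i j)) \<le> ennreal K" "\<And>i j. 0 \<le> k i j" "\<And>i j. k i j \<le> 1"
proof -
  define X V where "X = 2 powr - u" and "V = 2 powr - v"
  have X: "0 < X" "X < 1" and V: "0 < V" "V \<le> 1"
    using u v powr_less_mono[of "- u" 0 2] powr_mono[of "- v" 0 2] by (auto simp: X_def V_def)
  have l1: "1 \<le> wt j" for j using wt by auto
  have k01: "0 \<le> k i j" "k i j \<le> 1" for i j
    using dyadic_kernel_bounds[of X V i j] X V l1[of j]
    by (auto simp: k_def X_def V_def divide_le_eq intro: order_trans)
  have col: "(\<lambda>i. k i j) sums ((1 / (1 - X) + (\<Sum>i<j. V ^ (j - i))) / wt j)" for j
    unfolding k_def X_def[symmetric] V_def[symmetric] by (intro sums_divide dyadic_kernel_sums X)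
  have cole: "(\<Sum>i. ennreal (k i j)) = ennreal ((1 / (1 - X) + (\<Sum>i<j. V ^ (j - i))) / wt j)" for j
    using col k01 by (intro suminf_ennreal_eq) auto
  have X1: "1 \<le> 1 / (1 - X)" using X by simp
  from wt show thesis
  proof
    assume *: "0 < v \<and> wt = (\<lambda>j. 1)"
    have V1: "V < 1" using * powr_less_mono[of "- v" 0 2] by (simp add: V_def)
    show thesis
    proof (rule that[of "1 / (1 - X) + 1 / (1 - V)"])
      show "1 \<le> 1 / (1 - X) + 1 / (1 - V)" using X1 V1 by (simp add: add_increasing2)
      \<comment> \<open>A row is a column of the kernel with \<open>X\<close> and \<open>V\<close>
        exchanged.\<close>
      have row: "k i sums (1 / (1 - V) + (\<Sum>j<i. X ^ (i - j)))" for i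
        using dyadic_kernel_sums[OF V(1) V1, of X i] *
        using ext[of "dyadic_kernel X V i", OF dyadic_kernel_swap] by (simp add: k_def X_def[symmetric] V_def[symmetric])
      show "q = 1 \<or> (\<forall>i. summable (k i) \<and> suminf (k i) \<le> 1 / (1 - X) + 1 / (1 - V))"
        using row sums_summable[OF row] sums_unique[OF row, symmetric] sum_reflected_powers_le[of X] X by auto
      show "(\<Sum>i. ennreal (k i j)) \<le> ennreal (1 / (1 - X) + 1 / (1 - V))" for j
        unfolding cole using * sum_reflected_powers_le[of V j] V V1 by (intro ennreal_leI) auto
    qed (fact k01)+
  next
    assume *: "v = 0 \<and> q = 1 \<and> wt = (\<lambda>j. real (Suc j))"
    show thesis
    proof (rule that[of "1 / (1 - X) + 1"])
      show "1 \<le> 1 / (1 - X) + 1" using X by simp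
      show "q = 1 \<or> (\<forall>i. summable (k i) \<and> suminf (k i) \<le> 1 / (1 - X) + 1)" using * by simp
      show "(\<Sum>i. ennreal (k i j)) \<le> ennreal (1 / (1 - X) + 1)" for j
      proof -
        \<comment> \<open>With \<open>V = 1\<close> the column sum grows linearly, and the weight
          \<open>Suc j\<close> compensates exactly this growth.\<close>
        have "(\<Sum>i<j. V ^ (j - i)) = real j" using * by (simp add: V_def)
        moreover have "(1 / (1 - X) + real j) / real (Suc j) \<le> 1 / (1 - X) + 1"
        proof -
          have "Y + real j \<le> (Y + 1) * real (Suc j)" if "1 \<le> Y" for Y
            using that mult_nonneg_nonneg[of Y "real j"] by (simp add: algebra_simps)
          from this[OF X1] show ?thesis by (simp add: divide_le_eq)
        qed
        ultimately show ?thesis unfolding cole using * by (intro ennreal_leI) simp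
      qed
    qed (fact k01)+
  qed
qed

section \<open>Sufficiency of the Carleson condition\<close>

text \<open>Replacing \<open>t\<close> by 1 changes \<open>1 - t z\<close> by at most
  \<open>1 - t\<close>, which the first bound controls; this gives the factor 1/2 in the
  second.\<close>

lemma norm_one_minus_ge:
  assumes "0 \<le> t" "t < 1" "norm z < 1"
  shows "1 - t \<le> norm (1 - complex_of_real t * z)" "norm (1 - z) / 2 \<le> norm (1 - complex_of_real t * z)"
proof -
  have "t * norm z \<le> t * 1" using assms by (intro mult_left_mono) auto
  moreover have "norm (1::complex) - norm (complex_of_real t * z) \<le> norm (1 - complex_of_real t * z)"
    by (rule norm_triangle_ineq2)
  ultimately show 1: "1 - t \<le> norm (1 - complex_of_real t * z)"
    using assms by (simp add: norm_mult)
  have eq: "1 - z = (1 - complex_of_real t * z) - complex_of_real (1 - t) * z" by (simp add: algebra_simps)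
  have "norm (1 - z) \<le> norm (1 - complex_of_real t * z) + norm (complex_of_real (1 - t) * z)"
    unfolding eq by (rule norm_triangle_ineq4)
  also have "norm (complex_of_real (1 - t) * z) = (1 - t) * norm z"
    using assms by (simp only: norm_mult norm_of_real abs_of_nonneg)
  also have "(1 - t) * norm z \<le> (1 - t) * 1" using assms by (intro mult_left_mono) auto
  finally show "norm (1 - z) / 2 \<le> norm (1 - complex_of_real t * z)" using 1 by simp
qed

lemma dyadic_interval_bounds:
  assumes "t \<in> dyadic_interval j"
  shows "0 \<le> t" "t < 1" "(1 / 2) ^ j / 2 < 1 - t" "1 - t \<le> (1 / 2) ^ j"
  using assms UN_dyadic_interval by (auto simp: dyadic_interval_def)

lemma norm_one_minus_ge_dyadic:
  assumes "t \<in> dyadic_interval j" "z \<in> dyadic_ring i"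
  shows "(1 / 2) ^ min i j / 2 \<le> norm (1 - complex_of_real t * z)"
  using norm_one_minus_ge[of t z] dyadic_interval_bounds[OF assms(1)] assms(2)
  by (cases "i \<le> j") (auto simp: dyadic_ring_def)

text \<open>The exponents behind the reduction to \<open>dyadic_kernel\<close>: with \<open>u = e/q\<close> and
  \<open>v = e(1 - 1/q)\<close> the identity \<open>e min(i,j) - j v - i u = - (i - j) u\<close> or \<open>- (j - i) v\<close> holds.\<close>

lemma dyadic_kernel_identity:
  fixes u v :: real
  shows "(2 ^ min i j) powr (u + v) * ((1 / 2) ^ j) powr v
    = (2 ^ i) powr u * dyadic_kernel (2 powr - u) (2 powr - v) i j"
proof -
  have e: "(2 ^ n) powr s = 2 powr (real n * s)" "((1 / 2) ^ n) powr s = 2 powr (- real n * s)" for n s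
    by (simp_all add: powr_realpow[symmetric] powr_powr powr_divide powr_minus_divide power_one_over)
  have f: "(2 powr - s) ^ n = 2 powr (- s * real n)" for s n
    by (simp add: powr_realpow[symmetric] powr_powr)
  show ?thesis
    unfolding dyadic_kernel_def e f
    by (auto simp: min_def of_nat_diff algebra_simps simp flip: powr_add)
qed

text \<open>The kernel is at most \<open>2 powr e * (2 ^ min i j) powr e\<close> for
  \<open>t\<close> in \<open>dyadic_interval j\<close>. The growth exponent \<open>a\<close> of
  \<open>f\<close> cancels against the same summand in the Carleson exponent, and the remaining
  \<open>v\<close> combines with the kernel. The weight \<open>wt\<close> carries the
  logarithm.\<close>

lemma (in disc_measure) norm_hilb_op_ring_le:
  assumes f: "f holomorphic_on ball 0 1" "(\<integral>\<^sup>+t. (\<Sum>k. ennreal (norm (taylor_coeff f k) * t ^ k)) \<partial>\<mu>) < \<infinity>"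
    and e: "0 < e" and b: "\<And>j. 0 \<le> b j"
    and fb: "\<And>j t. t \<in> dyadic_interval j \<Longrightarrow> norm (f (complex_of_real t)) \<le> b j * (2 ^ j) powr a"
    and M: "\<And>j. measure \<mu> {1 - (1 / 2) ^ j ..< 1} \<le> M * ((1 / 2) ^ j) powr (a + v) / wt j"
    and wt: "\<And>j. 0 < wt j" and uv: "u + v = e" and z: "z \<in> dyadic_ring i"
  shows "ennreal (norm (hilb_op \<mu> e f z))
    \<le> (\<Sum>j. ennreal (2 powr e * M * (2 ^ i) powr u * (dyadic_kernel (2 powr - u) (2 powr - v) i j / wt j * b j)))"
proof -
  have zn: "norm z < 1" using z by (simp add: dyadic_ring_def)
  have M0: "0 \<le> M"
    using order_trans[OF measure_nonneg M[of 0]] wt[of 0] by (simp add: zero_le_divide_iff)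
  define g where "g = (\<lambda>t. f (complex_of_real t) * (1 - complex_of_real t * z) powr (- complex_of_real e))"
  have int: "integrable \<mu> g" unfolding g_def by (rule hilb_representation(4)[OF f(1) e f(2) zn])
  then have [measurable]: "g \<in> borel_measurable \<mu>" by simp
  have [measurable]: "dyadic_interval j \<in> sets \<mu>" for j
    using UN_dyadic_interval by (intro borel_sets_in) auto
  have gb: "norm (g t) \<le> b j * (2 ^ j) powr a * (2 powr e * (2 ^ min i j) powr e)" if t: "t \<in> dyadic_interval j" for t j
  proof -
    define x where "x = norm (1 - complex_of_real t * z)"
    have low: "(1 / 2) ^ min i j / 2 \<le> x" unfolding x_def by (rule norm_one_minus_ge_dyadic[OF t z])
    have "norm (g t) = norm (f (complex_of_real t)) * x powr (- e)"
      by (simp add: g_def x_def norm_mult norm_powr_real_powr')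
    also have "x powr (- e) \<le> ((1 / 2) ^ min i j / 2) powr (- e)"
      using low e by (intro powr_mono2') auto
    also have "((1 / 2) ^ min i j / 2) powr (- e) = 2 powr e * (2 ^ min i j) powr e"
      by (simp add: powr_minus powr_divide powr_mult power_one_over)
    finally show ?thesis
      using fb[OF t] b[of j] by (meson mult_mono norm_ge_zero order_trans mult_left_mono mult_right_mono powr_ge_zero mult_nonneg_nonneg)
  qed
  have "ennreal (norm (hilb_op \<mu> e f z)) = ennreal (norm (\<integral>t. g t \<partial>\<mu>))"
    unfolding g_def hilb_representation(5)[OF f(1) e f(2) zn] ..
  also have "\<dots> \<le> (\<integral>\<^sup>+t. ennreal (norm (g t)) \<partial>\<mu>)"
    using int by (rule integral_norm_bound_ennreal)
  also have "\<dots> = (\<integral>\<^sup>+t\<in>(\<Union>j. dyadic_interval j). ennreal (norm (g t)) \<partial>\<mu>)"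
    by (intro nn_integral_cong) (simp add: UN_dyadic_interval space_eq)
  also have "\<dots> = (\<Sum>j. \<integral>\<^sup>+t\<in>dyadic_interval j. ennreal (norm (g t)) \<partial>\<mu>)"
    by (intro nn_integral_disjoint_family disjoint_dyadic_interval) auto
  also have "\<dots> \<le> (\<Sum>j. ennreal (2 powr e * M * (2 ^ i) powr u * (dyadic_kernel (2 powr - u) (2 powr - v) i j / wt j * b j)))"
  proof (intro suminf_le)
    fix j
    define B where "B = b j * (2 ^ j) powr a * (2 powr e * (2 ^ min i j) powr e)"
    have B0: "0 \<le> B" using b by (simp add: B_def)
    have "(\<integral>\<^sup>+t\<in>dyadic_interval j. ennreal (norm (g t)) \<partial>\<mu>) \<le> (\<integral>\<^sup>+t. ennreal B * indicator (dyadic_interval j) t \<partial>\<mu>)"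
      using gb unfolding B_def by (intro nn_integral_mono) (auto split: split_indicator intro!: ennreal_leI)
    also have "\<dots> = ennreal B * emeasure \<mu> (dyadic_interval j)"
      by (rule nn_integral_cmult_indicator) simp
    also have "\<dots> \<le> ennreal B * ennreal (M * ((1 / 2) ^ j) powr (a + v) / wt j)"
    proof (intro mult_left_mono)
      have "emeasure \<mu> (dyadic_interval j) \<le> emeasure \<mu> {1 - (1 / 2) ^ j ..< 1}"
        by (intro emeasure_mono borel_sets_in) (auto simp: dyadic_interval_def power_le_one intro: less_le_trans)
      also have "\<dots> \<le> ennreal (M * ((1 / 2) ^ j) powr (a + v) / wt j)"
        unfolding emeasure_eq_measure by (intro ennreal_leI M)
      finally show "emeasure \<mu> (dyadic_interval j) \<le> ennreal (M * ((1 / 2) ^ j) powr (a + v) / wt j)" .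
    qed simp
    also have "\<dots> = ennreal (B * (M * ((1 / 2) ^ j) powr (a + v) / wt j))"
      using B0 M0 wt[of j] by (intro ennreal_mult[symmetric]) auto
    also have "B * (M * ((1 / 2) ^ j) powr (a + v) / wt j) =
      2 powr e * M * (2 ^ i) powr u * (dyadic_kernel (2 powr - u) (2 powr - v) i j / wt j * b j)"
    proof -
      \<comment> \<open>Here the growth of \<open>f\<close> cancels; what is left has the shape
        required by \<open>dyadic_kernel_identity\<close>.\<close>
      have "((1 / 2) ^ j) powr (a + v) = ((1 / 2) ^ j) powr v / (2 ^ j) powr a"
        by (simp add: powr_add powr_divide power_one_over)
      then have "B * (M * ((1 / 2) ^ j) powr (a + v) / wt j)
         = 2 powr e * M * ((2 ^ min i j) powr (u + v) * ((1 / 2) ^ j) powr v) * (b j / wt j)"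
        by (simp add: B_def uv)
      then show ?thesis by (simp only: dyadic_kernel_identity) (simp add: mult_ac)
    qed
    finally show "(\<integral>\<^sup>+t\<in>dyadic_interval j. ennreal (norm (g t)) \<partial>\<mu>) \<le>
       ennreal (2 powr e * M * (2 ^ i) powr u * (dyadic_kernel (2 powr - u) (2 powr - v) i j / wt j * b j))" .
  qed auto
  finally show ?thesis .
qed

text \<open>The normalising factor \<open>(2 ^ i) powr ((\<alpha> + 2) / q)\<close> is the one whose
  \<open>q\<close>-th power cancels the mass of the tent that contains the ring. It serves the
  images of the operator as well as the test functions.\<close>

lemma ring_mass_le_of_bound:
  assumes \<alpha>: "\<alpha> > -1"
  shows "\<exists>C>0. \<forall>F i B q. 0 \<le> B \<longrightarrow> 0 < q \<longrightarrow> (\<forall>z\<in>dyadic_ring i. norm (F z) \<le> B * (2 ^ i) powr ((\<alpha> + 2) / q)) \<longrightarrow>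
    ring_mass q \<alpha> F i \<le> ennreal (C * B powr q)"
proof -
  obtain C where C: "C > 0" "\<And>\<delta>. \<delta> > 0 \<Longrightarrow>
    (\<integral>\<^sup>+z. indicator {z. norm z < 1 \<and> norm (1 - z) \<le> \<delta>} z * ennreal (bergman_weight \<alpha> z) \<partial>lborel)
      \<le> ennreal (C * \<delta> powr (\<alpha> + 2))"
    using weight_tent_bound[OF \<alpha>] by blast
  show ?thesis
  proof (intro exI[of _ "C * 2 powr (\<alpha> + 2)"] conjI allI impI)
    show "0 < C * 2 powr (\<alpha> + 2)" using C by simp
    fix F :: "complex \<Rightarrow> complex" and i B q
    assume B: "0 \<le> B" and q: "0 < q" and F: "\<forall>z\<in>dyadic_ring i. norm (F z) \<le> B * (2 ^ i) powr ((\<alpha> + 2) / q)"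
    define D where "D = B powr q * (2 ^ i) powr (\<alpha> + 2)"
    define T where "T = {z :: complex. norm z < 1 \<and> norm (1 - z) \<le> 2 * (1 / 2) ^ i}"
    have [measurable]: "T \<in> sets borel" unfolding T_def by measurable
    have "ring_mass q \<alpha> F i \<le> (\<integral>\<^sup>+z. ennreal D * (indicator T z * ennreal (bergman_weight \<alpha> z)) \<partial>lborel)"
      unfolding ring_mass_def
    proof (intro nn_integral_mono)
      fix z
      show "indicator (dyadic_ring i) z * ennreal (norm (F z) powr q * bergman_weight \<alpha> z)
        \<le> ennreal D * (indicator T z * ennreal (bergman_weight \<alpha> z))"
      proof (cases "z \<in> dyadic_ring i")
        case True
        have "norm (F z) powr q \<le> (B * (2 ^ i) powr ((\<alpha> + 2) / q)) powr q"
          using F True q by (intro powr_mono2) auto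
        also have "\<dots> = D" using q by (simp add: D_def powr_mult powr_powr)
        finally have "norm (F z) powr q * bergman_weight \<alpha> z \<le> D * bergman_weight \<alpha> z"
          by (rule mult_right_mono) simp
        moreover have "z \<in> T" using True by (simp add: T_def dyadic_ring_def)
        ultimately show ?thesis using True by (simp add: D_def ennreal_leI flip: ennreal_mult)
      qed simp
    qed
    also have "\<dots> = ennreal D * (\<integral>\<^sup>+z. indicator T z * ennreal (bergman_weight \<alpha> z) \<partial>lborel)"
      by (rule nn_integral_cmult) measurable
    also have "\<dots> \<le> ennreal D * ennreal (C * (2 * (1 / 2) ^ i) powr (\<alpha> + 2))"
      unfolding T_def by (intro mult_left_mono C) auto
    also have "\<dots> = ennreal (D * (C * (2 * (1 / 2) ^ i) powr (\<alpha> + 2)))"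
      using C by (simp add: D_def flip: ennreal_mult)
    also have "D * (C * (2 * (1 / 2) ^ i) powr (\<alpha> + 2)) = C * 2 powr (\<alpha> + 2) * B powr q"
      by (simp add: D_def powr_mult powr_divide power_one_over)
    finally show "ring_mass q \<alpha> F i \<le> ennreal (C * 2 powr (\<alpha> + 2) * B powr q)" .
  qed
qed

text \<open>One statement for both parts: \<open>wt\<close> is constant for \<open>q > 1\<close>,
  and for \<open>q = 1\<close> it is \<open>Suc j\<close>, the dyadic form of the logarithm.\<close>

lemma (in disc_measure) hilb_bounded_if:
  fixes p q \<alpha> M :: real and wt :: "nat \<Rightarrow> real"
  assumes p: "0 < p" "p \<le> q" "1 \<le> q" and \<alpha>: "\<alpha> > -1"
    and wt: "1 < q \<and> wt = (\<lambda>j. 1) \<or> q = 1 \<and> wt = (\<lambda>j. real (Suc j))"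
    and M: "\<And>j. measure \<mu> {1 - (1 / 2) ^ j ..< 1}
      \<le> M * ((1 / 2) ^ j) powr ((\<alpha> + 2) / p + (\<alpha> + 2) * (1 - 1 / q)) / wt j"
  shows "hilb_bounded \<mu> (\<alpha> + 2) p \<alpha> q \<alpha>"
proof -
  define e where "e = \<alpha> + 2"
  define u where "u = e / q"
  define v where "v = e * (1 - 1 / q)"
  have e: "0 < e" using \<alpha> by (simp add: e_def)
  have u: "0 < u" using e p by (simp add: u_def)
  have v: "0 \<le> v" using e p by (simp add: v_def)
  have uv: "u + v = e" using p by (simp add: u_def v_def field_simps)
  have wt1: "1 \<le> wt j" for j using wt by auto
  have M0: "0 \<le> M"
    using order_trans[OF measure_nonneg M[of 0]] wt1[of 0] by (simp add: zero_le_divide_iff)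
  have wt': "0 < v \<and> wt = (\<lambda>j. 1) \<or> v = 0 \<and> q = 1 \<and> wt = (\<lambda>j. real (Suc j))"
    using wt e by (auto simp: v_def)
  define k where "k = (\<lambda>i j. dyadic_kernel (2 powr - u) (2 powr - v) i j / wt j)"
  obtain K where K: "1 \<le> K" "q = 1 \<or> (\<forall>i. summable (k i) \<and> suminf (k i) \<le> K)"
    "\<And>j. (\<Sum>i. ennreal (k i j)) \<le> ennreal K" "\<And>i j. 0 \<le> k i j" "\<And>i j. k i j \<le> 1"
    unfolding k_def by (rule hilb_kernel_bounds[OF u v p(3) wt']) (rule that[unfolded k_def])
  obtain C1 where C1: "C1 > 0" "\<And>f. in_bergman p \<alpha> f \<Longrightarrow> (\<exists>b. (\<forall>j. 0 \<le> b j)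
    \<and> (\<forall>j t. t \<in> dyadic_interval j \<longrightarrow> norm (f (complex_of_real t)) \<le> b j * (2 ^ j) powr ((\<alpha> + 2) / p))
    \<and> summable (\<lambda>j. b j powr p) \<and> (\<Sum>j. b j powr p) \<le> C1 * enn2real (bergman_integral p \<alpha> f))"
    using dyadic_majorant[OF p(1) \<alpha>] by blast
  obtain C2 where C2: "C2 > 0" "\<And>F i B q. 0 \<le> B \<Longrightarrow> 0 < q \<Longrightarrow> (\<forall>z\<in>dyadic_ring i. norm (F z) \<le> B * (2 ^ i) powr ((\<alpha> + 2) / q)) \<Longrightarrow>
    ring_mass q \<alpha> F i \<le> ennreal (C2 * B powr q)"
    using ring_mass_le_of_bound[OF \<alpha>] by blast
  define A where "A = C2 * (2 powr e * M) powr q * (2 powr q * K powr q)"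
  have A0: "0 \<le> A" using C2(1) by (simp add: A_def)
  define c where "c = (\<alpha> + 1) * (1 / pi)"
  have c0: "0 < c" using \<alpha> by (simp add: c_def)
  have main: "hilb_defined \<mu> e f \<and> in_bergman q \<alpha> (hilb_op \<mu> e f) \<and>
      enn2real (bergman_integral q \<alpha> (hilb_op \<mu> e f)) \<le> A * (C1 * enn2real (bergman_integral p \<alpha> f)) powr (q / p)"
    if f: "in_bergman p \<alpha> f" for f
  proof -
    have hol: "f holomorphic_on ball 0 1" using f by (simp add: in_bergman_def)
    \<comment> \<open>For absolute convergence the weight, which is at least 1, may be
      dropped.\<close>
    have M': "measure \<mu> {1 - (1 / 2) ^ j ..< 1} \<le> M * ((1 / 2) ^ j) powr ((\<alpha> + 2) / p + (\<alpha> + 2) * (1 - 1 / q))" for j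
    proof -
      have "M * ((1 / 2) ^ j) powr ((\<alpha> + 2) / p + (\<alpha> + 2) * (1 - 1 / q)) / wt j
         \<le> M * ((1 / 2) ^ j) powr ((\<alpha> + 2) / p + (\<alpha> + 2) * (1 - 1 / q)) / 1"
        using M0 wt1[of j] by (intro divide_left_mono) auto
      then show ?thesis using M[of j] by simp
    qed
    note fin = taylor_majorant_finite[OF f p \<alpha> M']
    define F where "F = hilb_op \<mu> e f"
    have Fhol: "F holomorphic_on ball 0 1" and def: "hilb_defined \<mu> e f"
      unfolding F_def by (rule hilb_representation[OF hol e fin])+
    obtain b where b: "\<And>j. 0 \<le> b j"
      "\<And>j t. t \<in> dyadic_interval j \<Longrightarrow> norm (f (complex_of_real t)) \<le> b j * (2 ^ j) powr ((\<alpha> + 2) / p)"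
      "summable (\<lambda>j. b j powr p)" "(\<Sum>j. b j powr p) \<le> C1 * enn2real (bergman_integral p \<alpha> f)"
      using C1(2)[OF f] by blast
    note bq = suminf_powr_le[OF b(1) p(1,2) b(3)]
    define G where "G = (\<lambda>i. \<Sum>j. k i j * b j)"
    have row': "q = 1 \<or> (summable (k i) \<and> suminf (k i) \<le> K)" for i using K(2) by auto
    have sG: "summable (\<lambda>j. k i j * b j)" for i
      by (rule schur_row(1)[OF K(4,5) b(1) p(3) bq(1) K(1) row'])
    have G0: "0 \<le> G i" for i
      unfolding G_def by (rule suminf_nonneg[OF sG]) (use K b in auto)
    have ring: "ring_mass q \<alpha> F i \<le> ennreal (C2 * (2 powr e * M * G i) powr q)" for i
    proof (rule C2(2), goal_cases)
      case 1
      show ?case using M0 G0[of i] by simp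
    next
      case 3
      show ?case
      proof
        fix z assume z: "z \<in> dyadic_ring i"
        have "ennreal (norm (F z)) \<le> (\<Sum>j. ennreal (2 powr e * M * (2 ^ i) powr u * (dyadic_kernel (2 powr - u) (2 powr - v) i j / wt j * b j)))"
          unfolding F_def
        proof (rule norm_hilb_op_ring_le[OF hol fin e b(1) b(2) _ _ uv z])
          show "measure \<mu> {1 - (1 / 2) ^ j ..< 1} \<le> M * ((1 / 2) ^ j) powr ((\<alpha> + 2) / p + v) / wt j" for j
            using M[of j] by (simp add: v_def e_def)
          show "0 < wt j" for j using wt1[of j] by simp
        qed
        also have "\<dots> = (\<Sum>j. ennreal (2 powr e * M * (2 ^ i) powr u * (k i j * b j)))"
          by (simp add: k_def)
        also have "\<dots> = ennreal (2 powr e * M * (2 ^ i) powr u * G i)"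
          unfolding G_def using sG[of i] M0 K(4) b(1) by (intro suminf_ennreal_eq sums_mult summable_sums) auto
        finally have "norm (F z) \<le> 2 powr e * M * (2 ^ i) powr u * G i"
          using M0 G0[of i] by simp
        then show "norm (F z) \<le> 2 powr e * M * G i * (2 ^ i) powr ((\<alpha> + 2) / q)"
          by (simp add: u_def e_def mult_ac)
      qed
    qed (use p in auto)
    have "bergman_integral q \<alpha> F = (\<Sum>i. ring_mass q \<alpha> F i)"
      by (rule bergman_integral_rings[OF Fhol])
    also have "\<dots> \<le> (\<Sum>i. ennreal (C2 * (2 powr e * M) powr q) * ennreal (G i powr q))"
      using ring C2(1) M0 G0 by (intro suminf_le) (auto simp: powr_mult mult.assoc simp flip: ennreal_mult)
    also have "\<dots> = ennreal (C2 * (2 powr e * M) powr q) * (\<Sum>i. ennreal (G i powr q))"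
      by simp
    also have "\<dots> \<le> ennreal (C2 * (2 powr e * M) powr q) * ennreal (2 powr q * K powr q * (\<Sum>j. b j powr q))"
      unfolding G_def by (intro mult_left_mono schur_test K b bq p) auto
    also have "\<dots> = ennreal (A * (\<Sum>j. b j powr q))"
      using C2(1) by (simp add: A_def mult.assoc flip: ennreal_mult')
    also have "\<dots> \<le> ennreal (A * (C1 * enn2real (bergman_integral p \<alpha> f)) powr (q / p))"
    proof (intro ennreal_leI mult_left_mono A0)
      have "(\<Sum>j. b j powr q) \<le> (\<Sum>j. b j powr p) powr (q / p)" by (rule bq)
      also have "\<dots> \<le> (C1 * enn2real (bergman_integral p \<alpha> f)) powr (q / p)"
        using b p by (intro powr_mono2 suminf_nonneg) auto
      finally show "(\<Sum>j. b j powr q) \<le> (C1 * enn2real (bergman_integral p \<alpha> f)) powr (q / p)" .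
    qed
    finally have le: "bergman_integral q \<alpha> F \<le> ennreal (A * (C1 * enn2real (bergman_integral p \<alpha> f)) powr (q / p))" .
    then have "bergman_integral q \<alpha> F < \<infinity>" by (rule le_less_trans) simp
    moreover have "enn2real (bergman_integral q \<alpha> F) \<le> A * (C1 * enn2real (bergman_integral p \<alpha> f)) powr (q / p)"
      using le A0 by (intro enn2real_leI) auto
    ultimately show ?thesis using def Fhol by (simp add: in_bergman_def F_def)
  qed
  \<comment> \<open>Obtained by taking the \<open>q\<close>-th root of
    \<open>c * (A * (C1 * I) powr (q / p))\<close> and restoring the normalising factor
    \<open>c powr (1 / p)\<close> of the norm.\<close>
  define L where "L = (c * A) powr (1 / q) * C1 powr (1 / p) / c powr (1 / p)"
  show ?thesis
    unfolding hilb_bounded_def e_def[symmetric]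
  proof (intro exI[of _ L] allI impI conjI)
    fix f assume f: "in_bergman p \<alpha> f"
    show "hilb_defined \<mu> e f" "in_bergman q \<alpha> (hilb_op \<mu> e f)" using main[OF f] by auto
    define I where "I = enn2real (bergman_integral p \<alpha> f)"
    have "bergman_norm q \<alpha> (hilb_op \<mu> e f) \<le> (c * (A * (C1 * I) powr (q / p))) powr (1 / q)"
      unfolding bergman_norm_def c_def[symmetric] I_def
      using main[OF f] c0 p by (intro powr_mono2 mult_left_mono) auto
    also have "\<dots> = (c * A) powr (1 / q) * C1 powr (1 / p) * I powr (1 / p)"
      using p by (simp add: powr_mult powr_powr mult.assoc)
    also have "\<dots> = L * bergman_norm p \<alpha> f"
      unfolding bergman_norm_def c_def[symmetric] I_def[symmetric] L_def
      using c0 by (simp add: powr_mult)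
    finally show "bergman_norm q \<alpha> (hilb_op \<mu> e f) \<le> L * bergman_norm p \<alpha> f" .
  qed
qed

section \<open>Test functions and necessity\<close>

text \<open>The order \<open>n\<close> is a natural number, so the denominator involves no branch of
  a complex power. In the estimates below \<open>a\<close> is the growth exponent
  \<open>(\<alpha> + 2) / p\<close>.\<close>

definition test_fun :: "real \<Rightarrow> nat \<Rightarrow> nat \<Rightarrow> complex \<Rightarrow> complex" where
  "test_fun a n m z = complex_of_real (((1 / 2) ^ m) powr (real n - a)) / (1 - complex_of_real (1 - (1 / 2) ^ m) * z) ^ n"

lemma test_fun_holomorphic: "\<exists>R>1. test_fun a n m holomorphic_on ball 0 R"
proof -
  define \<epsilon> where "\<epsilon> = (1 / 2 :: real) ^ m"
  have \<epsilon>: "0 < \<epsilon>" "\<epsilon> \<le> 1" by (auto simp: \<epsilon>_def power_le_one)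
  \<comment> \<open>A radius strictly between 1 and the pole \<open>1 / (1 - \<epsilon>)\<close>,
    written so that it also makes sense for \<open>m = 0\<close>, where
    \<open>\<epsilon> = 1\<close> and there is no pole.\<close>
  define R where "R = 2 / (2 - \<epsilon>)"
  have R: "1 < R" using \<epsilon> by (simp add: R_def)
  have "1 - complex_of_real (1 - \<epsilon>) * z \<noteq> 0" if z: "z \<in> ball 0 R" for z
  proof
    assume "1 - complex_of_real (1 - \<epsilon>) * z = 0"
    then have "complex_of_real (1 - \<epsilon>) * z = 1" by simp
    then have "norm (complex_of_real (1 - \<epsilon>) * z) = 1" by simp
    then have "(1 - \<epsilon>) * norm z = 1" using \<epsilon> by (simp only: norm_mult norm_of_real abs_of_nonneg)
    moreover have "(1 - \<epsilon>) * norm z \<le> (1 - \<epsilon>) * R" using z \<epsilon> by (intro mult_left_mono) auto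
    moreover have "(1 - \<epsilon>) * R < 1" using \<epsilon> by (simp add: R_def field_simps)
    ultimately show False by simp
  qed
  then have "test_fun a n m holomorphic_on ball 0 R"
    unfolding test_fun_def \<epsilon>_def[symmetric] by (intro holomorphic_intros) auto
  then show ?thesis using R by blast
qed

text \<open>The same exponent identity as for the operator, now with \<open>u = a\<close> and
  \<open>v = n - a\<close>: the test function has the size of a column of a dyadic kernel peaking at
  \<open>i = m\<close>.\<close>

lemma test_fun_ring_le:
  assumes z: "z \<in> dyadic_ring i"
  shows "norm (test_fun a n m z)
    \<le> 2 ^ n * dyadic_kernel (2 powr - a) (2 powr - (real n - a)) i m * (2 ^ i) powr a"
proof -
  define \<epsilon> where "\<epsilon> = (1 / 2 :: real) ^ m"
  have \<epsilon>: "0 < \<epsilon>" "\<epsilon> \<le> 1" by (auto simp: \<epsilon>_def power_le_one)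
  define x where "x = norm (1 - complex_of_real (1 - \<epsilon>) * z)"
  have zn: "norm z < 1" using z by (simp add: dyadic_ring_def)
  have x: "\<epsilon> \<le> x" "norm (1 - z) / 2 \<le> x"
    using norm_one_minus_ge[of "1 - \<epsilon>" z] \<epsilon> zn by (auto simp: x_def)
  then have low: "(1 / 2) ^ min i m / 2 \<le> x"
    using z \<epsilon> by (cases "i \<le> m") (auto simp: dyadic_ring_def \<epsilon>_def min_def)
  have "norm (test_fun a n m z) = \<epsilon> powr (real n - a) / x ^ n"
    by (simp add: test_fun_def \<epsilon>_def[symmetric] x_def norm_divide norm_power)
  also have "\<dots> \<le> \<epsilon> powr (real n - a) / ((1 / 2) ^ min i m / 2) ^ n"
    using low x(1) \<epsilon> by (intro divide_left_mono power_mono mult_pos_pos zero_less_power) auto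
  also have "\<dots> = 2 ^ n * ((2 ^ min i m) powr (a + (real n - a)) * \<epsilon> powr (real n - a))"
    by (simp add: power_divide powr_realpow power_one_over)
  also have "\<dots> = 2 ^ n * ((2 ^ i) powr a * dyadic_kernel (2 powr - a) (2 powr - (real n - a)) i m)"
    unfolding \<epsilon>_def dyadic_kernel_identity ..
  finally show ?thesis by (simp only: mult_ac)
qed

text \<open>A \<open>p\<close>-th power of a dyadic kernel is again a dyadic kernel, so the norms
  are bounded by column sums, uniformly in \<open>m\<close>. The condition on \<open>n\<close> makes
  the ratio \<open>V\<close> smaller than 1.\<close>

lemma test_fun_bergman:
  assumes p: "0 < p" and \<alpha>: "\<alpha> > -1" and n: "(\<alpha> + 2) / p < real n"
  shows "\<exists>C>0. \<forall>m. in_bergman p \<alpha> (test_fun ((\<alpha> + 2) / p) n m)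
    \<and> bergman_integral p \<alpha> (test_fun ((\<alpha> + 2) / p) n m) \<le> ennreal C"
proof -
  define a where "a = (\<alpha> + 2) / p"
  have a: "0 < a" using p \<alpha> by (simp add: a_def)
  obtain C2 where C2: "C2 > 0" "\<And>F i B q. 0 \<le> B \<Longrightarrow> 0 < q \<Longrightarrow> (\<forall>z\<in>dyadic_ring i. norm (F z) \<le> B * (2 ^ i) powr ((\<alpha> + 2) / q)) \<Longrightarrow>
    ring_mass q \<alpha> F i \<le> ennreal (C2 * B powr q)"
    using ring_mass_le_of_bound[OF \<alpha>] by blast
  define X V where "X = 2 powr - a" and "V = 2 powr - (real n - a)"
  define X' V' where "X' = X powr p" and "V' = V powr p"
  have "X < 1" "V < 1"
    using a n powr_less_mono[of "- a" 0 2] powr_less_mono[of "- (real n - a)" 0 2] by (auto simp: X_def V_def a_def)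
  moreover have X0: "0 < X" "0 < V" by (auto simp: X_def V_def)
  ultimately have X': "0 < X'" "X' < 1" "0 < V'" "V' < 1"
    using p powr_less_mono2[of p X 1] powr_less_mono2[of p V 1] by (auto simp: X'_def V'_def)
  have kp: "dyadic_kernel X V i m powr p = dyadic_kernel X' V' i m" for i m
    using X0 by (simp add: dyadic_kernel_def X'_def V'_def power_powr_swap)
  define C where "C = C2 * (2 ^ n) powr p * (1 / (1 - X') + 1 / (1 - V'))"
  have C: "0 < C" using C2(1) X' by (auto simp: C_def intro!: mult_pos_pos add_pos_pos)
  have "in_bergman p \<alpha> (test_fun a n m) \<and> bergman_integral p \<alpha> (test_fun a n m) \<le> ennreal C" for m
  proof -
    have hol: "test_fun a n m holomorphic_on ball 0 1"
      using test_fun_holomorphic[of a n m] by (auto elim!: holomorphic_on_subset)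
    have "bergman_integral p \<alpha> (test_fun a n m) = (\<Sum>i. ring_mass p \<alpha> (test_fun a n m) i)"
      by (rule bergman_integral_rings[OF hol])
    also have "\<dots> \<le> (\<Sum>i. ennreal (C2 * (2 ^ n) powr p * dyadic_kernel X' V' i m))"
    proof (intro suminf_le)
      fix i
      have "ring_mass p \<alpha> (test_fun a n m) i \<le> ennreal (C2 * (2 ^ n * dyadic_kernel X V i m) powr p)"
      proof (rule C2(2))
        show "0 \<le> 2 ^ n * dyadic_kernel X V i m" using X0 by (simp add: dyadic_kernel_def)
        show "\<forall>z\<in>dyadic_ring i. norm (test_fun a n m z) \<le> 2 ^ n * dyadic_kernel X V i m * (2 ^ i) powr ((\<alpha> + 2) / p)"
          using test_fun_ring_le[of _ i a n m] by (simp add: X_def V_def a_def)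
      qed (fact p)
      then show "ring_mass p \<alpha> (test_fun a n m) i \<le> ennreal (C2 * (2 ^ n) powr p * dyadic_kernel X' V' i m)"
        by (simp add: powr_mult kp mult.assoc)
    qed auto
    also have "\<dots> = ennreal (C2 * (2 ^ n) powr p * (1 / (1 - X') + (\<Sum>i<m. V' ^ (m - i))))"
      using C2(1) X' by (intro suminf_ennreal_eq sums_mult dyadic_kernel_sums) (auto simp: dyadic_kernel_def)
    also have "\<dots> \<le> ennreal C"
      unfolding C_def using C2(1) X' sum_reflected_powers_le[of V' m]
      by (intro ennreal_leI mult_left_mono add_left_mono) auto
    finally have le: "bergman_integral p \<alpha> (test_fun a n m) \<le> ennreal C" .
    then have "bergman_integral p \<alpha> (test_fun a n m) < \<infinity>" by (rule le_less_trans) simp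
    then show ?thesis using hol le by (simp add: in_bergman_def)
  qed
  then show ?thesis using C unfolding a_def by blast
qed

text \<open>Holomorphy beyond the circle makes the coefficients absolutely summable, so the integral
  representation is available before any Carleson condition on \<open>\<mu>\<close> is
  known.\<close>

lemma (in disc_measure) test_fun_majorant:
  "(\<integral>\<^sup>+t. (\<Sum>k. ennreal (norm (taylor_coeff (test_fun a n m) k) * t ^ k)) \<partial>\<mu>) < \<infinity>"
proof -
  obtain R where R: "R > 1" "test_fun a n m holomorphic_on ball 0 R"
    using test_fun_holomorphic by blast
  have s: "summable (\<lambda>k. norm (taylor_coeff (test_fun a n m) k))"
    using taylor_norm_summable[OF R(2), of 1] R(1) by simp
  have "(\<integral>\<^sup>+t. (\<Sum>k. ennreal (norm (taylor_coeff (test_fun a n m) k) * t ^ k)) \<partial>\<mu>)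
      \<le> (\<integral>\<^sup>+t. ennreal (\<Sum>k. norm (taylor_coeff (test_fun a n m) k)) \<partial>\<mu>)"
  proof (intro nn_integral_mono)
    fix t assume t: "t \<in> space \<mu>"
    have "(\<Sum>k. ennreal (norm (taylor_coeff (test_fun a n m) k) * t ^ k)) \<le> (\<Sum>k. ennreal (norm (taylor_coeff (test_fun a n m) k)))"
      using t by (intro suminf_le ennreal_leI mult_right_le_one_le) (auto simp: space_eq power_le_one)
    also have "\<dots> = ennreal (\<Sum>k. norm (taylor_coeff (test_fun a n m) k))"
      using s by (intro suminf_ennreal_eq summable_sums) auto
    finally show "(\<Sum>k. ennreal (norm (taylor_coeff (test_fun a n m) k) * t ^ k))
      \<le> ennreal (\<Sum>k. norm (taylor_coeff (test_fun a n m) k))" .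
  qed
  also have "\<dots> < \<infinity>"
    by (simp add: ennreal_mult_less_top emeasure_eq_measure)
  finally show ?thesis .
qed

text \<open>At a real point the integrand is positive, so the integral may be restricted to the tail
  where \<open>1 - t \<le> \<epsilon>\<close>. There the two denominators are at most
  \<open>2 * \<epsilon>\<close> and \<open>2 * \<eta>\<close>; the second bound uses
  \<open>i \<le> m\<close>, that is \<open>\<epsilon> \<le> \<eta>\<close>.\<close>

lemma (in disc_measure) hilb_test_fun_ge:
  assumes e: "0 < e" and i: "i \<le> m"
  shows "measure \<mu> {1 - (1 / 2) ^ m ..< 1} * (2 powr (- e) / 2 ^ n * (2 ^ m) powr a * (2 ^ i) powr e)
     \<le> norm (hilb_op \<mu> e (test_fun a n m) (complex_of_real (1 - (1 / 2) ^ i)))"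
proof -
  define \<epsilon> where "\<epsilon> = (1 / 2 :: real) ^ m"
  have \<epsilon>: "0 < \<epsilon>" "\<epsilon> \<le> 1" by (auto simp: \<epsilon>_def power_le_one)
  define \<eta> where "\<eta> = (1 / 2 :: real) ^ i"
  have \<eta>: "0 < \<eta>" "\<eta> \<le> 1" "\<epsilon> \<le> \<eta>" using half_power_mono[OF i] by (auto simp: \<eta>_def \<epsilon>_def power_le_one)
  define \<phi> where "\<phi> = (\<lambda>t. \<epsilon> powr (real n - a) / (1 - (1 - \<epsilon>) * t) ^ n * (1 - t * (1 - \<eta>)) powr (- e))"
  have hol: "test_fun a n m holomorphic_on ball 0 1"
    using test_fun_holomorphic[of a n m] by (auto elim!: holomorphic_on_subset)
  have x1: "norm (complex_of_real (1 - \<eta>)) < 1" using \<eta> by (simp only: norm_of_real)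
  have pos: "0 < 1 - (1 - \<epsilon>) * t" "0 < 1 - t * (1 - \<eta>)" if "t \<in> space \<mu>" for t
  proof -
    have "(1 - \<epsilon>) * t \<le> 1 * t" "t * (1 - \<eta>) \<le> t * 1"
      using that \<epsilon> \<eta> by (intro mult_right_mono mult_left_mono; simp add: space_eq)+
    then show "0 < 1 - (1 - \<epsilon>) * t" "0 < 1 - t * (1 - \<eta>)" using that by (auto simp: space_eq)
  qed
  have eq: "test_fun a n m (complex_of_real t) * (1 - complex_of_real t * complex_of_real (1 - \<eta>)) powr (- complex_of_real e)
    = complex_of_real (\<phi> t)" if t: "t \<in> space \<mu>" for t
  proof -
    have "(1 - complex_of_real t * complex_of_real (1 - \<eta>)) powr (- complex_of_real e)
        = complex_of_real (1 - t * (1 - \<eta>)) powr complex_of_real (- e)" by simp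
    also have "\<dots> = complex_of_real ((1 - t * (1 - \<eta>)) powr (- e))"
      using pos(2)[OF t] by (intro powr_of_real) simp
    finally show ?thesis by (simp add: test_fun_def \<phi>_def \<epsilon>_def[symmetric])
  qed
  note rep = hilb_representation(4,5)[OF hol e test_fun_majorant x1]
  have "integrable \<mu> (\<lambda>t. complex_of_real (\<phi> t))"
    using rep(1) by (subst (asm) Bochner_Integration.integrable_cong[OF refl eq]) auto
  then have int: "integrable \<mu> \<phi>" by (simp only: complex_of_real_integrable_eq)
  have op: "hilb_op \<mu> e (test_fun a n m) (complex_of_real (1 - \<eta>)) = complex_of_real (\<integral>t. \<phi> t \<partial>\<mu>)"
    unfolding rep(2) integral_complex_of_real[symmetric]
    by (intro Bochner_Integration.integral_cong refl eq)
  have \<phi>0: "0 \<le> \<phi> t" if "t \<in> space \<mu>" for t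
    using pos[OF that] by (simp add: \<phi>_def)
  define c where "c = 2 powr (- e) / 2 ^ n * (2 ^ m) powr a * (2 ^ i) powr e"
  have low: "c \<le> \<phi> t" if t: "t \<in> {1 - \<epsilon> ..< 1}" for t
  proof -
    have ts: "t \<in> space \<mu>" using t \<epsilon> by (auto simp: space_eq)
    have "(1 - \<epsilon>) * (1 - \<epsilon>) \<le> (1 - \<epsilon>) * t" using t \<epsilon> by (intro mult_left_mono) auto
    moreover have "1 - (1 - \<epsilon>) * (1 - \<epsilon>) \<le> 2 * \<epsilon>" by (simp add: algebra_simps)
    ultimately have 1: "1 - (1 - \<epsilon>) * t \<le> 2 * \<epsilon>" by linarith
    have "1 - t * (1 - \<eta>) = (1 - t) + t * \<eta>" by (simp add: algebra_simps)
    also have "\<dots> \<le> \<eta> + 1 * \<eta>" using t \<eta> by (intro add_mono mult_right_mono) auto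
    finally have 2: "1 - t * (1 - \<eta>) \<le> 2 * \<eta>" by simp
    \<comment> \<open>\<open>c\<close> is the integrand with both denominators replaced by these
      upper bounds.\<close>
    have "c = \<epsilon> powr (real n - a) / (2 * \<epsilon>) ^ n * (2 * \<eta>) powr (- e)"
      using \<epsilon> by (simp add: c_def powr_diff powr_realpow power_mult_distrib powr_mult \<eta>_def powr_minus powr_divide power_one_over)
        (simp add: \<epsilon>_def powr_divide power_one_over field_simps)
    also have "\<dots> \<le> \<phi> t"
      unfolding \<phi>_def using pos[OF ts] 1 2 e \<epsilon>
      by (intro mult_mono divide_left_mono power_mono powr_mono2' mult_pos_pos zero_less_power) auto
    finally show ?thesis .
  qed
  have As: "{1 - \<epsilon> ..< 1} \<in> sets \<mu>" using \<epsilon> by (intro borel_sets_in) auto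
  have "measure \<mu> {1 - \<epsilon> ..< 1} * c = (\<integral>t. c * indicator {1 - \<epsilon> ..< 1} t \<partial>\<mu>)"
    using Int_absorb2[OF sets.sets_into_space[OF As]] by simp
  also have "\<dots> \<le> (\<integral>t. \<phi> t \<partial>\<mu>)"
    using As \<phi>0 low by (intro integral_mono int integrable_mult_right integrable_real_indicator)
      (auto simp: emeasure_eq_measure split: split_indicator)
  also have "\<dots> \<le> norm (hilb_op \<mu> e (test_fun a n m) (complex_of_real (1 - \<eta>)))"
    unfolding op by simp
  finally show ?thesis by (simp add: c_def \<epsilon>_def \<eta>_def)
qed

text \<open>The images of the test functions have bounded norm in the target space, so their dyadic
  majorants have bounded \<open>q\<close>-sums; each majorant is tested at one real point per scale.
  For \<open>q > 1\<close> the term \<open>i = m\<close> is extracted later, for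
  \<open>q = 1\<close> the whole sum.\<close>

lemma (in disc_measure) hilb_bounded_imp:
  assumes p: "0 < p" and q: "0 < q" and \<alpha>: "\<alpha> > -1" and bdd: "hilb_bounded \<mu> (\<alpha> + 2) p \<alpha> q \<alpha>"
  shows "\<exists>D. \<forall>m. (\<Sum>i\<le>m. (measure \<mu> {1 - (1 / 2) ^ m ..< 1} * ((2 ^ m) powr ((\<alpha> + 2) / p) * (2 ^ i) powr (\<alpha> + 2))) powr q
       * ((1 / 2) ^ i) powr (\<alpha> + 2)) \<le> D"
proof -
  define e where "e = \<alpha> + 2"
  have e: "0 < e" using \<alpha> by (simp add: e_def)
  obtain n :: nat where n: "(\<alpha> + 2) / p < real n" using reals_Archimedean2 by blast
  obtain C where C: "C > 0" "\<And>m. in_bergman p \<alpha> (test_fun (e / p) n m)"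
    "\<And>m. bergman_integral p \<alpha> (test_fun (e / p) n m) \<le> ennreal C"
    using test_fun_bergman[OF p \<alpha> n] unfolding e_def by blast
  obtain L where L: "\<And>f. in_bergman p \<alpha> f \<Longrightarrow>
        hilb_defined \<mu> e f \<and> in_bergman q \<alpha> (hilb_op \<mu> e f) \<and>
        bergman_norm q \<alpha> (hilb_op \<mu> e f) \<le> L * bergman_norm p \<alpha> f"
    using bdd unfolding hilb_bounded_def e_def by blast
  obtain C1 where C1: "C1 > 0" "\<And>f. in_bergman q \<alpha> f \<Longrightarrow> (\<exists>b. (\<forall>j. 0 \<le> b j)
    \<and> (\<forall>j t. t \<in> dyadic_interval j \<longrightarrow> norm (f (complex_of_real t)) \<le> b j * (2 ^ j) powr (e / q))
    \<and> summable (\<lambda>j. b j powr q) \<and> (\<Sum>j. b j powr q) \<le> C1 * enn2real (bergman_integral q \<alpha> f))"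
    using dyadic_majorant[OF q \<alpha>] unfolding e_def by blast
  define c where "c = (\<alpha> + 1) * (1 / pi)"
  have c0: "0 < c" using \<alpha> by (simp add: c_def)
  define N where "N = (c * C) powr (1 / p)"
  define \<kappa> where "\<kappa> = 2 powr (- e) / 2 ^ n"
  have \<kappa>: "0 < \<kappa>" by (simp add: \<kappa>_def)
  have "(\<Sum>i\<le>m. (measure \<mu> {1 - (1 / 2) ^ m ..< 1} * ((2 ^ m) powr (e / p) * (2 ^ i) powr e)) powr q
       * ((1 / 2) ^ i) powr e) \<le> (1 / \<kappa>) powr q * (C1 * ((\<bar>L\<bar> * N) powr q / c))" for m
  proof -
    define F where "F = hilb_op \<mu> e (test_fun (e / p) n m)"
    have F: "in_bergman q \<alpha> F" "bergman_norm q \<alpha> F \<le> L * bergman_norm p \<alpha> (test_fun (e / p) n m)"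
      using L[OF C(2)] unfolding F_def by auto
    have "enn2real (bergman_integral p \<alpha> (test_fun (e / p) n m)) \<le> C"
      using C by (intro enn2real_leI) auto
    then have "bergman_norm p \<alpha> (test_fun (e / p) n m) \<le> N"
      unfolding bergman_norm_def c_def[symmetric] N_def using c0 p by (intro powr_mono2 mult_left_mono) auto
    moreover have "0 \<le> bergman_norm p \<alpha> (test_fun (e / p) n m)" by (simp add: bergman_norm_def)
    ultimately have "\<bar>L\<bar> * bergman_norm p \<alpha> (test_fun (e / p) n m) \<le> \<bar>L\<bar> * N"
      by (intro mult_left_mono) auto
    moreover have "L * bergman_norm p \<alpha> (test_fun (e / p) n m) \<le> \<bar>L\<bar> * bergman_norm p \<alpha> (test_fun (e / p) n m)"
      using \<open>0 \<le> bergman_norm p \<alpha> (test_fun (e / p) n m)\<close> by (intro mult_right_mono) auto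
    ultimately have "bergman_norm q \<alpha> F \<le> \<bar>L\<bar> * N" using F(2) by linarith
    then have "bergman_norm q \<alpha> F powr q \<le> (\<bar>L\<bar> * N) powr q"
      using q by (intro powr_mono2) (auto simp: bergman_norm_def)
    then have "c * enn2real (bergman_integral q \<alpha> F) \<le> (\<bar>L\<bar> * N) powr q"
      unfolding bergman_norm_def c_def[symmetric] using q c0 by (simp add: powr_powr)
    then have Fq: "enn2real (bergman_integral q \<alpha> F) \<le> (\<bar>L\<bar> * N) powr q / c"
      using c0 by (simp add: field_simps)
    obtain b where b: "\<And>j. 0 \<le> b j"
      "\<And>j t. t \<in> dyadic_interval j \<Longrightarrow> norm (F (complex_of_real t)) \<le> b j * (2 ^ j) powr (e / q)"
      "summable (\<lambda>j. b j powr q)" "(\<Sum>j. b j powr q) \<le> C1 * enn2real (bergman_integral q \<alpha> F)"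
      using C1(2)[OF F(1)] by blast
    have "(measure \<mu> {1 - (1 / 2) ^ m ..< 1} * ((2 ^ m) powr (e / p) * (2 ^ i) powr e)) powr q * ((1 / 2) ^ i) powr e
        \<le> (1 / \<kappa>) powr q * b i powr q" if i: "i \<le> m" for i
    proof -
      \<comment> \<open>The sampling point is the left endpoint of its interval, where the distance
        to 1 is exactly \<open>1/2^i\<close>.\<close>
      have "1 - (1 / 2 :: real) ^ i \<in> dyadic_interval i" by (simp add: dyadic_interval_def)
      then have "norm (F (complex_of_real (1 - (1 / 2) ^ i))) \<le> b i * (2 ^ i) powr (e / q)"
        by (rule b(2))
      moreover note hilb_test_fun_ge[OF e i, of n "e / p"]
      ultimately have "measure \<mu> {1 - (1 / 2) ^ m ..< 1} * (\<kappa> * (2 ^ m) powr (e / p) * (2 ^ i) powr e) \<le> b i * (2 ^ i) powr (e / q)"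
        unfolding F_def \<kappa>_def by linarith
      then have "measure \<mu> {1 - (1 / 2) ^ m ..< 1} * ((2 ^ m) powr (e / p) * (2 ^ i) powr e) \<le> (1 / \<kappa>) * b i * (2 ^ i) powr (e / q)"
        using \<kappa> by (simp add: field_simps)
      then have "(measure \<mu> {1 - (1 / 2) ^ m ..< 1} * ((2 ^ m) powr (e / p) * (2 ^ i) powr e)) powr q
         \<le> ((1 / \<kappa>) * b i * (2 ^ i) powr (e / q)) powr q"
        using q by (intro powr_mono2) auto
      also have "\<dots> = (1 / \<kappa>) powr q * b i powr q * (2 ^ i) powr e"
        using q by (simp only: powr_mult powr_powr) simp
      finally have "(measure \<mu> {1 - (1 / 2) ^ m ..< 1} * ((2 ^ m) powr (e / p) * (2 ^ i) powr e)) powr q * ((1 / 2) ^ i) powr e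
         \<le> (1 / \<kappa>) powr q * b i powr q * (2 ^ i) powr e * ((1 / 2) ^ i) powr e"
        by (rule mult_right_mono) simp
      then show ?thesis by (simp add: powr_divide power_one_over)
    qed
    then have "(\<Sum>i\<le>m. (measure \<mu> {1 - (1 / 2) ^ m ..< 1} * ((2 ^ m) powr (e / p) * (2 ^ i) powr e)) powr q
       * ((1 / 2) ^ i) powr e) \<le> (\<Sum>i\<le>m. (1 / \<kappa>) powr q * b i powr q)"
      by (intro sum_mono) auto
    also have "\<dots> = (1 / \<kappa>) powr q * (\<Sum>i\<le>m. b i powr q)" by (simp add: sum_distrib_left)
    also have "\<dots> \<le> (1 / \<kappa>) powr q * (C1 * ((\<bar>L\<bar> * N) powr q / c))"
    proof (intro mult_left_mono)
      have "(\<Sum>i\<le>m. b i powr q) \<le> (\<Sum>i. b i powr q)" using b(3) by (intro sum_le_suminf) auto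
      also note b(4)
      also have "C1 * enn2real (bergman_integral q \<alpha> F) \<le> C1 * ((\<bar>L\<bar> * N) powr q / c)"
        using C1(1) Fq by (intro mult_left_mono) auto
      finally show "(\<Sum>i\<le>m. b i powr q) \<le> C1 * ((\<bar>L\<bar> * N) powr q / c)" .
    qed simp
    finally show ?thesis .
  qed
  then show ?thesis unfolding e_def by blast
qed

section \<open>Carleson conditions on dyadic tails\<close>

context disc_measure
begin

lemma dyadic_tail_le:
  assumes "0 < \<delta>" "\<delta> \<le> 1"
  obtains n where "(1 / 2) ^ Suc n < \<delta>" "\<delta> \<le> (1 / 2) ^ n"
    "measure \<mu> {1 - \<delta> ..< 1} \<le> measure \<mu> {1 - (1 / 2) ^ n ..< 1}"
    "((1 / 2) ^ n) powr s \<le> max (1 powr s) (2 powr s) * \<delta> powr s"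
proof -
  obtain n where n: "(1 / 2) ^ Suc n < \<delta>" "\<delta> \<le> (1 / 2) ^ n"
    using dyadic_scale[OF assms] by auto
  have "measure \<mu> {1 - \<delta> ..< 1} \<le> measure \<mu> {1 - (1 / 2) ^ n ..< 1}"
    using n assms by (intro finite_measure_mono borel_sets_in) (auto simp: power_le_one intro: order_trans)
  moreover have "((1 / 2) ^ n) powr s \<le> max (1 powr s) (2 powr s) * \<delta> powr s"
    using n assms by (intro powr_comparable(2)) auto
  ultimately show thesis using that n by blast
qed

lemma carleson_iff_dyadic:
  "carleson s \<mu> \<longleftrightarrow> (\<exists>M. \<forall>j. measure \<mu> {1 - (1 / 2) ^ j ..< 1} \<le> M * ((1 / 2) ^ j) powr s)"
proof
  assume "carleson s \<mu>"
  then obtain C where C: "\<And>t. 0 \<le> t \<Longrightarrow> t < 1 \<Longrightarrow> emeasure \<mu> {t..<1} \<le> ennreal (C * (1 - t) powr s)"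
    by (auto simp: carleson_def)
  have "measure \<mu> {1 - (1 / 2) ^ j ..< 1} \<le> \<bar>C\<bar> * ((1 / 2) ^ j) powr s" for j
  proof -
    have "ennreal (measure \<mu> {1 - (1 / 2) ^ j ..< 1}) \<le> ennreal (C * (1 - (1 - (1 / 2) ^ j)) powr s)"
      using C[of "1 - (1 / 2) ^ j"] by (simp add: emeasure_eq_measure power_le_one)
    also have "\<dots> \<le> ennreal (\<bar>C\<bar> * ((1 / 2) ^ j) powr s)"
      by (intro ennreal_leI) (simp add: mult_right_mono)
    finally show ?thesis by simp
  qed
  then show "\<exists>M. \<forall>j. measure \<mu> {1 - (1 / 2) ^ j ..< 1} \<le> M * ((1 / 2) ^ j) powr s" by blast
next
  assume "\<exists>M. \<forall>j. measure \<mu> {1 - (1 / 2) ^ j ..< 1} \<le> M * ((1 / 2) ^ j) powr s"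
  then obtain M where M: "\<And>j. measure \<mu> {1 - (1 / 2) ^ j ..< 1} \<le> M * ((1 / 2) ^ j) powr s" by blast
  have M0: "0 \<le> M" using order_trans[OF measure_nonneg M[of 0]] by simp
  show "carleson s \<mu>"
    unfolding carleson_def
  proof (intro exI[of _ "M * max (1 powr s) (2 powr s)"] allI impI)
    fix t :: real assume t: "0 \<le> t \<and> t < 1"
    then obtain n where n: "measure \<mu> {1 - (1 - t) ..< 1} \<le> measure \<mu> {1 - (1 / 2) ^ n ..< 1}"
      "((1 / 2) ^ n) powr s \<le> max (1 powr s) (2 powr s) * (1 - t) powr s"
      using dyadic_tail_le[of "1 - t" s] by auto
    have "measure \<mu> {t..<1} \<le> M * ((1 / 2) ^ n) powr s" using n(1) M[of n] by simp
    also have "\<dots> \<le> M * (max (1 powr s) (2 powr s) * (1 - t) powr s)"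
      using n(2) M0 by (rule mult_left_mono)
    finally show "emeasure \<mu> {t..<1} \<le> ennreal (M * max (1 powr s) (2 powr s) * (1 - t) powr s)"
      by (simp add: emeasure_eq_measure ennreal_leI mult.assoc)
  qed
qed

text \<open>Taking moduli in the polar form of \<open>t\<close> removes the angle. Thus the arc
  starting at angle 0 has the largest trace on the radius, and arcs in other positions impose
  nothing new.\<close>

lemma carleson_box_trace_subset:
  "{t. 0 \<le> t \<and> t < 1 \<and> complex_of_real t \<in> carleson_box a L} \<subseteq> {1 - L / (2 * pi) ..< 1}"
  if "L \<le> 2 * pi"
proof
  fix t assume "t \<in> {t. 0 \<le> t \<and> t < 1 \<and> complex_of_real t \<in> carleson_box a L}"
  then obtain r \<theta> where t: "0 \<le> t" "t < 1" "complex_of_real t = complex_of_real r * cis \<theta>" "1 - L / (2 * pi) \<le> r"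
    by (auto simp: carleson_box_def)
  have "norm (complex_of_real t) = norm (complex_of_real r * cis \<theta>)" using t(3) by simp
  then have "t = \<bar>r\<bar>" using t(1) by (simp add: norm_mult)
  then show "t \<in> {1 - L / (2 * pi) ..< 1}" using t by auto
qed

lemma carleson_box_trace:
  assumes "0 < L" "L \<le> 2 * pi"
  shows "{t. 0 \<le> t \<and> t < 1 \<and> complex_of_real t \<in> carleson_box 0 L} = {1 - L / (2 * pi) ..< 1}"
proof (rule antisym[OF carleson_box_trace_subset[OF assms(2)] subsetI])
  fix t assume t: "t \<in> {1 - L / (2 * pi) ..< 1}"
  have "L / (2 * pi) \<le> 1" using assms by simp
  then have "0 \<le> t" "t < 1" using t unfolding atLeastLessThan_iff by linarith+
  moreover have "complex_of_real t \<in> carleson_box 0 L"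
  proof -
    have "complex_of_real t = complex_of_real t * cis 0 \<and> 0 \<le> (0::real) \<and> 0 \<le> 0 + L
        \<and> 1 - L / (2 * pi) \<le> t \<and> t \<le> 1"
      using assms t by simp
    then show ?thesis unfolding carleson_box_def by blast
  qed
  ultimately show "t \<in> {t. 0 \<le> t \<and> t < 1 \<and> complex_of_real t \<in> carleson_box 0 L}" by simp
qed

text \<open>For an arc of length \<open>2 * pi / 2 ^ j\<close> the logarithm is
  \<open>j * ln 2\<close>. The dyadic form has \<open>Suc j\<close> because the logarithm vanishes
  at \<open>j = 0\<close>, where the finite total mass takes over.\<close>

lemma log_carleson_iff_dyadic:
  assumes s: "0 < s"
  shows "log_carleson 1 s \<mu> \<longleftrightarrow>
    (\<exists>M. \<forall>j. measure \<mu> {1 - (1 / 2) ^ j ..< 1} \<le> M * ((1 / 2) ^ j) powr s / real (Suc j))"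
proof
  assume "log_carleson 1 s \<mu>"
  then obtain C where C: "\<And>a L. 0 < L \<Longrightarrow> L \<le> 2 * pi \<Longrightarrow>
        emeasure \<mu> {t. 0 \<le> t \<and> t < 1 \<and> complex_of_real t \<in> carleson_box a L} * ennreal ((ln (2 * pi / L)) powr 1)
        \<le> ennreal (C * L powr s)"
    by (auto simp: log_carleson_def)
  \<comment> \<open>The total mass settles \<open>j = 0\<close>. For \<open>j \<ge> 1\<close> the
    factor 2 comes from \<open>Suc j \<le> 2 * j\<close> and \<open>ln 2\<close> from the logarithm
    of \<open>2 ^ j\<close>.\<close>
  define M where "M = measure \<mu> {0..<1} + 2 / ln 2 * \<bar>C\<bar> * (2 * pi) powr s"
  have "measure \<mu> {1 - (1 / 2) ^ j ..< 1} \<le> M * ((1 / 2) ^ j) powr s / real (Suc j)" for j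
  proof (cases "j = 0")
    case True
    then show ?thesis by (simp add: M_def)
  next
    case False
    define L where "L = 2 * pi * (1 / 2) ^ j"
    have L: "0 < L" "L \<le> 2 * pi" "L / (2 * pi) = (1 / 2) ^ j" "2 * pi / L = 2 ^ j"
      using mult_left_mono[of "(1 / 2) ^ j" 1 "2 * pi"] by (auto simp: L_def power_le_one power_one_over)
    have "emeasure \<mu> {1 - (1 / 2) ^ j ..< 1} * ennreal (real j * ln 2) \<le> ennreal (C * L powr s)"
      using C[OF L(1,2), of 0] unfolding carleson_box_trace[OF L(1,2)] L(3,4) by (simp add: ln_realpow)
    also have "\<dots> \<le> ennreal (\<bar>C\<bar> * L powr s)" by (intro ennreal_leI mult_right_mono) auto
    finally have "measure \<mu> {1 - (1 / 2) ^ j ..< 1} * (real j * ln 2) \<le> \<bar>C\<bar> * L powr s"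
      by (simp add: emeasure_eq_measure flip: ennreal_mult)
    also have "L powr s = (2 * pi) powr s * ((1 / 2) ^ j) powr s" by (simp add: L_def powr_mult)
    finally have m: "measure \<mu> {1 - (1 / 2) ^ j ..< 1} * real j \<le> \<bar>C\<bar> * ((2 * pi) powr s * ((1 / 2) ^ j) powr s) / ln 2"
      by (simp add: pos_le_divide_eq mult.assoc)
    have "measure \<mu> {1 - (1 / 2) ^ j ..< 1} * real (Suc j) \<le> measure \<mu> {1 - (1 / 2) ^ j ..< 1} * (2 * real j)"
      using False by (intro mult_left_mono) auto
    also have "\<dots> \<le> 2 / ln 2 * \<bar>C\<bar> * (2 * pi) powr s * ((1 / 2) ^ j) powr s"
      using mult_left_mono[OF m, of 2] by (simp add: mult_ac)
    also have "\<dots> \<le> M * ((1 / 2) ^ j) powr s"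
      by (intro mult_right_mono) (auto simp: M_def)
    finally show ?thesis by (simp add: pos_le_divide_eq)
  qed
  then show "\<exists>M. \<forall>j. measure \<mu> {1 - (1 / 2) ^ j ..< 1} \<le> M * ((1 / 2) ^ j) powr s / real (Suc j)" by blast
next
  assume "\<exists>M. \<forall>j. measure \<mu> {1 - (1 / 2) ^ j ..< 1} \<le> M * ((1 / 2) ^ j) powr s / real (Suc j)"
  then obtain M where M: "\<And>j. measure \<mu> {1 - (1 / 2) ^ j ..< 1} \<le> M * ((1 / 2) ^ j) powr s / real (Suc j)" by blast
  have M0: "0 \<le> M" using order_trans[OF measure_nonneg M[of 0]] by simp
  define K where "K = max (1 powr s) (2 powr s)"
  have K0: "0 \<le> K" by (simp add: K_def le_max_iff_disj)
  show "log_carleson 1 s \<mu>"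
    unfolding log_carleson_def
  proof (intro exI[of _ "M * K / (2 * pi) powr s"] allI impI)
    fix a L :: real assume L: "0 < L \<and> L \<le> 2 * pi"
    define \<delta> where "\<delta> = L / (2 * pi)"
    have \<delta>: "0 < \<delta>" "\<delta> \<le> 1" "2 * pi / L = 1 / \<delta>" using L by (auto simp: \<delta>_def)
    obtain n where n: "(1 / 2) ^ Suc n < \<delta>" "measure \<mu> {1 - \<delta> ..< 1} \<le> measure \<mu> {1 - (1 / 2) ^ n ..< 1}"
      "((1 / 2) ^ n) powr s \<le> K * \<delta> powr s"
      unfolding K_def using dyadic_tail_le[OF \<delta>(1,2), of s] by metis
    have "1 / \<delta> \<le> 2 ^ Suc n" using n(1) \<delta>(1) by (simp add: power_one_over field_simps)
    then have "ln (1 / \<delta>) \<le> ln (2 ^ Suc n)" using \<delta> by (subst ln_le_cancel_iff) auto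
    also have "\<dots> = real (Suc n) * ln 2" by (rule ln_realpow)
    also have "\<dots> \<le> real (Suc n) * 1" using ln_2_less_1 by (intro mult_left_mono) auto
    finally have ln_le: "ln (1 / \<delta>) \<le> real (Suc n)" by simp
    have ln0: "0 \<le> ln (1 / \<delta>)" using \<delta> by (intro ln_ge_zero) auto
    have "measure \<mu> {1 - \<delta> ..< 1} * ln (1 / \<delta>) \<le> measure \<mu> {1 - (1 / 2) ^ n ..< 1} * real (Suc n)"
      using n(2) ln_le ln0 by (intro mult_mono) auto
    also have "\<dots> \<le> M * ((1 / 2) ^ n) powr s"
      using M[of n] by (simp add: pos_le_divide_eq)
    also have "\<dots> \<le> M * (K * \<delta> powr s)" using n(3) M0 by (rule mult_left_mono)
    also have "\<delta> powr s = L powr s / (2 * pi) powr s"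
      using L by (simp add: \<delta>_def powr_divide)
    finally have le: "measure \<mu> {1 - \<delta> ..< 1} * ln (1 / \<delta>) \<le> M * K / (2 * pi) powr s * L powr s" by simp
    have "emeasure \<mu> {t. 0 \<le> t \<and> t < 1 \<and> complex_of_real t \<in> carleson_box a L} \<le> emeasure \<mu> {1 - \<delta> ..< 1}"
      unfolding \<delta>_def using carleson_box_trace_subset[of L a] L \<delta>(2)
      by (intro emeasure_mono borel_sets_in) (auto simp: \<delta>_def)
    then have "emeasure \<mu> {t. 0 \<le> t \<and> t < 1 \<and> complex_of_real t \<in> carleson_box a L} *
          ennreal (if (1::real) = 0 then 1 else (ln (2 * pi / L)) powr 1) \<le> emeasure \<mu> {1 - \<delta> ..< 1} * ennreal (ln (1 / \<delta>))"
      unfolding \<delta>(3) using ln0 by (auto intro!: mult_right_mono)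
    also have "\<dots> = ennreal (measure \<mu> {1 - \<delta> ..< 1} * ln (1 / \<delta>))"
      using ln0 by (simp add: emeasure_eq_measure ennreal_mult)
    also have "\<dots> \<le> ennreal (M * K / (2 * pi) powr s * L powr s)" by (intro ennreal_leI le)
    finally show "emeasure \<mu> {t. 0 \<le> t \<and> t < 1 \<and> complex_of_real t \<in> carleson_box a L} *
          ennreal (if (1::real) = 0 then 1 else (ln (2 * pi / L)) powr 1)
        \<le> ennreal (M * K / (2 * pi) powr s * L powr s)" .
  qed
qed

section \<open>The two equivalences\<close>

lemma hilb_bounded_iff_carleson:
  assumes p: "0 < p" and q: "p \<le> q" "1 < q" and \<alpha>: "\<alpha> > -1"
  shows "hilb_bounded \<mu> (\<alpha> + 2) p \<alpha> q \<alpha> \<longleftrightarrow> carleson ((\<alpha> + 2) / p + (\<alpha> + 2) * (1 - 1 / q)) \<mu>"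
proof
  assume "carleson ((\<alpha> + 2) / p + (\<alpha> + 2) * (1 - 1 / q)) \<mu>"
  then obtain M where M: "\<And>j. measure \<mu> {1 - (1 / 2) ^ j ..< 1}
      \<le> M * ((1 / 2) ^ j) powr ((\<alpha> + 2) / p + (\<alpha> + 2) * (1 - 1 / q))"
    unfolding carleson_iff_dyadic by blast
  show "hilb_bounded \<mu> (\<alpha> + 2) p \<alpha> q \<alpha>"
    by (rule hilb_bounded_if[OF p q(1) _ \<alpha>, of "\<lambda>j. 1"]) (use q M in auto)
next
  assume bdd: "hilb_bounded \<mu> (\<alpha> + 2) p \<alpha> q \<alpha>"
  define e where "e = \<alpha> + 2"
  define s where "s = e / p + e * (1 - 1 / q)"
  have q0: "0 < q" using q by simp
  obtain D where D: "\<And>m. (\<Sum>i\<le>m. (measure \<mu> {1 - (1 / 2) ^ m ..< 1} * ((2 ^ m) powr (e / p) * (2 ^ i) powr e)) powr q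
       * ((1 / 2) ^ i) powr e) \<le> D"
    using hilb_bounded_imp[OF p q0 \<alpha> bdd] unfolding e_def by blast
  have "measure \<mu> {1 - (1 / 2) ^ m ..< 1} \<le> D powr (1 / q) * ((1 / 2) ^ m) powr s" for m
  proof -
    define x where "x = measure \<mu> {1 - (1 / 2) ^ m ..< 1}"
    \<comment> \<open>The last term \<open>i = m\<close> alone yields the sharp power: its exponent
      is \<open>e / p + e - e / q\<close>, which is \<open>s\<close>.\<close>
    have "(x * ((2 ^ m) powr (e / p) * (2 ^ m) powr e)) powr q * ((1 / 2) ^ m) powr e
      \<le> (\<Sum>i\<le>m. (x * ((2 ^ m) powr (e / p) * (2 ^ i) powr e)) powr q * ((1 / 2) ^ i) powr e)"
      by (rule member_le_sum) auto
    also have "\<dots> \<le> D" unfolding x_def by (rule D)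
    also have "(x * ((2 ^ m) powr (e / p) * (2 ^ m) powr e)) powr q * ((1 / 2) ^ m) powr e = (x * (2 ^ m) powr s) powr q"
    proof -
      have "((1 / 2) ^ m) powr e = ((2 ^ m) powr (- e / q)) powr q"
        using q0 by (simp add: powr_powr powr_divide powr_minus_divide power_one_over)
      then have "(x * ((2 ^ m) powr (e / p) * (2 ^ m) powr e)) powr q * ((1 / 2) ^ m) powr e
        = (x * ((2 ^ m) powr (e / p) * (2 ^ m) powr e) * (2 ^ m) powr (- e / q)) powr q"
        by (simp only: powr_mult)
      also have "x * ((2 ^ m) powr (e / p) * (2 ^ m) powr e) * (2 ^ m) powr (- e / q) = x * (2 ^ m) powr s"
        by (simp add: s_def algebra_simps flip: powr_add)
      finally show ?thesis .
    qed
    finally have "((x * (2 ^ m) powr s) powr q) powr (1 / q) \<le> D powr (1 / q)"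
      using q0 by (intro powr_mono2) auto
    then have "x * (2 ^ m) powr s \<le> D powr (1 / q)"
      using q0 by (simp add: powr_powr x_def)
    then show ?thesis
      by (simp add: x_def powr_divide power_one_over field_simps)
  qed
  then show "carleson ((\<alpha> + 2) / p + (\<alpha> + 2) * (1 - 1 / q)) \<mu>"
    unfolding carleson_iff_dyadic e_def s_def by blast
qed

lemma hilb_bounded_iff_log_carleson:
  assumes p: "0 < p" "p \<le> 1" and \<alpha>: "\<alpha> > -1"
  shows "hilb_bounded \<mu> (\<alpha> + 2) p \<alpha> 1 \<alpha> \<longleftrightarrow> log_carleson 1 ((\<alpha> + 2) / p) \<mu>"
proof -
  have s: "0 < (\<alpha> + 2) / p" using p \<alpha> by simp
  show ?thesis
  proof
    assume "log_carleson 1 ((\<alpha> + 2) / p) \<mu>"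
    then obtain M where M: "\<And>j. measure \<mu> {1 - (1 / 2) ^ j ..< 1} \<le> M * ((1 / 2) ^ j) powr ((\<alpha> + 2) / p) / real (Suc j)"
      unfolding log_carleson_iff_dyadic[OF s] by blast
    show "hilb_bounded \<mu> (\<alpha> + 2) p \<alpha> 1 \<alpha>"
      by (rule hilb_bounded_if[OF p _ \<alpha>, of "\<lambda>j. real (Suc j)" M]) (use M in simp_all)
  next
    assume bdd: "hilb_bounded \<mu> (\<alpha> + 2) p \<alpha> 1 \<alpha>"
    define e where "e = \<alpha> + 2"
    obtain D where D: "\<And>m. (\<Sum>i\<le>m. (measure \<mu> {1 - (1 / 2) ^ m ..< 1} * ((2 ^ m) powr (e / p) * (2 ^ i) powr e)) powr 1
         * ((1 / 2) ^ i) powr e) \<le> D"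
      using hilb_bounded_imp[OF p(1) zero_less_one \<alpha> bdd] unfolding e_def by blast
    have "measure \<mu> {1 - (1 / 2) ^ m ..< 1} \<le> D * ((1 / 2) ^ m) powr (e / p) / real (Suc m)" for m
    proof -
      \<comment> \<open>For \<open>q = 1\<close> the powers of \<open>2 ^ i\<close> cancel, so all
        \<open>m + 1\<close> summands agree; their number is the logarithmic factor.\<close>
      have eq: "(measure \<mu> {1 - (1 / 2) ^ m ..< 1} * ((2 ^ m) powr (e / p) * (2 ^ i) powr e)) powr 1 * ((1 / 2) ^ i) powr e
        = measure \<mu> {1 - (1 / 2) ^ m ..< 1} * (2 ^ m) powr (e / p)" for i
        by (simp add: powr_divide power_one_over)
      have "real (Suc m) * (measure \<mu> {1 - (1 / 2) ^ m ..< 1} * (2 ^ m) powr (e / p)) \<le> D"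
        using D[of m] unfolding eq by simp
      then have "measure \<mu> {1 - (1 / 2) ^ m ..< 1} * (real (Suc m) * (2 ^ m) powr (e / p)) \<le> D"
        by (simp only: mult_ac)
      then have "measure \<mu> {1 - (1 / 2) ^ m ..< 1} \<le> D / (real (Suc m) * (2 ^ m) powr (e / p))"
        by (subst pos_le_divide_eq) auto
      then show ?thesis by (simp add: powr_divide power_one_over mult.commute)
    qed
    then show "log_carleson 1 ((\<alpha> + 2) / p) \<mu>"
      unfolding log_carleson_iff_dyadic[OF s] e_def by blast
  qed
qed

end

theorem theorem4p01:
  fixes p q \<alpha> :: real and \<mu> :: "real measure"
  assumes "0 < p" and "\<alpha> > -1"
    and "sets \<mu> = sets (restrict_space borel {0..<1})"
    and "cond_W p \<alpha> \<mu>"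
  shows "(q \<ge> p \<and> q > 1 \<longrightarrow>
           (hilb_bounded \<mu> (\<alpha> + 2) p \<alpha> q \<alpha> \<longleftrightarrow>
            carleson ((\<alpha> + 2) / p + (\<alpha> + 2) / (q / (q - 1))) \<mu>))
       \<and> (q \<ge> p \<and> q = 1 \<longrightarrow>
           (hilb_bounded \<mu> (\<alpha> + 2) p \<alpha> 1 \<alpha> \<longleftrightarrow>
            log_carleson 1 ((\<alpha> + 2) / p) \<mu>))"
proof -
  \<comment> \<open>Whichever range \<open>p\<close> lies in, condition W supplies some Carleson
    exponent, and its bound at \<open>t = 0\<close> makes the total mass finite.\<close>
  have "\<exists>s. carleson s \<mu>"
    using assms(1,4) unfolding cond_W_def by (meson linear)
  then obtain s C where "emeasure \<mu> {0..<1} \<le> ennreal (C * (1 - 0) powr s)"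
    unfolding carleson_def by (metis order_refl zero_less_one)
  then have "emeasure \<mu> {0..<1} \<noteq> \<infinity>"
    by (auto simp: top_unique)
  moreover have "space \<mu> = {0..<1}"
    using sets_eq_imp_space_eq[OF assms(3)] by (simp add: space_restrict_space)
  ultimately have "finite_measure \<mu>"
    by (intro finite_measureI) simp
  then interpret disc_measure \<mu>
    by (intro disc_measure.intro disc_measure_axioms.intro assms(3))
  \<comment> \<open>The conjugate exponent is \<open>q / (q - 1)\<close>, with reciprocal
    \<open>1 - 1 / q\<close>.\<close>
  have "(\<alpha> + 2) / (q / (q - 1)) = (\<alpha> + 2) * (1 - 1 / q)" if "q > 1"
    using that by (simp add: field_simps)
  then show ?thesis
    using hilb_bounded_iff_carleson[of p q \<alpha>] hilb_bounded_iff_log_carleson[of p \<alpha>] assms(1,2) by auto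
qed

end
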